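(* Let $w\in\mathbb C$ and let $y$ be real with $-\pi/4<y<\pi/4$. Then for all $s\in\mathbb C$, $$\xi_{\mathbb Q}(w,s)=\frac12\int_{-\infty}^\infty\gamma(w,x+iy)\,e^{(x+iy)s}\,dx .$$ Moreover, for fixed $\sigma\in\mathbb R$ the function $x\mapsto e^{\sigma x}\gamma(w,x+iy)$ belongs to $\mathcal S(\mathbb R)$, and the Schwartz constants are uniform on compact subsets of $\{(w,\sigma,y):w\in\mathbb C,\sigma\in\mathbb R,-\pi/4<y<\pi/4\}$.
   Context: For $\Re(\tau)>0$ let $\theta(\tau)=\sum_{n\in\mathbb Z}e^{-\pi n^2\tau}$; it has no zeros on $\Re(\tau)>0$, and $\theta(\tau)^w:=e^{w\log\theta(\tau)}$ with the branch of $\log\theta$ on $\{\Re\tau>0\}$ that is real on the positive real axis. For $w\in\mathbb C$ and $z=x+iy$ with $|y|<\pi/4$ (so $\Re(e^{2z})>0$) define $h(w,z)=\frac{\theta(e^{2z})^w-1}{w}$ if $w\neq0$ and $h(0,z)=\log\theta(e^{2z})$, and $\gamma(w,z)=\bigl(\frac{d^2}{dz^2}+w\frac{d}{dz}\bigr)h(w,z)$. $Z_{\mathbb Q}(w,s)=\int_0^\infty\theta(t^2)^s\theta(1/t^2)^{w-s}\frac{dt}{t}$ for $\Re(w)<\Re(s)<0$, continued meromorphically; $\xi_{\mathbb Q}(w,s)=\frac{s(s-w)}{2w}Z_{\mathbb Q}(w,s)$ denotes its entire extension to $\mathbb C^2$. $\mathcal S(\mathbb R)$ is the Schwartz space. 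*)

theory Defs
  imports "HOL-Complex_Analysis.Complex_Analysis"
begin

definition theta :: "complex \<Rightarrow> complex" where
  "theta \<tau> = (\<Sum>\<^sub>\<infinity>n::int. exp (- of_real pi * (of_int n)\<^sup>2 * \<tau>))"

text \<open>
  The branch of the logarithm of \<open>theta\<close> on the right half-plane that is real on the positive
  real axis. It is unique on the half-plane; outside of it the value is irrelevant. This is not
  the composition of the principal logarithm \<open>Ln\<close> with \<open>theta\<close>.
\<close>

definition log_theta :: "complex \<Rightarrow> complex" where
  "log_theta = (SOME L. L holomorphic_on {\<tau>. Re \<tau> > 0} \<and>
                        (\<forall>\<tau>. Re \<tau> > 0 \<longrightarrow> exp (L \<tau>) = theta \<tau>) \<and>
                        (\<forall>t::real. t > 0 \<longrightarrow> L (of_real t) \<in> \<real>))"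

definition theta_pow :: "complex \<Rightarrow> complex \<Rightarrow> complex" where
  "theta_pow \<tau> w = exp (w * log_theta \<tau>)"

definition h :: "complex \<Rightarrow> complex \<Rightarrow> complex" where
  "h w z = (if w = 0 then log_theta (exp (2 * z))
            else (theta_pow (exp (2 * z)) w - 1) / w)"

definition gamma :: "complex \<Rightarrow> complex \<Rightarrow> complex" where
  "gamma w z = (deriv ^^ 2) (h w) z + w * deriv (h w) z"

text \<open>The integral below converges absolutely for \<open>Re w < Re s < 0\<close> and is only used there.\<close>

definition Z_Q :: "complex \<Rightarrow> complex \<Rightarrow> complex" where
  "Z_Q w s = (LINT t:{0<..}|lborel.
      theta_pow (of_real (t\<^sup>2)) s * theta_pow (of_real (1 / t\<^sup>2)) (w - s) / of_real t)"

text \<open>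
  Entire functions on \<open>\<complex>\<^sup>2\<close>: everywhere Frechet differentiable with a complex-linear derivative.
\<close>

definition entire2 :: "(complex \<Rightarrow> complex \<Rightarrow> complex) \<Rightarrow> bool" where
  "entire2 F \<longleftrightarrow> (\<forall>w s. \<exists>a b.
      ((\<lambda>(u, v). F u v) has_derivative (\<lambda>(p, q). a * p + b * q)) (at (w, s)))"

text \<open>
  Since an entire function on \<open>\<complex>\<^sup>2\<close> is determined by its values on the nonempty open set
  \<open>Re w < Re s < 0\<close>, the meromorphic continuation of \<open>Z_Q\<close> itself need not be mentioned.
  On that set \<open>w \<noteq> 0\<close>.
\<close>

definition xi_Q :: "complex \<Rightarrow> complex \<Rightarrow> complex" where
  "xi_Q = (THE F. entire2 F \<and>
      (\<forall>w s. Re w < Re s \<and> Re s < 0 \<longrightarrow> F w s = s * (s - w) / (2 * w) * Z_Q w s))"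

definition nth_vderiv :: "nat \<Rightarrow> (real \<Rightarrow> complex) \<Rightarrow> real \<Rightarrow> complex" where
  "nth_vderiv m = ((\<lambda>f x. vector_derivative f (at x)) ^^ m)"

definition schwartz :: "(real \<Rightarrow> complex) set" where
  "schwartz = {f. (\<forall>m x. nth_vderiv m f differentiable (at x)) \<and>
                  (\<forall>k m. \<exists>C. \<forall>x. \<bar>x\<bar> ^ k * norm (nth_vderiv m f x) \<le> C)}"

end

(*
  Write gamma(w,z) = (l'' + w l'^2 + w l') e^{w l} with l(z) = log theta(e^{2z}).  The functional
  equation of theta becomes l(-z) = l(z) + z, hence gamma(w,-z) = e^{wz} gamma(w,z), and since
  theta(tau) - 1 = O(e^{-pi Re tau}), gamma decays faster than every exponential at both ends,
  uniformly on closed substrips; Cauchy's inequality turns this into the Schwartz bounds.  So the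
  integral is entire in (w,s) and, by Cauchy's theorem, independent of y.  For Re w < Re s < 0 it is
  s(s-w)/w times the integral of theta(e^{2x})^w e^{xs}, by parts, and that integral is Z_Q.
  An entire function on C^2 is determined by its values on this region.

  Zero-freeness of theta comes from the Jacobi triple product (a finite q-binomial identity and
  Tannery's theorem), and the functional equation from Poisson summation for the Gaussian.
*)
theory Submission
  imports Defs "HOL-Probability.Characteristic_Functions"
begin

section \<open>The theta series\<close>

text \<open>The operator d^2/dz^2 + w d/dz annihilates 1 and e^{-wz}, which are the leading terms of
  theta(e^{2z})^w at the right and left end of the strip. This is why gamma decays at both ends
  although theta^w does not. On the Mellin side the operator becomes multiplication by s(s-w). The
  quotient by w in \<open>h\<close> disappears after one differentiation, so w = 0 needs no limit
  argument. Two obstacles shape the rest. The branch of log theta is pinned down only by being real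
  on the positive axis and is not \<open>Ln\<close> of theta, so identities for it are proved by
  comparing two continuous logarithms that agree at 1. And \<open>xi_Q\<close> is a definite
  description over entire functions on C^2: the integral of gamma is the witness, and restriction to
  complex lines gives uniqueness.\<close>

lemma norm_theta_term:
  "norm (exp (- of_real pi * (of_nat n)\<^sup>2 * \<tau>)) = exp (- pi * (real n)\<^sup>2 * Re \<tau>)"
  by (simp add: Re_complex_of_real power2_eq_square)

lemma theta_term_le:
  assumes "a > 0"
  shows "exp (- pi * (real n)\<^sup>2 * a) \<le> exp (- pi * a) ^ n"
proof -
  have "real n \<le> (real n)\<^sup>2"
    by (cases n) (auto simp: power2_eq_square mult_le_cancel_left)
  hence "pi * a * real n \<le> pi * a * (real n)\<^sup>2"
    using assms by (intro mult_left_mono) auto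
  thus ?thesis by (simp add: exp_of_nat_mult[symmetric] mult_ac)
qed

lemma summable_theta_term:
  assumes "Re \<tau> > 0"
  shows "summable (\<lambda>n. norm (exp (- of_real pi * (of_nat n)\<^sup>2 * \<tau>)))"
proof (rule summable_comparison_test')
  show "summable (\<lambda>n. exp (- pi * Re \<tau>) ^ n)"
    using assms by (intro summable_geometric) auto
qed (use theta_term_le[OF assms] norm_theta_term in auto)

text \<open>Folding n and -n together turns the unordered sum over the integers into an ordinary
  series starting at n = 1, the form in which all later estimates use theta.\<close>

lemma theta_sums:
  assumes "Re \<tau> > 0"
  shows "(\<lambda>n. 2 * exp (- of_real pi * (of_nat (Suc n))\<^sup>2 * \<tau>)) sums (theta \<tau> - 1)"
proof -
  define a where "a = (\<lambda>n::nat. exp (- of_real pi * (of_nat (Suc n))\<^sup>2 * \<tau>))"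
  define b where "b = (\<lambda>n::int. exp (- of_real pi * (of_int n)\<^sup>2 * \<tau>))"
  have sa: "summable (\<lambda>n. norm (a n))"
    unfolding a_def using summable_theta_term[OF assms] by (subst summable_Suc_iff)
  define S where "S = suminf a"
  have S: "(a has_sum S) UNIV"
    unfolding S_def
    by (rule norm_summable_imp_has_sum[OF sa summable_sums[OF summable_norm_cancel[OF sa]]])
  have b1: "b (int n + 1) = a n" "b (- int n - 1) = a n" for n
    unfolding a_def b_def by (auto simp: power2_eq_square algebra_simps)
  have inj: "inj (\<lambda>n. int n + 1)" "inj (\<lambda>n. - int n - 1)" by (auto simp: inj_on_def)
  have "(b has_sum S) (range (\<lambda>n. int n + 1))"
    using S inj(1) by (subst has_sum_reindex) (auto simp: o_def b1)
  moreover have "(b has_sum S) (range (\<lambda>n. - int n - 1))"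
    using S inj(2) by (subst has_sum_reindex) (auto simp: o_def b1)
  moreover have "(b has_sum 1) {0}"
    using has_sum_finite[of "{0::int}" b] by (simp add: b_def)
  ultimately have "(b has_sum (1 + (S + S))) ({0} \<union> (range (\<lambda>n. int n + 1) \<union> range (\<lambda>n. - int n - 1)))"
    by (intro has_sum_Un_disjoint) auto
  also have "{0} \<union> (range (\<lambda>n. int n + 1) \<union> range (\<lambda>n. - int n - 1)) = UNIV"
  proof -
    have "x \<in> {0} \<union> (range (\<lambda>n. int n + 1) \<union> range (\<lambda>n. - int n - 1))" for x :: int
    proof (cases x "0::int" rule: linorder_cases)
      case less
      hence "x = - int (nat (- x - 1)) - 1" by simp
      thus ?thesis by blast
    next
      case greater
      hence "x = int (nat (x - 1)) + 1" by simp
      thus ?thesis by blast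
    qed auto
    thus ?thesis by blast
  qed
  finally have "theta \<tau> = 1 + 2 * S"
    unfolding theta_def b_def by (simp add: infsumI)
  moreover have "a sums S" using has_sum_imp_sums[OF S] .
  ultimately show ?thesis
    using sums_mult[of a S 2] by (simp add: a_def)
qed

text \<open>A geometric majorant with ratio r = e^{-pi Re tau}: since ln 2 <= 1 <= pi Re tau, r is
  at most 1/2, and 2r/(1-r) <= 4r.\<close>

lemma theta_minus_one_bound:
  assumes "Re \<tau> \<ge> 1"
  shows "norm (theta \<tau> - 1) \<le> 4 * exp (- pi * Re \<tau>)"
proof -
  define r where "r = exp (- pi * Re \<tau>)"
  have r0: "r > 0" by (simp add: r_def)
  have "ln 2 \<le> (1::real)" using ln_le_minus_one[of "2::real"] by simp
  hence "exp (- pi * Re \<tau>) \<le> exp (- ln 2)"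
    using assms mult_mono[of 1 pi 1 "Re \<tau>"] pi_gt3 by simp
  hence r2: "r \<le> 1 / 2" unfolding r_def by (simp add: exp_minus)
  have "norm (2 * exp (- of_real pi * (of_nat (Suc n))\<^sup>2 * \<tau>)) \<le> 2 * r * r ^ n" for n
    using theta_term_le[of "Re \<tau>" "Suc n"] assms norm_theta_term[of "Suc n" \<tau>]
    unfolding norm_mult r_def by (simp add: mult_ac)
  moreover have "(\<lambda>n. 2 * r * r ^ n) sums (2 * r * (1 / (1 - r)))"
    using r0 r2 by (intro sums_mult geometric_sums) auto
  moreover have "(\<lambda>n. 2 * exp (- of_real pi * (of_nat (Suc n))\<^sup>2 * \<tau>)) sums (theta \<tau> - 1)"
    using assms by (intro theta_sums) auto
  ultimately have "norm (theta \<tau> - 1) \<le> 2 * r * (1 / (1 - r))"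
    by (metis (no_types, lifting) norm_suminf_le sums_summable sums_unique)
  also have "\<dots> \<le> 4 * r"
    using r0 r2 by (simp add: field_simps)
  finally show ?thesis by (simp add: r_def)
qed

lemma theta_holomorphic: "theta holomorphic_on {\<tau>. Re \<tau> > 0}"
proof (rule holomorphic_uniform_sequence)
  show "open {\<tau>. Re \<tau> > 0}" by (rule open_halfspace_Re_gt)
next
  fix n :: nat
  show "(\<lambda>\<tau>. 1 + (\<Sum>k<n. 2 * exp (- of_real pi * (of_nat (Suc k))\<^sup>2 * \<tau>))) holomorphic_on {\<tau>. Re \<tau> > 0}"
    by (intro holomorphic_intros)
next
  fix \<tau> assume "\<tau> \<in> {\<tau>. Re \<tau> > 0}"
  hence t: "Re \<tau> > 0" by simp
  \<comment> \<open>Half the distance to the boundary: on the closed disc of this radius Re z is at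
    least d, which makes e^{-pi d} a uniform geometric ratio.\<close>
  define d where "d = Re \<tau> / 2"
  have d: "d > 0" using t by (simp add: d_def)
  have Re: "Re z \<ge> d" if "z \<in> cball \<tau> d" for z
    using abs_Re_le_cmod[of "\<tau> - z"] that by (auto simp: dist_norm d_def abs_le_iff)
  have "uniform_limit (cball \<tau> d) (\<lambda>n z. \<Sum>k<n. 2 * exp (- of_real pi * (of_nat (Suc k))\<^sup>2 * z))
     (\<lambda>z. \<Sum>k. 2 * exp (- of_real pi * (of_nat (Suc k))\<^sup>2 * z)) sequentially"
  proof (rule Weierstrass_m_test)
    show "summable (\<lambda>n. 2 * exp (- pi * d) ^ Suc n)"
      unfolding summable_Suc_iff[of "\<lambda>n. 2 * exp (- pi * d) ^ n"] using d by (intro summable_mult summable_geometric) auto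
    fix n z assume z: "z \<in> cball \<tau> d"
    have "norm (exp (- of_real pi * (of_nat (Suc n))\<^sup>2 * z)) \<le> exp (- pi * Re z) ^ Suc n"
      using theta_term_le[of "Re z" "Suc n"] Re[OF z] d norm_theta_term[of "Suc n" z] by auto
    also have "\<dots> \<le> exp (- pi * d) ^ Suc n"
      using Re[OF z] by (intro power_mono) auto
    finally show "norm (2 * exp (- of_real pi * (of_nat (Suc n))\<^sup>2 * z)) \<le> 2 * exp (- pi * d) ^ Suc n"
      unfolding norm_mult by simp
  qed
  moreover have "(\<Sum>k. 2 * exp (- of_real pi * (of_nat (Suc k))\<^sup>2 * z)) = theta z - 1" if "z \<in> cball \<tau> d" for z
    using theta_sums[of z] Re[OF that] d by (simp add: sums_iff)
  ultimately have "uniform_limit (cball \<tau> d) (\<lambda>n z. \<Sum>k<n. 2 * exp (- of_real pi * (of_nat (Suc k))\<^sup>2 * z))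
     (\<lambda>z. theta z - 1) sequentially"
    by (subst (asm) uniform_limit_cong'[OF refl]) auto
  hence "uniform_limit (cball \<tau> d) (\<lambda>n z. 1 + (\<Sum>k<n. 2 * exp (- of_real pi * (of_nat (Suc k))\<^sup>2 * z)))
     (\<lambda>z. 1 + (theta z - 1)) sequentially"
    by (intro uniform_limit_intros)
  moreover have "cball \<tau> d \<subseteq> {\<tau>. Re \<tau> > 0}" using Re d by force
  ultimately show "\<exists>d. 0 < d \<and> cball \<tau> d \<subseteq> {\<tau>. Re \<tau> > 0} \<and>
      uniform_limit (cball \<tau> d) (\<lambda>n z. 1 + (\<Sum>k<n. 2 * exp (- of_real pi * (of_nat (Suc k))\<^sup>2 * z))) theta sequentially"
    using d by auto
qed

lemma theta_of_real:
  assumes "t > 0"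
  shows "Im (theta (of_real t)) = 0" "Re (theta (of_real t)) \<ge> 1"
proof -
  let ?f = "\<lambda>n. 2 * exp (- pi * (real (Suc n))\<^sup>2 * t)"
  have "(\<lambda>n. of_real (?f n)) sums (theta (of_real t) - 1)"
    using theta_sums[of "of_real t"] assms by (simp flip: exp_of_real)
  hence "(\<lambda>n. Im (of_real (?f n))) sums Im (theta (of_real t) - 1)"
        and "(\<lambda>n. Re (of_real (?f n))) sums Re (theta (of_real t) - 1)"
    using sums_Im sums_Re by blast+
  thus "Im (theta (of_real t)) = 0" "Re (theta (of_real t)) \<ge> 1"
    using sums_le[OF _ sums_zero, of ?f "Re (theta (of_real t) - 1)"] by (simp_all add: sums_iff)
qed

section \<open>Zero-freeness via the triple product\<close>

text \<open>The q-Pochhammer symbol (p; p)_m.\<close>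

definition qfact :: "complex \<Rightarrow> nat \<Rightarrow> complex" where
  "qfact p m = (\<Prod>k<m. 1 - p ^ Suc k)"

text \<open>The Gaussian binomial coefficient. Because of truncated subtraction it is the right
  value only for j <= m; beyond that it does not vanish.\<close>

definition qbin :: "complex \<Rightarrow> nat \<Rightarrow> nat \<Rightarrow> complex" where
  "qbin p m j = qfact p m / (qfact p j * qfact p (m - j))"

lemma one_minus_power_neq_0:
  fixes p :: complex
  assumes "norm p < 1"
  shows "1 - p ^ Suc k \<noteq> 0"
proof
  assume "1 - p ^ Suc k = 0"
  hence "norm (p ^ Suc k) = 1" by (metis norm_one right_minus_eq)
  moreover have "norm p ^ Suc k < 1" using assms power_Suc_less_one[of "norm p" k] by (cases "p = 0") auto
  ultimately show False by (simp add: norm_power norm_mult)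
qed

lemma qfact_neq_0: "norm p < 1 \<Longrightarrow> qfact p m \<noteq> 0"
  unfolding qfact_def using one_minus_power_neq_0 by (auto simp: prod_zero_iff)

text \<open>The q-Pascal rule. It fails at j = m, where \<open>qbin p m (Suc m)\<close> would have
  to be 0.\<close>

lemma qbin_Suc_Suc:
  assumes "norm p < 1" "j < m"
  shows "qbin p (Suc m) (Suc j) = qbin p m (Suc j) + p ^ (m - j) * qbin p m j"
proof -
  obtain i where i: "m = Suc (j + i)" using assms(2) less_iff_Suc_add by blast
  define A B C where "A = qfact p m" "B = qfact p j" "C = qfact p i"
  define u v where "u = p ^ Suc j" "v = p ^ Suc i"
  have nz: "A \<noteq> 0" "B \<noteq> 0" "C \<noteq> 0" "1 - u \<noteq> 0" "1 - v \<noteq> 0"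
    using assms one_minus_power_neq_0[OF assms(1)] qfact_neq_0 unfolding A_B_C_def u_v_def by auto
  have m: "m - j = Suc i" "Suc m - Suc j = Suc i" "m - Suc j = i" using i by auto
  have pm: "p ^ Suc m = u * v"
    unfolding u_v_def power_add[symmetric] by (simp add: i)
  have Q: "qfact p (Suc m) = A * (1 - u * v)" "qfact p (Suc j) = B * (1 - u)" "qfact p (Suc i) = C * (1 - v)"
    unfolding A_B_C_def pm[symmetric] unfolding u_v_def qfact_def by (simp_all only: prod.lessThan_Suc)
  \<comment> \<open>After clearing denominators this is 1 - uv = (1 - v) + v(1 - u).\<close>
  have "A * (1 - u * v) / (B * (1 - u) * (C * (1 - v))) = A / (B * (1 - u) * C) + v * (A / (B * (C * (1 - v))))"
    using nz by (simp add: divide_simps) (simp add: algebra_simps)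
  thus ?thesis
    unfolding qbin_def m Q A_B_C_def[symmetric] u_v_def(2)[symmetric] .
qed

lemma qbin_0 [simp]: "norm p < 1 \<Longrightarrow> qbin p m 0 = 1"
  and qbin_same [simp]: "norm p < 1 \<Longrightarrow> qbin p m m = 1"
  using qfact_neq_0 by (auto simp: qbin_def qfact_def[of p 0])

text \<open>The base is \<open>p = q\<^sup>2\<close>, so that \<open>q ^ (j * (j - 1))\<close> is \<open>p\<close> to the power \<open>j\<close> choose 2.\<close>

lemma q_binomial_theorem:
  fixes q x y :: complex
  assumes "norm (q\<^sup>2) < 1"
  shows "(\<Prod>k<m. y + x * (q\<^sup>2) ^ k) = (\<Sum>j\<le>m. qbin (q\<^sup>2) m j * q ^ (j * (j - 1)) * x ^ j * y ^ (m - j))"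
proof (induction m)
  case 0
  show ?case using assms by simp
next
  case (Suc m)
  define t where "t = (\<lambda>m j. qbin (q\<^sup>2) m j * q ^ (j * (j - 1)) * x ^ j * y ^ (m - j))"
  have q: "q ^ (Suc j * (Suc j - 1)) = q ^ (j * (j - 1)) * (q\<^sup>2) ^ j" for j
    by (cases j) (simp_all add: power_add[symmetric] power_mult[symmetric] algebra_simps power2_eq_square numeral_eq_Suc)
  \<comment> \<open>The q-Pascal rule treats the interior terms; the extreme terms
    \<open>top\<close> and \<open>bot\<close> lie outside its range and are matched by hand.\<close>
  have mid: "t (Suc m) (Suc j) = y * t m (Suc j) + x * (q\<^sup>2) ^ m * t m j" if "j < m" for j
  proof -
    have 1: "(q\<^sup>2) ^ (m - j) * (q\<^sup>2) ^ j = (q\<^sup>2) ^ m"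
      using that by (simp add: power_add[symmetric])
    have 2: "y ^ (m - j) = y * y ^ (m - Suc j)"
      using that by (metis Suc_diff_Suc power_Suc)
    show ?thesis
      unfolding t_def qbin_Suc_Suc[OF assms that] q diff_Suc_Suc 2 1[symmetric]
      by (simp add: algebra_simps)
  qed
  have top: "t (Suc m) (Suc m) = x * (q\<^sup>2) ^ m * t m m"
    unfolding t_def q using assms by simp
  have bot: "t (Suc m) 0 = y * t m 0" unfolding t_def using assms by simp
  have "(\<Sum>j\<le>Suc m. t (Suc m) j) = t (Suc m) 0 + (\<Sum>j<m. t (Suc m) (Suc j)) + t (Suc m) (Suc m)"
    by (subst sum.atMost_Suc_shift) (simp add: lessThan_Suc_atMost[symmetric] add_ac)
  also have "\<dots> = y * (t m 0 + (\<Sum>j<m. t m (Suc j))) + x * (q\<^sup>2) ^ m * ((\<Sum>j<m. t m j) + t m m)"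
    unfolding top bot by (simp add: mid sum.distrib sum_distrib_left sum_distrib_right algebra_simps)
  also have "t m 0 + (\<Sum>j<m. t m (Suc j)) = (\<Sum>j\<le>m. t m j)"
    using sum.lessThan_Suc_shift[of "t m" m] by (simp add: lessThan_Suc_atMost)
  also have "(\<Sum>j<m. t m j) + t m m = (\<Sum>j\<le>m. t m j)"
    by (simp add: lessThan_Suc_atMost[symmetric])
  finally show ?case using Suc.IH unfolding t_def
    by (simp add: algebra_simps)
qed

lemma sum_lessThan_add:
  fixes f :: "nat \<Rightarrow> 'a :: comm_monoid_add"
  shows "(\<Sum>k<m + n. f k) = (\<Sum>k<m. f k) + (\<Sum>k<n. f (m + k))"
  by (induction n) (simp_all add: add_ac)

lemma prod_lessThan_add:
  fixes f :: "nat \<Rightarrow> 'a :: comm_monoid_mult"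
  shows "(\<Prod>k<m + n. f k) = (\<Prod>k<m. f k) * (\<Prod>k<n. f (m + k))"
  by (induction n) (simp_all add: mult_ac)

lemma sum_atMost_fold:
  fixes g :: "nat \<Rightarrow> 'a :: comm_monoid_add"
  shows "(\<Sum>j\<le>2 * N. g j) = g N + (\<Sum>n<N. g (N + Suc n) + g (N - Suc n))"
proof -
  have "(\<Sum>j\<le>2 * N. g j) = (\<Sum>j<N + (Suc N). g j)"
    by (rule sum.cong) auto
  also have "\<dots> = (\<Sum>j<N. g j) + (\<Sum>j<Suc N. g (N + j))"
    by (rule sum_lessThan_add)
  also have "(\<Sum>j<Suc N. g (N + j)) = g N + (\<Sum>n<N. g (N + Suc n))"
    by (subst sum.lessThan_Suc_shift) simp
  also have "(\<Sum>j<N. g j) = (\<Sum>n<N. g (N - Suc n))"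
    by (rule sum.nat_diff_reindex[symmetric])
  finally show ?thesis by (simp add: sum.distrib add_ac)
qed

text \<open>The \<open>q\<close>-binomial theorem with \<open>m = 2 N\<close>, \<open>x = 1\<close> and \<open>y = q ^ (2 N - 1)\<close>, with the terms
  \<open>j = N + n\<close> and \<open>j = N - n\<close> paired.\<close>

lemma finite_triple_product:
  fixes q :: complex
  assumes "norm q < 1" "q \<noteq> 0"
  shows "(\<Prod>k<N. 1 + q ^ (2 * k + 1))\<^sup>2 = qbin (q\<^sup>2) (2 * N) N +
     (\<Sum>n<N. 2 * (qfact (q\<^sup>2) (2 * N) / (qfact (q\<^sup>2) (N + Suc n) * qfact (q\<^sup>2) (N - Suc n))) * q ^ ((Suc n)\<^sup>2))"
\<comment> \<open>The exponent \<open>2 * N - 1\<close> truncates at N = 0.\<close>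
proof (cases "N = 0")
  case True
  thus ?thesis using assms by (simp add: norm_power power_less_one_iff)
next
  case False
  define P where "P = (\<Prod>k<N. 1 + q ^ (2 * k + 1))"
  \<comment> \<open>The total power of q extracted from the two halves of the product, N(N-1) +
    (2N-1)N. Integer exponents avoid truncated subtraction when it is cancelled.\<close>
  define K where "K = 3 * (int N)\<^sup>2 - 2 * int N"
  have q2: "norm (q\<^sup>2) < 1" using assms by (simp add: norm_power power_less_one_iff)
  have "(\<Prod>k<2 * N. q ^ (2 * N - 1) + 1 * (q\<^sup>2) ^ k) =
      (\<Prod>k<N. q ^ (2 * N - 1) + (q\<^sup>2) ^ k) * (\<Prod>k<N. q ^ (2 * N - 1) + (q\<^sup>2) ^ (N + k))"
    unfolding mult_2[of N] prod_lessThan_add by simp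
  \<comment> \<open>For k < N the smaller power is q^(2k). Pulling it out leaves the odd-exponent
    product in reverse order; in the upper half of the product q^(2N-1) is the smaller power, and
    the same product appears in its natural order.\<close>
  also have "(\<Prod>k<N. q ^ (2 * N - 1) + (q\<^sup>2) ^ k) = (\<Prod>k<N. (q\<^sup>2) ^ k * (1 + q ^ (2 * (N - Suc k) + 1)))"
  proof (rule prod.cong)
    fix k assume "k \<in> {..<N}"
    hence "2 * N - 1 = 2 * k + (2 * (N - Suc k) + 1)" by auto
    hence "q ^ (2 * N - 1) = (q\<^sup>2) ^ k * q ^ (2 * (N - Suc k) + 1)"
      by (simp only: power_add power_mult)
    thus "q ^ (2 * N - 1) + (q\<^sup>2) ^ k = (q\<^sup>2) ^ k * (1 + q ^ (2 * (N - Suc k) + 1))"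
      by (simp only: distrib_left mult_1_right add.commute)
  qed auto
  also have "\<dots> = (\<Prod>k<N. (q\<^sup>2) ^ k) * P"
    unfolding P_def prod.distrib
    by (simp only: prod.nat_diff_reindex[where g = "\<lambda>k. 1 + q ^ (2 * k + 1)"])
  also have "(\<Prod>k<N. (q\<^sup>2) ^ k) = q powi (int N * (int N - 1))"
  proof (induction N)
    case (Suc N)
    have "int (Suc N) * (int (Suc N) - 1) = int N * (int N - 1) + int (2 * N)"
      by (simp add: algebra_simps)
    hence "q powi (int (Suc N) * (int (Suc N) - 1)) = q powi (int N * (int N - 1)) * q powi (int (2 * N))"
      using assms(2) power_int_add by metis
    thus ?case using Suc by (simp only: power_int_of_nat power_mult prod.lessThan_Suc)
  qed simp
  also have "(\<Prod>k<N. q ^ (2 * N - 1) + (q\<^sup>2) ^ (N + k)) = (\<Prod>k<N. q ^ (2 * N - 1) * (1 + q ^ (2 * k + 1)))"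
  proof (rule prod.cong)
    fix k assume "k \<in> {..<N}"
    have "2 * (N + k) = (2 * N - 1) + (2 * k + 1)" using False by auto
    hence "(q\<^sup>2) ^ (N + k) = q ^ (2 * N - 1) * q ^ (2 * k + 1)"
      by (simp only: power_add[symmetric] power_mult[symmetric])
    thus "q ^ (2 * N - 1) + (q\<^sup>2) ^ (N + k) = q ^ (2 * N - 1) * (1 + q ^ (2 * k + 1))"
      by (simp only: distrib_left mult_1_right)
  qed auto
  also have "\<dots> = q powi ((2 * int N - 1) * int N) * P"
  proof -
    have "(2 * int N - 1) * int N = int ((2 * N - 1) * N)" using False by (simp add: of_nat_diff)
    hence "q powi ((2 * int N - 1) * int N) = q ^ ((2 * N - 1) * N)" by (simp only: power_int_of_nat)
    thus ?thesis by (simp add: P_def prod.distrib power_mult)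
  qed
  finally have L0: "(\<Prod>k<2 * N. q ^ (2 * N - 1) + 1 * (q\<^sup>2) ^ k) =
      q powi (int N * (int N - 1)) * P * (q powi ((2 * int N - 1) * int N) * P)" .
  have L: "(\<Prod>k<2 * N. q ^ (2 * N - 1) + 1 * (q\<^sup>2) ^ k) = q powi K * P\<^sup>2"
  proof -
    have "q powi K = q powi (int N * (int N - 1)) * q powi ((2 * int N - 1) * int N)"
      unfolding K_def using assms(2)
      by (subst power_int_add[symmetric]) (auto simp: power2_eq_square algebra_simps)
    thus ?thesis unfolding L0 by (simp add: power2_eq_square)
  qed
  have "q powi K * P\<^sup>2 = (\<Sum>j\<le>2 * N. qbin (q\<^sup>2) (2 * N) j * q ^ (j * (j - 1)) * 1 ^ j * (q ^ (2 * N - 1)) ^ (2 * N - j))"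
    unfolding L[symmetric] by (rule q_binomial_theorem[OF q2])
  also have "\<dots> = (\<Sum>j\<le>2 * N. q powi K * (qbin (q\<^sup>2) (2 * N) j * q ^ (nat ((int j - int N)\<^sup>2))))"
  proof (rule sum.cong)
    fix j assume j: "j \<in> {..2 * N}"
    have a: "int (j * (j - 1)) = int j * (int j - 1)" by (cases j) (auto simp: algebra_simps)
    have b: "int ((2 * N - 1) * (2 * N - j)) = (2 * int N - 1) * (2 * int N - int j)"
      using j False by (auto simp: of_nat_diff)
    \<comment> \<open>Completing the square: j(j-1) + (2N-1)(2N-j) = K + (j-N)^2. This is where the
      squares in the exponents of theta come from.\<close>
    have "q ^ (j * (j - 1)) * (q ^ (2 * N - 1)) ^ (2 * N - j) = q powi (int (j * (j - 1))) * q powi (int ((2 * N - 1) * (2 * N - j)))"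
      by (simp only: power_int_of_nat power_mult)
    also have "\<dots> = q powi (K + (int j - int N)\<^sup>2)"
      using assms(2) unfolding a b K_def
      by (subst power_int_add[symmetric]) (auto simp: power2_eq_square algebra_simps)
    also have "\<dots> = q powi K * q powi (int (nat ((int j - int N)\<^sup>2)))"
      using assms(2) by (simp add: power_int_add)
    also have "\<dots> = q powi K * q ^ (nat ((int j - int N)\<^sup>2))"
      by (simp only: power_int_of_nat)
    finally show "qbin (q\<^sup>2) (2 * N) j * q ^ (j * (j - 1)) * 1 ^ j * (q ^ (2 * N - 1)) ^ (2 * N - j) =
       q powi K * (qbin (q\<^sup>2) (2 * N) j * q ^ (nat ((int j - int N)\<^sup>2)))"
      by (simp add: mult_ac)
  qed auto
  finally have "P\<^sup>2 = (\<Sum>j\<le>2 * N. qbin (q\<^sup>2) (2 * N) j * q ^ (nat ((int j - int N)\<^sup>2)))"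
    using assms(2) by (simp add: sum_distrib_left[symmetric])
  also have "\<dots> = qbin (q\<^sup>2) (2 * N) N +
     (\<Sum>n<N. 2 * (qfact (q\<^sup>2) (2 * N) / (qfact (q\<^sup>2) (N + Suc n) * qfact (q\<^sup>2) (N - Suc n))) * q ^ ((Suc n)\<^sup>2))"
    unfolding sum_atMost_fold
  proof (intro arg_cong2[where f = "(+)"] sum.cong refl)
    fix n assume n: "n \<in> {..<N}"
    have "nat ((int (N + Suc n) - int N)\<^sup>2) = (Suc n)\<^sup>2" "nat ((int (N - Suc n) - int N)\<^sup>2) = (Suc n)\<^sup>2"
    proof -
      have "(int (N + Suc n) - int N)\<^sup>2 = int ((Suc n)\<^sup>2)" by simp
      thus "nat ((int (N + Suc n) - int N)\<^sup>2) = (Suc n)\<^sup>2" by (metis nat_int)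
      have "int (N - Suc n) - int N = - int (Suc n)" using n by (simp add: of_nat_diff)
      hence "(int (N - Suc n) - int N)\<^sup>2 = int ((Suc n)\<^sup>2)" by (metis power2_minus of_nat_power)
      thus "nat ((int (N - Suc n) - int N)\<^sup>2) = (Suc n)\<^sup>2" by (metis nat_int)
    qed
    moreover have "2 * N - (N + Suc n) = N - Suc n" "2 * N - (N - Suc n) = N + Suc n" using n by auto
    ultimately show "qbin (q\<^sup>2) (2 * N) (N + Suc n) * q ^ nat ((int (N + Suc n) - int N)\<^sup>2) +
       qbin (q\<^sup>2) (2 * N) (N - Suc n) * q ^ nat ((int (N - Suc n) - int N)\<^sup>2) =
       2 * (qfact (q\<^sup>2) (2 * N) / (qfact (q\<^sup>2) (N + Suc n) * qfact (q\<^sup>2) (N - Suc n))) * q ^ ((Suc n)\<^sup>2)"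
      by (simp add: qbin_def mult_ac)
  qed simp
  finally show ?thesis by (simp add: P_def)
qed

section \<open>The limit of the finite identity\<close>

text \<open>Absolute convergence makes the product convergent in the strict sense, where the limit
  is 0 only if some factor is 0.\<close>

lemma prod_lessThan_tendsto_nonzero:
  fixes f :: "nat \<Rightarrow> complex"
  assumes "summable (\<lambda>n. norm (f n - 1))" "\<And>n. f n \<noteq> 0"
  obtains L where "L \<noteq> 0" "(\<lambda>n. \<Prod>k<n. f k) \<longlonglongrightarrow> L"
proof
  have c: "convergent_prod f"
    using assms(1) abs_convergent_prod_conv_summable abs_convergent_prod_imp_convergent_prod by blast
  show "prodinf f \<noteq> 0" using prodinf_nonzero[OF c] assms(2) by blast
  show "(\<lambda>n. \<Prod>k<n. f k) \<longlonglongrightarrow> prodinf f"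
    using convergent_prod_LIMSEQ[OF c] by (simp add: LIMSEQ_lessThan_iff_atMost)
qed

text \<open>As N grows the finite identity becomes P^2 = theta / Q, where q = e^{-pi tau}, P is the
  product of the 1 + q^(2k+1) and Q that of the 1 - q^(2k+2). P is a convergent product of nonzero
  factors, so theta cannot vanish.\<close>

lemma theta_nonzero:
  assumes "Re \<tau> > 0"
  shows "theta \<tau> \<noteq> 0"
proof -
  define q where "q = exp (- of_real pi * \<tau>)"
  have q: "norm q < 1" "q \<noteq> 0" using assms by (auto simp: q_def)
  have q2: "norm (q\<^sup>2) < 1" using q by (simp add: norm_power power_less_one_iff)
  have "summable (\<lambda>n. norm q * norm (q\<^sup>2) ^ n)"
    using q2 by (intro summable_mult summable_geometric) auto
  hence s1: "summable (\<lambda>n. norm ((1 + q ^ (2 * n + 1)) - 1))"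
    by (simp add: norm_mult norm_power power_mult power_mult_distrib)
  have "1 + q ^ (2 * n + 1) \<noteq> 0" for n
  proof
    assume "1 + q ^ (2 * n + 1) = 0"
    hence "q ^ Suc (2 * n) = - 1" by (simp add: eq_neg_iff_add_eq_0 add.commute)
    hence "(- q) ^ Suc (2 * n) = 1" by (simp add: power_minus_odd)
    thus False using one_minus_power_neq_0[of "- q" "2 * n"] q by simp
  qed
  then obtain P where P: "P \<noteq> 0" "(\<lambda>n. \<Prod>k<n. 1 + q ^ (2 * k + 1)) \<longlonglongrightarrow> P"
    using prod_lessThan_tendsto_nonzero[OF s1] by blast
  have "summable (\<lambda>n. norm (q\<^sup>2) * norm (q\<^sup>2) ^ n)"
    using q2 by (intro summable_mult summable_geometric) auto
  hence "summable (\<lambda>n. norm ((1 - (q\<^sup>2) ^ Suc n) - 1))"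
    by (simp add: norm_mult norm_power)
  then obtain Q where Q: "Q \<noteq> 0" "qfact (q\<^sup>2) \<longlonglongrightarrow> Q"
    using prod_lessThan_tendsto_nonzero[of "\<lambda>n. 1 - (q\<^sup>2) ^ Suc n"] one_minus_power_neq_0[OF q2]
    unfolding qfact_def by blast
  \<comment> \<open>Since \<open>qfact\<close> converges to a nonzero limit, it and its reciprocal
    are bounded. This bounds the coefficients \<open>c N n\<close> uniformly in both indices, as
    Tannery's theorem requires.\<close>
  have "Bseq (qfact (q\<^sup>2))" using Q(2) by (intro convergent_imp_Bseq convergentI)
  then obtain A where A: "A > 0" "\<And>n. norm (qfact (q\<^sup>2) n) \<le> A" by (auto simp: Bseq_def)
  have "Bseq (\<lambda>n. inverse (qfact (q\<^sup>2) n))"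
    using tendsto_inverse[OF Q(2) Q(1)] by (intro convergent_imp_Bseq convergentI)
  then obtain B where B: "B > 0" "\<And>n. norm (inverse (qfact (q\<^sup>2) n)) \<le> B" by (auto simp: Bseq_def)
  define c where "c = (\<lambda>N n. qfact (q\<^sup>2) (2 * N) / (qfact (q\<^sup>2) (N + Suc n) * qfact (q\<^sup>2) (N - Suc n)))"
  \<comment> \<open>The cut-off at n < N turns the finite sums into series and discards the indices
    where \<open>N - Suc n\<close> truncates.\<close>
  define a where "a = (\<lambda>n N. if n < N then 2 * c N n * q ^ ((Suc n)\<^sup>2) else 0)"
  have sub: "(\<lambda>N. qfact (q\<^sup>2) (2 * N)) \<longlonglongrightarrow> Q" "(\<lambda>N. qfact (q\<^sup>2) (N + Suc n)) \<longlonglongrightarrow> Q"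
    "(\<lambda>N. qfact (q\<^sup>2) (N - Suc n)) \<longlonglongrightarrow> Q" for n
  proof -
    show "(\<lambda>N. qfact (q\<^sup>2) (2 * N)) \<longlonglongrightarrow> Q"
      using LIMSEQ_subseq_LIMSEQ[OF Q(2), of "\<lambda>N. 2 * N"] by (simp add: strict_mono_def o_def)
    show "(\<lambda>N. qfact (q\<^sup>2) (N + Suc n)) \<longlonglongrightarrow> Q"
      by (rule LIMSEQ_ignore_initial_segment[OF Q(2)])
    show "(\<lambda>N. qfact (q\<^sup>2) (N - Suc n)) \<longlonglongrightarrow> Q"
      by (rule LIMSEQ_offset[of _ "Suc n"]) (use Q(2) in simp)
  qed
  have c_lim: "(\<lambda>N. c N n) \<longlonglongrightarrow> 1 / Q" for n
  proof -
    have "(\<lambda>N. c N n) \<longlonglongrightarrow> Q / (Q * Q)"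
      unfolding c_def using Q(1) by (intro tendsto_intros sub) auto
    thus ?thesis using Q(1) by simp
  qed
  have c_bound: "norm (c N n) \<le> A * (B * B)" for N n
    unfolding c_def divide_inverse inverse_mult_distrib norm_mult
    using A B by (intro mult_mono) auto
  have qq: "q ^ ((Suc n)\<^sup>2) = exp (- of_real pi * (of_nat (Suc n))\<^sup>2 * \<tau>)" for n
    unfolding q_def by (subst exp_of_nat_mult[symmetric]) (simp add: mult_ac)
  have "eventually (\<lambda>N. summable (\<lambda>n. norm (a n N))) sequentially \<and>
           summable (\<lambda>n. norm (2 * (1 / Q) * q ^ ((Suc n)\<^sup>2))) \<and>
           ((\<lambda>N. suminf (\<lambda>n. a n N)) \<longlongrightarrow> suminf (\<lambda>n. 2 * (1 / Q) * q ^ ((Suc n)\<^sup>2))) sequentially"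
  proof (rule tannerys_theorem)
    fix n
    have "(\<lambda>N. 2 * c N n * q ^ ((Suc n)\<^sup>2)) \<longlonglongrightarrow> 2 * (1 / Q) * q ^ ((Suc n)\<^sup>2)"
      by (intro tendsto_intros c_lim)
    moreover have "eventually (\<lambda>N. 2 * c N n * q ^ ((Suc n)\<^sup>2) = a n N) sequentially"
      using eventually_gt_at_top[of n] by eventually_elim (simp add: a_def)
    ultimately show "(\<lambda>N. a n N) \<longlonglongrightarrow> 2 * (1 / Q) * q ^ ((Suc n)\<^sup>2)"
      by (rule Lim_transform_eventually)
  next
    show "summable (\<lambda>n. 2 * (A * (B * B)) * norm (exp (- of_real pi * (of_nat (Suc n))\<^sup>2 * \<tau>)))"
      using summable_theta_term[OF assms]
      by (intro summable_mult) (subst summable_Suc_iff)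
    show "\<forall>\<^sub>F (n, N) in at_top \<times>\<^sub>F sequentially. norm (a n N) \<le> 2 * (A * (B * B)) * norm (exp (- of_real pi * (of_nat (Suc n))\<^sup>2 * \<tau>))"
    proof (intro always_eventually, clarify)
      fix n N
      show "norm (a n N) \<le> 2 * (A * (B * B)) * norm (exp (- of_real pi * (of_nat (Suc n))\<^sup>2 * \<tau>))"
        unfolding qq[symmetric] a_def
        using mult_right_mono[OF c_bound[of N n], of "2 * norm (q ^ ((Suc n)\<^sup>2))"] A(1) B(1)
        by (auto simp: norm_mult mult_ac)
    qed
  qed auto
  hence "(\<lambda>N. suminf (\<lambda>n. a n N)) \<longlonglongrightarrow> suminf (\<lambda>n. 2 * (1 / Q) * q ^ ((Suc n)\<^sup>2))" by blast
  also have "(\<lambda>n. 2 * (1 / Q) * q ^ ((Suc n)\<^sup>2)) = (\<lambda>n. (1 / Q) * (2 * exp (- of_real pi * (of_nat (Suc n))\<^sup>2 * \<tau>)))"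
    unfolding qq by (simp add: mult_ac)
  also have "suminf \<dots> = (1 / Q) * (theta \<tau> - 1)"
    using sums_mult[OF theta_sums[OF assms], of "1 / Q"] sums_unique by metis
  also have "(\<lambda>N. suminf (\<lambda>n. a n N)) = (\<lambda>N. \<Sum>n<N. 2 * c N n * q ^ ((Suc n)\<^sup>2))"
  proof
    fix N
    have "suminf (\<lambda>n. a n N) = (\<Sum>n<N. a n N)"
      by (rule suminf_finite) (auto simp: a_def)
    thus "suminf (\<lambda>n. a n N) = (\<Sum>n<N. 2 * c N n * q ^ ((Suc n)\<^sup>2))" by (simp add: a_def)
  qed
  finally have l1: "(\<lambda>N. \<Sum>n<N. 2 * c N n * q ^ ((Suc n)\<^sup>2)) \<longlonglongrightarrow> (1 / Q) * (theta \<tau> - 1)" .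
  have "(\<lambda>N. qbin (q\<^sup>2) (2 * N) N) \<longlonglongrightarrow> Q / (Q * Q)"
  proof -
    have "(\<lambda>N. qfact (q\<^sup>2) (2 * N) / (qfact (q\<^sup>2) N * qfact (q\<^sup>2) N)) \<longlonglongrightarrow> Q / (Q * Q)"
      using Q(1) by (intro tendsto_intros sub Q(2)) auto
    thus ?thesis by (simp add: qbin_def mult_2)
  qed
  from tendsto_add[OF this l1]
  have "(\<lambda>N. (\<Prod>k<N. 1 + q ^ (2 * k + 1))\<^sup>2) \<longlonglongrightarrow> Q / (Q * Q) + (1 / Q) * (theta \<tau> - 1)"
    unfolding c_def finite_triple_product[OF q, symmetric] .
  hence "P\<^sup>2 = Q / (Q * Q) + (1 / Q) * (theta \<tau> - 1)"
    using tendsto_power[OF P(2), of 2] LIMSEQ_unique by blast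
  hence "P\<^sup>2 = theta \<tau> / Q" using Q(1) by (simp add: field_simps)
  thus ?thesis using P(1) by auto
qed

section \<open>Fourier coefficients on the unit interval\<close>

lemma cnj_measurable [measurable]:
  "f \<in> borel_measurable M \<Longrightarrow> (\<lambda>x. cnj (f x)) \<in> borel_measurable M"
  by (rule borel_measurable_continuous_on[of cnj]) (auto intro: continuous_intros)

text \<open>The proof integrates the square of the distance from \<open>g\<close> to its partial expansion.\<close>

lemma bessel_tendsto_0:
  fixes e :: "nat \<Rightarrow> 'a \<Rightarrow> complex" and g :: "'a \<Rightarrow> complex"
  assumes "finite_measure M"
    and [measurable]: "\<And>j. e j \<in> borel_measurable M" "g \<in> borel_measurable M"
    and e_le: "\<And>j x. norm (e j x) \<le> 1"
    and g_le: "\<And>x. x \<in> space M \<Longrightarrow> norm (g x) \<le> B"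
    and orth: "\<And>j k. (LINT x|M. e j x * cnj (e k x)) = (if j = k then 1 else 0)"
  shows "(\<lambda>j. LINT x|M. g x * cnj (e j x)) \<longlonglongrightarrow> 0"
proof -
  interpret finite_measure M by fact
  define c where "c = (\<lambda>j. LINT x|M. g x * cnj (e j x))"
  have i_ge: "integrable M (\<lambda>x. g x * cnj (e j x))" for j
  proof (rule integrable_const_bound[where B = "\<bar>B\<bar>"])
    have "norm (g x * cnj (e j x)) \<le> \<bar>B\<bar> * 1" if "x \<in> space M" for x
      unfolding norm_mult using e_le[of j x] g_le[OF that] by (intro mult_mono) auto
    thus "AE x in M. norm (g x * cnj (e j x)) \<le> \<bar>B\<bar>" by simp
  qed auto
  have i_eg: "integrable M (\<lambda>x. e j x * cnj (g x))" for j
    using integrable_cnj[OF i_ge[of j]] by (simp add: mult.commute)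
  have i_ee: "integrable M (\<lambda>x. e j x * cnj (e k x))" for j k
    by (rule integrable_const_bound[where B = 1])
       (auto simp: norm_mult intro!: mult_le_one e_le)
  have i_gg: "integrable M (\<lambda>x. g x * cnj (g x))"
  proof (rule integrable_const_bound[where B = "\<bar>B\<bar> * \<bar>B\<bar>"])
    have "norm (g x * cnj (g x)) \<le> \<bar>B\<bar> * \<bar>B\<bar>" if "x \<in> space M" for x
      unfolding norm_mult using g_le[OF that] by (intro mult_mono) auto
    thus "AE x in M. norm (g x * cnj (g x)) \<le> \<bar>B\<bar> * \<bar>B\<bar>" by simp
  qed auto
  have c_cnj: "(LINT x|M. e j x * cnj (g x)) = cnj (c j)" for j
  proof -
    have "(LINT x|M. e j x * cnj (g x)) = (LINT x|M. cnj (g x * cnj (e j x)))"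
      by (simp add: mult.commute)
    also have "\<dots> = cnj (c j)" unfolding c_def by (rule integral_bounded_linear[OF bounded_linear_cnj i_ge])
    finally show ?thesis .
  qed
  define G where "G = Re (LINT x|M. g x * cnj (g x))"
  have le: "(\<Sum>j<N. (norm (c j))\<^sup>2) \<le> G" for N
  proof -
    define p where "p = (\<lambda>x. \<Sum>j<N. c j * e j x)"
    have eq: "(g x - p x) * cnj (g x - p x) = g x * cnj (g x) - (\<Sum>j<N. cnj (c j) * (g x * cnj (e j x)))
       - (\<Sum>j<N. c j * (e j x * cnj (g x))) + (\<Sum>j<N. \<Sum>k<N. c j * cnj (c k) * (e j x * cnj (e k x)))" for x
    proof -
      have cnj_p: "cnj (p x) = (\<Sum>j<N. cnj (c j) * cnj (e j x))"
        unfolding p_def by simp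
      have 1: "g x * cnj (p x) = (\<Sum>j<N. cnj (c j) * (g x * cnj (e j x)))"
        unfolding cnj_p sum_distrib_left by (intro sum.cong) (auto simp only: mult_ac)
      have 2: "p x * cnj (g x) = (\<Sum>j<N. c j * (e j x * cnj (g x)))"
        unfolding p_def sum_distrib_right by (intro sum.cong) (auto simp only: mult_ac)
      have 3: "p x * cnj (p x) = (\<Sum>j<N. \<Sum>k<N. c j * cnj (c k) * (e j x * cnj (e k x)))"
        unfolding cnj_p unfolding p_def sum_product by (intro sum.cong) (auto simp only: mult_ac)
      have "(g x - p x) * cnj (g x - p x) = g x * cnj (g x) - g x * cnj (p x) - p x * cnj (g x) + p x * cnj (p x)"
        by (simp add: algebra_simps)
      thus ?thesis unfolding 1 2 3 .
    qed
    have "has_bochner_integral M (\<lambda>x. (g x - p x) * cnj (g x - p x)) ((LINT x|M. g x * cnj (g x)) - (\<Sum>j<N. cnj (c j) * c j)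
       - (\<Sum>j<N. c j * cnj (c j)) + (\<Sum>j<N. \<Sum>k<N. c j * cnj (c k) * (if j = k then 1 else 0)))"
      unfolding eq
    proof (intro has_bochner_integral_add has_bochner_integral_diff has_bochner_integral_sum has_bochner_integral_mult_right)
      show "has_bochner_integral M (\<lambda>x. g x * cnj (g x)) (LINT x|M. g x * cnj (g x))"
        using i_gg by (rule has_bochner_integral_integrable)
      show "has_bochner_integral M (\<lambda>x. g x * cnj (e j x)) (c j)" for j
        unfolding c_def using i_ge by (rule has_bochner_integral_integrable)
      show "has_bochner_integral M (\<lambda>x. e j x * cnj (g x)) (cnj (c j))" for j
        unfolding c_cnj[symmetric] using i_eg by (rule has_bochner_integral_integrable)
      show "has_bochner_integral M (\<lambda>x. e j x * cnj (e k x)) (if j = k then 1 else 0)" for j k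
        unfolding orth[symmetric] using i_ee by (rule has_bochner_integral_integrable)
    qed
    hence "(LINT x|M. (g x - p x) * cnj (g x - p x)) = (LINT x|M. g x * cnj (g x)) - (\<Sum>j<N. cnj (c j) * c j)
       - (\<Sum>j<N. c j * cnj (c j)) + (\<Sum>j<N. \<Sum>k<N. c j * cnj (c k) * (if j = k then 1 else 0))"
      by (rule has_bochner_integral_integral_eq)
    \<comment> \<open>Orthonormality collapses the double sum to the sum of
      \<open>c j * cnj (c j)\<close>, which cancels one of the two equal single sums.\<close>
    also have "\<dots> = (LINT x|M. g x * cnj (g x)) - (\<Sum>j<N. c j * cnj (c j))"
      by (simp add: mult.commute if_distrib cong: if_cong)
    finally have "Re (LINT x|M. (g x - p x) * cnj (g x - p x)) = G - (\<Sum>j<N. (norm (c j))\<^sup>2)"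
      by (simp add: G_def flip: complex_norm_square)
    moreover have "(LINT x|M. (g x - p x) * cnj (g x - p x)) = of_real (LINT x|M. (norm (g x - p x))\<^sup>2)"
      unfolding complex_norm_square[symmetric] by (rule integral_complex_of_real)
    ultimately have "G - (\<Sum>j<N. (norm (c j))\<^sup>2) = (LINT x|M. (norm (g x - p x))\<^sup>2)" by simp
    also have "\<dots> \<ge> 0" by simp
    finally show ?thesis by simp
  qed
  have "summable (\<lambda>j. (norm (c j))\<^sup>2)"
    by (rule summableI_nonneg_bounded[OF _ le]) auto
  hence "(\<lambda>j. (norm (c j))\<^sup>2) \<longlonglongrightarrow> 0" by (rule summable_LIMSEQ_zero)
  hence "(\<lambda>j. sqrt ((norm (c j))\<^sup>2)) \<longlonglongrightarrow> sqrt 0" by (rule tendsto_real_sqrt)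
  thus ?thesis unfolding c_def by (simp add: tendsto_norm_zero_iff)
qed

definition fourier_basis :: "int \<Rightarrow> real \<Rightarrow> complex" where
  "fourier_basis k x = exp (\<i> * of_real (2 * pi * of_int k * x))"

lemma fourier_basis_mult: "fourier_basis j x * fourier_basis k x = fourier_basis (j + k) x"
  by (simp add: fourier_basis_def exp_add[symmetric] algebra_simps)

lemma cnj_fourier_basis: "cnj (fourier_basis k x) = fourier_basis (- k) x"
  by (simp add: fourier_basis_def exp_cnj)

lemma norm_fourier_basis [simp]: "norm (fourier_basis k x) = 1"
  by (simp add: fourier_basis_def)

lemma fourier_basis_0 [simp]: "fourier_basis 0 x = 1" "fourier_basis k 0 = 1"
  by (simp_all add: fourier_basis_def)

lemma fourier_basis_add_int [simp]: "fourier_basis k (x + of_int n) = fourier_basis k x"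
proof -
  have "fourier_basis k (x + of_int n) = fourier_basis k x * exp (\<i> * of_real (2 * pi * of_int (k * n)))"
    by (simp add: fourier_basis_def exp_add[symmetric] algebra_simps)
  also have "exp (\<i> * of_real (2 * pi * of_int (k * n))) = 1"
    by (subst exp_eq_1) (auto intro!: exI[of _ "k * n"])
  finally show ?thesis by simp
qed

lemma continuous_on_fourier_basis [continuous_intros]: "continuous_on S (fourier_basis k)"
  unfolding fourier_basis_def by (intro continuous_intros)

lemma fourier_basis_measurable [measurable]: "fourier_basis k \<in> borel_measurable borel"
  by (intro borel_measurable_continuous_onI continuous_intros)

text \<open>The period is centred at 0 so that \<open>fourier_basis 1 x - 1\<close> vanishes in it
  only at x = 0, the point at which the Fourier series is evaluated.\<close>

definition unit_period :: "real measure" where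
  "unit_period = restrict_space lborel {-1/2..1/2}"

lemma finite_measure_unit_period: "finite_measure unit_period"
  unfolding unit_period_def
  by (rule finite_measureI) (simp add: emeasure_restrict_space space_restrict_space emeasure_lborel_Icc_eq)

lemma measurable_unit_period: "f \<in> borel_measurable borel \<Longrightarrow> f \<in> borel_measurable unit_period"
  unfolding unit_period_def by (rule measurable_restrict_space1) simp

lemma space_unit_period: "x \<in> space unit_period \<longleftrightarrow> \<bar>x\<bar> \<le> 1 / 2"
proof -
  have "x \<in> {-1/2..1/2} \<longleftrightarrow> \<bar>x\<bar> \<le> 1 / 2" unfolding atLeastAtMost_iff by linarith
  thus ?thesis unfolding unit_period_def space_restrict_space by simp
qed

lemma integral_unit_period:
  fixes f :: "real \<Rightarrow> complex"
  assumes "continuous_on {-1/2..1/2} f"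
  shows "(LINT x|unit_period. f x) = integral {-1/2..1/2} f"
proof -
  have "set_integrable lborel {-1/2..1/2} f"
    by (rule borel_integrable_atLeastAtMost') fact
  thus ?thesis
    using set_borel_integral_eq_integral(2)[of "{-1/2..1/2}" f]
    by (simp add: unit_period_def integral_restrict_space set_lebesgue_integral_def)
qed

lemma integral_fourier_basis: "integral {-1/2..1/2} (fourier_basis k) = (if k = 0 then 1 else 0)"
proof (cases "k = 0")
  case True
  have "fourier_basis 0 = (\<lambda>_. 1)" by (simp add: fun_eq_iff)
  thus ?thesis using True by simp
next
  case False
  let ?F = "\<lambda>x. fourier_basis k x / (\<i> * of_real (2 * pi * of_int k))"
  have "(fourier_basis k has_integral (?F (1/2) - ?F (-1/2))) {-1/2..1/2}"
  proof (rule fundamental_theorem_of_calculus)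
    fix x :: real assume "x \<in> {-1/2..1/2}"
    show "(?F has_vector_derivative fourier_basis k x) (at x within {-1/2..1/2})"
    proof -
      define c where "c = \<i> * of_real (2 * pi * of_int k)"
      have c: "c \<noteq> 0" using False by (simp add: c_def)
      have e: "fourier_basis k x = exp (c * of_real x)" for x
        by (simp add: fourier_basis_def c_def mult_ac)
      have "((\<lambda>z. exp (c * z) / c) has_field_derivative exp (c * of_real x)) (at (of_real x))"
        using c by (auto intro!: derivative_eq_intros)
      thus ?thesis unfolding e c_def[symmetric] by (rule has_vector_derivative_real_field)
    qed
  qed auto
  moreover have "fourier_basis k (1/2) = fourier_basis k (-1/2)"
    using fourier_basis_add_int[of k "-1/2" 1] by simp
  ultimately show ?thesis using False by (simp add: integral_unique)
qed

text \<open>The characteristic function of the standard normal distribution, rescaled by c = sqrt (2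
  pi t): the density at cx is e^{-pi t x^2} / sqrt (2 pi), and the frequency s is chosen so that sc
  = -2 pi k.\<close>

lemma gaussian_fourier:
  assumes "t > 0"
  shows "integrable lborel (\<lambda>x. of_real (exp (- pi * t * x\<^sup>2)) * fourier_basis (- k) x)"
    and "(LINT x|lborel. of_real (exp (- pi * t * x\<^sup>2)) * fourier_basis (- k) x) =
      of_real (exp (- pi * (of_int k)\<^sup>2 / t) / sqrt t)"
proof -
  define c where "c = sqrt (2 * pi * t)"
  have c: "c > 0" "c\<^sup>2 = 2 * pi * t" using assms by (auto simp: c_def)
  define s where "s = - 2 * pi * of_int k / c"
  let ?g = "\<lambda>x. of_real (std_normal_density x) * exp (\<i> * of_real (s * x))"
  have dens: "std_normal_density (c * x) = exp (- pi * t * x\<^sup>2) / sqrt (2 * pi)" for x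
    using c by (simp add: std_normal_density_def power_mult_distrib)
  have osc: "exp (\<i> * of_real (s * (c * x))) = fourier_basis (- k) x" for x
    using c by (simp add: s_def fourier_basis_def mult_ac)
  have resc: "?g (0 + c * x) = of_real (exp (- pi * t * x\<^sup>2)) * fourier_basis (- k) x / of_real (sqrt (2 * pi))" for x
    using dens[of x] osc[of x] by simp
  have "integrable lborel (\<lambda>x. of_real (std_normal_density x) :: complex)"
    using integrable_normal_moment[of 1 0 0] by simp
  hence ig: "integrable lborel ?g"
    by (rule Bochner_Integration.integrable_bound) (auto simp: norm_mult)
  hence "integrable lborel (\<lambda>x. ?g (0 + c * x))"
    using c by (intro lborel_integrable_real_affine) auto
  thus int: "integrable lborel (\<lambda>x. of_real (exp (- pi * t * x\<^sup>2)) * fourier_basis (- k) x)"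
    unfolding resc using integrable_mult_right[of "of_real (sqrt (2 * pi))" lborel
      "\<lambda>x. of_real (exp (- pi * t * x\<^sup>2)) * fourier_basis (- k) x / of_real (sqrt (2 * pi))"] by simp
  have "char std_normal_distribution s = (LINT x|lborel. ?g x)"
    unfolding char_def by (subst integral_density) (auto simp: scaleR_conv_of_real)
  also have "\<dots> = \<bar>c\<bar> *\<^sub>R (LINT x|lborel. ?g (0 + c * x))"
    using c by (intro lborel_integral_real_affine) auto
  also have "\<dots> = of_real (sqrt t) * (LINT x|lborel. of_real (exp (- pi * t * x\<^sup>2)) * fourier_basis (- k) x)"
    unfolding resc using c(1) by (simp add: c_def real_sqrt_mult scaleR_conv_of_real)
  finally have "of_real (sqrt t) * (LINT x|lborel. of_real (exp (- pi * t * x\<^sup>2)) * fourier_basis (- k) x) =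
     of_real (exp (- s\<^sup>2 / 2))"
    unfolding char_std_normal_distribution by simp
  also have "- s\<^sup>2 / 2 = - pi * (of_int k)\<^sup>2 / t"
    unfolding s_def power_divide c(2) using assms by (simp add: power2_eq_square)
  finally show "(LINT x|lborel. of_real (exp (- pi * t * x\<^sup>2)) * fourier_basis (- k) x) =
      of_real (exp (- pi * (of_int k)\<^sup>2 / t) / sqrt t)"
    using assms by (simp add: field_simps)
qed

text \<open>The Taylor remainder |x|^3 / 6 is at most (4/6) |x| on this range, which leaves 1/3 of
  |x|. The range covers pi x for |x| <= 1/2.\<close>

lemma abs_sin_ge:
  fixes x :: real
  assumes "\<bar>x\<bar> \<le> 2"
  shows "\<bar>sin x\<bar> \<ge> \<bar>x\<bar> / 3"
proof -
  have "\<bar>sin x - (\<Sum>m<3. sin_coeff m * x ^ m)\<bar> \<le> inverse (fact 3) * \<bar>x\<bar> ^ 3"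
    by (rule Maclaurin_sin_bound)
  hence "\<bar>sin x - x\<bar> \<le> \<bar>x\<bar> ^ 3 / 6"
    by (simp add: eval_nat_numeral sin_coeff_def)
  also have "\<bar>x\<bar> ^ 3 \<le> 4 * \<bar>x\<bar>"
    using mult_right_mono[OF mult_mono[OF assms assms], of "\<bar>x\<bar>"] by (simp add: power3_eq_cube)
  finally show ?thesis by linarith
qed

text \<open>The chord has length 2 |sin (pi x)|. Linear vanishing of the denominator at 0 is what
  makes the quotient \<open>g\<close> in the proof of theta inversion bounded once its numerator is
  Lipschitz at 0.\<close>

lemma norm_fourier_basis_minus_one:
  assumes "\<bar>x\<bar> \<le> 1 / 2"
  shows "norm (fourier_basis 1 x - 1) \<ge> 2 * \<bar>x\<bar>"
proof -
  have "norm (fourier_basis 1 x - 1) = 2 * \<bar>sin (pi * x)\<bar>"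
    using dist_exp_i_1[of "2 * pi * x"] by (simp add: fourier_basis_def)
  moreover have "\<bar>pi * x\<bar> \<le> 2"
    using mult_mono[of pi 4 "\<bar>x\<bar>" "1/2"] assms pi_less_4 by (simp add: abs_mult)
  hence "\<bar>sin (pi * x)\<bar> \<ge> \<bar>pi * x\<bar> / 3" by (rule abs_sin_ge)
  moreover have "\<bar>pi * x\<bar> \<ge> 3 * \<bar>x\<bar>" using pi_gt3 by (simp add: abs_mult mult_right_mono)
  ultimately show ?thesis by linarith
qed

section \<open>The theta inversion formula\<close>

text \<open>The translates of the centred unit interval by -N, ..., N tile the interval on the
  right. Working with finitely many translates postpones the interchange of sum and integral to a
  limit in N.\<close>

lemma integral_periodization:
  fixes h :: "real \<Rightarrow> complex"
  assumes "continuous_on UNIV h"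
  shows "integral {-1/2..1/2} (\<lambda>x. h x + (\<Sum>n<N. h (x + real (Suc n)) + h (x - real (Suc n)))) =
         integral {-(real N + 1/2)..real N + 1/2} h"
proof (induction N)
  case 0
  show ?case by simp
next
  case (Suc N)
  have c: "continuous_on S (\<lambda>x. h (x + c))" "continuous_on S (\<lambda>x. h (x - c))" "continuous_on S h" for c S
    by (rule continuous_on_compose2[OF assms]; force intro: continuous_intros continuous_on_subset[OF assms])+
  have i: "(\<lambda>x. h (x + c)) integrable_on {a..b}" "(\<lambda>x. h (x - c)) integrable_on {a..b}" "h integrable_on {a..b}" for c a b
    by (intro integrable_continuous_real c)+
  have "integral {-1/2..1/2} (\<lambda>x. h x + (\<Sum>n<Suc N. h (x + real (Suc n)) + h (x - real (Suc n)))) =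
        integral {-1/2..1/2} (\<lambda>x. (h x + (\<Sum>n<N. h (x + real (Suc n)) + h (x - real (Suc n)))) + (h (x + real (Suc N)) + h (x - real (Suc N))))"
    by (simp add: add_ac)
  also have "\<dots> = integral {-(real N + 1/2)..real N + 1/2} h + (integral {-1/2..1/2} (\<lambda>x. h (x + real (Suc N))) +
      integral {-1/2..1/2} (\<lambda>x. h (x - real (Suc N))))"
    unfolding Suc.IH[symmetric]
    by (simp only: Henstock_Kurzweil_Integration.integral_add integrable_add integrable_sum i finite_lessThan)
  also have "integral {-1/2..1/2} (\<lambda>x. h (x + real (Suc N))) = integral {real N + 1/2..real (Suc N) + 1/2} h"
    using integral_shift_real_ivl[of "real N + 1/2" "real (Suc N)" "real (Suc N) + 1/2" h] by (simp add: algebra_simps)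
  also have "integral {-1/2..1/2} (\<lambda>x. h (x - real (Suc N))) = integral {-(real (Suc N) + 1/2)..-(real N + 1/2)} h"
    using integral_shift_real_ivl[of "-(real (Suc N) + 1/2)" "-real (Suc N)" "-(real N + 1/2)" h] by (simp add: algebra_simps)
  also have "integral {-(real N + 1/2)..real N + 1/2} h + (integral {real N + 1/2..real (Suc N) + 1/2} h +
      integral {-(real (Suc N) + 1/2)..-(real N + 1/2)} h) = integral {-(real (Suc N) + 1/2)..real (Suc N) + 1/2} h"
  proof -
    have e1: "integral {-(real (Suc N) + 1/2)..-(real N + 1/2)} h + integral {-(real N + 1/2)..real N + 1/2} h =
        integral {-(real (Suc N) + 1/2)..real N + 1/2} h"
      by (rule Henstock_Kurzweil_Integration.integral_combine) (auto intro: i)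
    have e2: "integral {-(real (Suc N) + 1/2)..real N + 1/2} h + integral {real N + 1/2..real (Suc N) + 1/2} h =
        integral {-(real (Suc N) + 1/2)..real (Suc N) + 1/2} h"
      by (rule Henstock_Kurzweil_Integration.integral_combine) (auto intro: i)
    show ?thesis unfolding e2[symmetric] e1[symmetric] by (simp only: add_ac)
  qed
  finally show ?case .
qed

text \<open>Dominated convergence, with the bounds N + 1/2 produced by the tiling. It also links
  gauge integrals, for which the fundamental theorem is available, to Lebesgue integrals over the
  line.\<close>

lemma integral_Icc_tendsto_lborel:
  fixes h :: "real \<Rightarrow> complex"
  assumes "integrable lborel h"
  shows "(\<lambda>N. integral {-(real N + 1/2)..real N + 1/2} h) \<longlonglongrightarrow> (LINT x|lborel. h x)"
proof -
  let ?A = "\<lambda>N. {-(real N + 1/2)..real N + 1/2}"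
  have "(\<lambda>N. LINT x|lborel. indicator (?A N) x *\<^sub>R h x) \<longlonglongrightarrow> (LINT x|lborel. h x)"
  proof (rule integral_dominated_convergence[where w = "\<lambda>x. norm (h x)"])
    show "AE x in lborel. (\<lambda>N. indicator (?A N) x *\<^sub>R h x) \<longlonglongrightarrow> h x"
    proof (rule AE_I2)
      fix x
      have "eventually (\<lambda>N. h x = indicator (?A N) x *\<^sub>R h x) sequentially"
        using eventually_ge_at_top[of "nat \<lceil>\<bar>x\<bar>\<rceil>"]
      proof eventually_elim
        case (elim N)
        hence "x \<in> ?A N" unfolding atLeastAtMost_iff by linarith
        thus ?case by (simp only: indicator_simps scaleR_one)
      qed
      thus "(\<lambda>N. indicator (?A N) x *\<^sub>R h x) \<longlonglongrightarrow> h x"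
        by (rule Lim_transform_eventually[OF tendsto_const])
    qed
  qed (use assms in \<open>auto simp: indicator_def\<close>)
  also have "(\<lambda>N. LINT x|lborel. indicator (?A N) x *\<^sub>R h x) = (\<lambda>N. integral (?A N) h)"
  proof
    fix N
    have "set_integrable lborel (?A N) h"
      unfolding set_integrable_def using assms by (intro integrable_mult_indicator) auto
    thus "(LINT x|lborel. indicator (?A N) x *\<^sub>R h x) = integral (?A N) h"
      using set_borel_integral_eq_integral(2) unfolding set_lebesgue_integral_def by blast
  qed
  finally show ?thesis .
qed

text \<open>A Lipschitz estimate for e^{-x} on x >= m, from 1 - e^{-d} <= d. Applied termwise it
  shows that the periodized Gaussian is Lipschitz at 0 without differentiating a series.\<close>

lemma abs_exp_minus_diff_le:
  fixes p q m :: real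
  assumes "m \<le> p" "m \<le> q"
  shows "\<bar>exp (- p) - exp (- q)\<bar> \<le> \<bar>p - q\<bar> * exp (- m)"
proof -
  have *: "\<bar>exp (- p) - exp (- q)\<bar> \<le> \<bar>p - q\<bar> * exp (- m)" if "m \<le> p" "p \<le> q" for p q :: real
  proof -
    have "1 - exp (- (q - p)) \<le> q - p" using exp_ge_add_one_self[of "- (q - p)"] by linarith
    hence "exp (- p) * (1 - exp (- (q - p))) \<le> exp (- m) * (q - p)"
      using that by (intro mult_mono) auto
    thus ?thesis using that by (simp add: algebra_simps flip: exp_add)
  qed
  show ?thesis using *[of p q] *[of q p] assms by (cases "p \<le> q") (auto simp: abs_minus_commute)
qed

lemma telescoping_symmetric_sum:
  fixes c :: "int \<Rightarrow> 'a :: ab_group_add"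
  shows "(c (- 1) - c 0) + (\<Sum>n<N. (c (int (Suc n) - 1) - c (int (Suc n))) + (c (- int (Suc n) - 1) - c (- int (Suc n)))) =
     c (- int N - 1) - c (int N)"
proof (induction N)
  case (Suc N)
  have e: "c (int (Suc N) - 1) = c (int N)" "c (- int N - 1) = c (- int (Suc N))"
    by (rule arg_cong[where f = c], simp)+
  show ?case
    unfolding sum.lessThan_Suc add.assoc[symmetric] Suc.IH unfolding e
    by (simp del: of_nat_Suc)
qed simp

text \<open>Chernoff's proof of pointwise Fourier convergence: dividing the periodized Gaussian minus its value
  at 0 by \<open>exp (2 \<pi> i x) - 1\<close> leaves a bounded function \<open>g\<close>, and the partial sums of the Fourier series
  at 0 telescope in the coefficients of \<open>g\<close>, which tend to 0.\<close>

lemma theta_inversion_real: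
  assumes "t > 0"
  shows "theta (of_real t) = of_real (1 / sqrt t) * theta (of_real (1 / t))"
proof -
  define a where "a = (\<lambda>u. exp (- (pi * t * u\<^sup>2)))"
  define b where "b = (\<lambda>n x. a (x + real (Suc n)) + a (x - real (Suc n)))"
  \<comment> \<open>If |u| >= n - 1/2 with n >= 1 then u^2 >= n/4, because (n - 1)(n - 1/4) >= 0.
    Hence \<open>a u\<close> is at most r^n.\<close>
  define r where "r = exp (- (pi * t / 4))"
  define f where "f = (\<lambda>x. a x + (\<Sum>n. b n x))"
  have r: "0 < r" "r < 1" using assms by (auto simp: r_def)
  have a_cont: "continuous_on S a" for S unfolding a_def by (intro continuous_intros)
  have [measurable]: "a \<in> borel_measurable borel" by (rule borel_measurable_continuous_onI[OF a_cont])
  have [measurable]: "b n \<in> borel_measurable borel" for n unfolding b_def by measurable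
  have [measurable]: "f \<in> borel_measurable borel" unfolding f_def by measurable
  have sq_ge: "real (Suc n) / 4 \<le> u\<^sup>2" if "\<bar>u\<bar> \<ge> real (Suc n) - 1 / 2" for u n
  proof -
    have "(real (Suc n) - 1 / 2)\<^sup>2 \<le> \<bar>u\<bar>\<^sup>2" using that by (intro power_mono) auto
    moreover have "real (Suc n) / 4 \<le> (real (Suc n) - 1 / 2)\<^sup>2" by (simp add: power2_eq_square field_simps)
    ultimately show ?thesis by simp
  qed
  have r_pow: "exp (- (pi * t * (real (Suc n) / 4))) = r ^ Suc n" for n
    unfolding r_def by (subst exp_of_nat_mult[symmetric]) (simp add: field_simps)
  have a_le: "a u \<le> r ^ Suc n" if "\<bar>u\<bar> \<ge> real (Suc n) - 1 / 2" for u n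
    unfolding a_def r_pow[symmetric] using sq_ge[OF that] assms by (auto intro: mult_left_mono)
  have b_le: "norm (b n x) \<le> 2 * r ^ Suc n" if "\<bar>x\<bar> \<le> 1 / 2" for n x
  proof -
    have "\<bar>x + real (Suc n)\<bar> \<ge> real (Suc n) - 1 / 2" "\<bar>x - real (Suc n)\<bar> \<ge> real (Suc n) - 1 / 2"
      using that by linarith+
    from this[THEN a_le] show ?thesis unfolding b_def by (simp add: a_def)
  qed
  have sr: "summable (\<lambda>n. 2 * r ^ Suc n)"
    using r by (intro summable_mult) (subst summable_Suc_iff, simp)
  have b_sum: "summable (\<lambda>n. b n x)" if "\<bar>x\<bar> \<le> 1 / 2" for x
    using b_le[OF that] by (intro summable_comparison_test'[OF sr, of 0]) auto
  \<comment> \<open>The increment of u^2 from s to x + s is x(x + 2s), and |x + 2s| <= 1/2 + 2(n+1)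
    <= 3(n+1).\<close>
  have a_diff: "\<bar>a (x + s) - a s\<bar> \<le> \<bar>x\<bar> * (pi * t * (3 * real (Suc n)) * r ^ n)"
    if x: "\<bar>x\<bar> \<le> 1 / 2" and s: "\<bar>s\<bar> = real (Suc n)" for x s n
  proof -
    have "\<bar>x + s\<bar> \<ge> real (Suc n) - 1 / 2" "\<bar>s\<bar> \<ge> real (Suc n) - 1 / 2"
      using that by linarith+
    hence "\<bar>a (x + s) - a s\<bar> \<le> \<bar>pi * t * (x + s)\<^sup>2 - pi * t * s\<^sup>2\<bar> * exp (- (pi * t * (real (Suc n) / 4)))"
      unfolding a_def using assms by (intro abs_exp_minus_diff_le mult_left_mono sq_ge) auto
    also have "pi * t * (x + s)\<^sup>2 - pi * t * s\<^sup>2 = x * (pi * t * (x + 2 * s))"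
      by (simp add: power2_eq_square algebra_simps)
    also have "\<bar>x * (pi * t * (x + 2 * s))\<bar> * exp (- (pi * t * (real (Suc n) / 4))) =
        \<bar>x\<bar> * (pi * t * \<bar>x + 2 * s\<bar> * r ^ Suc n)"
      unfolding r_pow using assms by (simp add: abs_mult)
    also have "\<dots> \<le> \<bar>x\<bar> * (pi * t * (3 * real (Suc n)) * r ^ n)"
    proof (intro mult_left_mono mult_mono)
      have "\<bar>x + 2 * s\<bar> \<le> \<bar>x\<bar> + 2 * \<bar>s\<bar>" by linarith
      moreover define S where "S = real (Suc n)"
      moreover have "S \<ge> 1" by (simp add: S_def)
      ultimately show "\<bar>x + 2 * s\<bar> \<le> 3 * real (Suc n)"
        using x s unfolding S_def[symmetric] by linarith
      show "r ^ Suc n \<le> r ^ n" using r by (intro power_decreasing) auto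
    qed (use assms r in auto)
    finally show ?thesis .
  qed
  define D where "D = (\<lambda>n. 2 * (pi * t * (3 * real (Suc n)) * r ^ n))"
  have D_sum: "summable D"
  proof -
    have "summable (\<lambda>n. 6 * pi * t * (of_nat (Suc n) * r ^ n))"
      using geometric_deriv_sums[of r] r by (intro summable_mult) (auto simp: sums_iff)
    moreover have "D = (\<lambda>n. 6 * pi * t * (of_nat (Suc n) * r ^ n))"
      by (simp add: D_def fun_eq_iff algebra_simps)
    ultimately show ?thesis by simp
  qed
  have b_diff: "norm (b n x - b n 0) \<le> \<bar>x\<bar> * D n" if "\<bar>x\<bar> \<le> 1 / 2" for n x
  proof -
    have "norm (b n x - b n 0) = \<bar>(a (x + real (Suc n)) - a (real (Suc n))) + (a (x + - real (Suc n)) - a (- real (Suc n)))\<bar>"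
      unfolding b_def by (simp del: of_nat_Suc)
    also have "\<dots> \<le> \<bar>a (x + real (Suc n)) - a (real (Suc n))\<bar> + \<bar>a (x + - real (Suc n)) - a (- real (Suc n))\<bar>"
      by (rule abs_triangle_ineq)
    also have "\<dots> \<le> \<bar>x\<bar> * (pi * t * (3 * real (Suc n)) * r ^ n) + \<bar>x\<bar> * (pi * t * (3 * real (Suc n)) * r ^ n)"
      using that by (intro add_mono a_diff) auto
    also have "\<dots> = \<bar>x\<bar> * D n" by (simp add: D_def algebra_simps)
    finally show ?thesis .
  qed
  define C where "C = pi * t + suminf D"
  have f_diff: "\<bar>f x - f 0\<bar> \<le> \<bar>x\<bar> * C" if "\<bar>x\<bar> \<le> 1 / 2" for x
  proof -
    have "\<bar>a x - a 0\<bar> \<le> \<bar>pi * t * x\<^sup>2 - pi * t * 0\<^sup>2\<bar> * exp (- 0)"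
      unfolding a_def using assms by (intro abs_exp_minus_diff_le) auto
    also have "\<dots> = pi * t * (\<bar>x\<bar> * \<bar>x\<bar>)"
      using assms by (simp add: abs_mult power2_eq_square)
    also have "\<dots> \<le> pi * t * (\<bar>x\<bar> * 1)" using assms that by (intro mult_left_mono) auto
    finally have 1: "\<bar>a x - a 0\<bar> \<le> \<bar>x\<bar> * (pi * t)" by (simp add: mult_ac)
    have "norm (\<Sum>n. b n x - b n 0) \<le> (\<Sum>n. \<bar>x\<bar> * D n)"
      by (rule norm_suminf_le[OF b_diff[OF that] summable_mult[OF D_sum]])
    also have "(\<Sum>n. \<bar>x\<bar> * D n) = \<bar>x\<bar> * suminf D" by (rule suminf_mult[OF D_sum])
    also have "(\<Sum>n. b n x - b n 0) = (\<Sum>n. b n x) - (\<Sum>n. b n 0)"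
      using b_sum[OF that] b_sum[of 0] by (simp add: suminf_diff)
    finally have 2: "\<bar>(\<Sum>n. b n x) - (\<Sum>n. b n 0)\<bar> \<le> \<bar>x\<bar> * suminf D" by simp
    have "\<bar>x\<bar> * C = \<bar>x\<bar> * (pi * t) + \<bar>x\<bar> * suminf D" by (simp add: C_def distrib_left)
    thus ?thesis using 1 2 unfolding f_def by linarith
  qed
  have f0: "of_real (f 0) = theta (of_real t)"
  proof -
    have "(\<lambda>n. b n 0) sums (\<Sum>n. b n 0)" using b_sum[of 0] by (simp add: summable_sums)
    hence "(\<lambda>n. complex_of_real (b n 0)) sums of_real (\<Sum>n. b n 0)" by (rule sums_of_real)
    also have "(\<lambda>n. complex_of_real (b n 0)) = (\<lambda>n. 2 * exp (- of_real pi * (of_nat (Suc n))\<^sup>2 * of_real t))"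
      unfolding b_def a_def by (auto simp: fun_eq_iff mult_ac exp_of_real[symmetric] simp del: of_nat_Suc)
    finally have "of_real (\<Sum>n. b n 0) = theta (of_real t) - 1"
      using theta_sums[of "of_real t"] assms sums_unique2 by fastforce
    thus ?thesis by (simp add: f_def a_def)
  qed
  define fN where "fN = (\<lambda>N x. a x + (\<Sum>n<N. b n x))"
  define B where "B = 1 + (\<Sum>n. 2 * r ^ Suc n)"
  have a_le1: "\<bar>a x\<bar> \<le> 1" for x unfolding a_def using assms by simp
  have fN_le: "\<bar>fN N x\<bar> \<le> B" if "\<bar>x\<bar> \<le> 1 / 2" for N x
  proof -
    have "\<bar>\<Sum>n<N. b n x\<bar> \<le> (\<Sum>n<N. 2 * r ^ Suc n)"
      using b_le[OF that] by (intro order_trans[OF sum_abs] sum_mono) auto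
    also have "\<dots> \<le> (\<Sum>n. 2 * r ^ Suc n)" using r by (intro sum_le_suminf sr) auto
    finally show ?thesis using a_le1[of x] unfolding fN_def B_def by linarith
  qed
  have fN_lim: "(\<lambda>N. fN N x) \<longlonglongrightarrow> f x" if "\<bar>x\<bar> \<le> 1 / 2" for x
    unfolding fN_def f_def by (intro tendsto_intros summable_LIMSEQ b_sum that)
  have f_le: "\<bar>f x\<bar> \<le> B" if "\<bar>x\<bar> \<le> 1 / 2" for x
    by (rule LIMSEQ_le_const2[OF tendsto_rabs[OF fN_lim[OF that]]]) (use fN_le[OF that] in auto)
  interpret finite_measure unit_period by (rule finite_measure_unit_period)
  note on_period = fN_lim[folded space_unit_period] fN_le[folded space_unit_period] f_le[folded space_unit_period]
  \<comment> \<open>The Fourier coefficients of the periodization are values of the Fourier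
    transform of the Gaussian: exact for each partial sum \<open>fN\<close> over a longer interval,
    then passed to the limit on both sides. The constant \<open>B\<close> dominates on the
    period.\<close>
  have coeff: "(LINT x|unit_period. of_real (f x) * fourier_basis (- k) x) =
      of_real (exp (- pi * (of_int k)\<^sup>2 / t) / sqrt t)" for k
  proof -
    define h where "h = (\<lambda>x. of_real (a x) * fourier_basis (- k) x)"
    have "a = (\<lambda>x. exp (- pi * t * x\<^sup>2))" by (simp add: a_def)
    hence h: "integrable lborel h" "(LINT x|lborel. h x) = of_real (exp (- pi * (of_int k)\<^sup>2 / t) / sqrt t)"
      unfolding h_def using gaussian_fourier[OF assms, of k] by simp_all
    have h_cont: "continuous_on UNIV h" unfolding h_def by (intro continuous_intros a_cont)
    have h_shift: "h (x + real n) = of_real (a (x + real n)) * fourier_basis (- k) x"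
         "h (x - real n) = of_real (a (x - real n)) * fourier_basis (- k) x" for x n
      using fourier_basis_add_int[of "- k" x "int n"] fourier_basis_add_int[of "- k" x "- int n"]
      by (simp_all add: h_def del: fourier_basis_add_int)
    have "(\<lambda>N. LINT x|unit_period. of_real (fN N x) * fourier_basis (- k) x) \<longlonglongrightarrow>
            (LINT x|unit_period. of_real (f x) * fourier_basis (- k) x)"
    proof (rule integral_dominated_convergence[where w = "\<lambda>_. B"])
      show "AE x in unit_period. (\<lambda>N. of_real (fN N x) * fourier_basis (- k) x) \<longlonglongrightarrow> of_real (f x) * fourier_basis (- k) x"
        by (intro AE_I2 tendsto_intros on_period)
      show "\<And>N. AE x in unit_period. norm (of_real (fN N x) * fourier_basis (- k) x) \<le> B"
        by (intro AE_I2) (simp add: norm_mult on_period)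
    qed (auto simp: fN_def intro!: measurable_unit_period)
    moreover have "(LINT x|unit_period. of_real (fN N x) * fourier_basis (- k) x) =
        integral {-(real N + 1/2)..real N + 1/2} h" for N
    proof -
      have eq: "of_real (fN N x) * fourier_basis (- k) x = h x + (\<Sum>n<N. h (x + real (Suc n)) + h (x - real (Suc n)))" for x
        unfolding h_shift fN_def b_def
        by (simp add: h_def algebra_simps sum_distrib_left sum_distrib_right sum.distrib)
      have "continuous_on {-1/2..1/2} (\<lambda>x. of_real (fN N x) * fourier_basis (- k) x)"
        unfolding fN_def b_def
        by (intro continuous_intros a_cont continuous_on_compose2[OF a_cont[of UNIV]]) auto
      from integral_unit_period[OF this] show ?thesis
        unfolding eq integral_periodization[OF h_cont] .
    qed
    ultimately show ?thesis
      using integral_Icc_tendsto_lborel[OF h(1)] h(2) LIMSEQ_unique by auto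
  qed
  \<comment> \<open>At x = 0 division by zero gives the value 0; the factorization \<open>fg\<close>
    still holds there because its left side is f 0 - f 0.\<close>
  define g where "g = (\<lambda>x. of_real (f x - f 0) / (fourier_basis 1 x - 1))"
  have [measurable]: "g \<in> borel_measurable unit_period"
    unfolding g_def by (intro measurable_unit_period) measurable
  define K where "K = C / 2"
  have g_le: "norm (g x) \<le> K" if "\<bar>x\<bar> \<le> 1 / 2" for x
  proof (cases "x = 0")
    case True
    \<comment> \<open>Only C >= 0 is wanted, read off from the Lipschitz bound at one nonzero
      point.\<close>
    have "0 \<le> \<bar>1/2\<bar> * C" using f_diff[of "1/2"] by linarith
    thus ?thesis using True by (simp add: g_def K_def)
  next
    case False
    have "norm (g x) \<le> (\<bar>x\<bar> * C) / (2 * \<bar>x\<bar>)"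
      unfolding g_def norm_divide norm_of_real using False order_trans[OF abs_ge_zero f_diff[OF that]]
      by (intro frac_le f_diff norm_fourier_basis_minus_one that) auto
    thus ?thesis using False by (simp add: K_def)
  qed
  have fg: "of_real (f x - f 0) = (fourier_basis 1 x - 1) * g x" if "\<bar>x\<bar> \<le> 1 / 2" for x
  proof (cases "x = 0")
    case False
    hence "fourier_basis 1 x - 1 \<noteq> 0" using norm_fourier_basis_minus_one[OF that] by auto
    thus ?thesis by (simp add: g_def)
  qed auto
  define c where "c = (\<lambda>k. LINT x|unit_period. g x * fourier_basis (- k) x)"
  have fbm [measurable]: "fourier_basis k \<in> borel_measurable unit_period" for k
    by (intro measurable_unit_period) measurable
  have int_g: "integrable unit_period (\<lambda>x. g x * fourier_basis k x)" for k
  proof (rule integrable_const_bound)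
    show "AE x in unit_period. norm (g x * fourier_basis k x) \<le> K"
      by (rule AE_I2) (simp only: norm_mult norm_fourier_basis mult_1_right g_le[folded space_unit_period])
  qed measurable
  have int_f: "integrable unit_period (\<lambda>x. of_real (f x) * fourier_basis k x)" for k
  proof (rule integrable_const_bound)
    show "AE x in unit_period. norm (of_real (f x) * fourier_basis k x :: complex) \<le> B"
      by (rule AE_I2) (simp only: norm_mult norm_of_real norm_fourier_basis mult_1_right on_period)
  qed (intro measurable_unit_period, measurable)
  have int_e: "integrable unit_period (fourier_basis k)" for k
    by (rule integrable_const_bound[where B = 1]) auto
  have int_basis: "(LINT x|unit_period. fourier_basis k x) = (if k = 0 then 1 else 0)" for k
    using integral_unit_period[of "fourier_basis k"] integral_fourier_basis[of k]
    by (simp add: continuous_on_fourier_basis)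
  \<comment> \<open>Multiplication by \<open>fourier_basis 1\<close> shifts the index of a
    coefficient by one, so f - f 0 = (\<open>fourier_basis 1\<close> - 1) g gives a difference of
    consecutive coefficients of g. The constant f 0 contributes to k = 0 alone.\<close>
  have coeff_g: "of_real (exp (- pi * (of_int k)\<^sup>2 / t) / sqrt t) - of_real (f 0) * (if k = 0 then 1 else 0) = c (k - 1) - c k" for k
  proof -
    have "of_real (exp (- pi * (of_int k)\<^sup>2 / t) / sqrt t) - of_real (f 0) * (if k = 0 then 1 else 0) =
        (LINT x|unit_period. of_real (f x) * fourier_basis (- k) x) - of_real (f 0) * (LINT x|unit_period. fourier_basis (- k) x)"
      unfolding coeff int_basis by simp
    also have "\<dots> = (LINT x|unit_period. of_real (f x) * fourier_basis (- k) x - of_real (f 0) * fourier_basis (- k) x)"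
      by (subst Bochner_Integration.integral_diff) (auto intro: int_f int_e)
    also have "\<dots> = (LINT x|unit_period. g x * fourier_basis (- (k - 1)) x - g x * fourier_basis (- k) x)"
    proof (rule Bochner_Integration.integral_cong)
      fix x assume "x \<in> space unit_period"
      hence "of_real (f x) - of_real (f 0) = (fourier_basis 1 x - 1) * g x" using fg[folded space_unit_period, of x] by simp
      hence "of_real (f x) * fourier_basis (- k) x - of_real (f 0) * fourier_basis (- k) x = (fourier_basis 1 x - 1) * g x * fourier_basis (- k) x"
        by (simp only: left_diff_distrib[symmetric])
      also have "\<dots> = g x * (fourier_basis 1 x * fourier_basis (- k) x) - g x * fourier_basis (- k) x"
        by (simp add: algebra_simps)
      finally show "of_real (f x) * fourier_basis (- k) x - of_real (f 0) * fourier_basis (- k) x =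
          g x * fourier_basis (- (k - 1)) x - g x * fourier_basis (- k) x"
        unfolding fourier_basis_mult by simp
    qed simp
    also have "\<dots> = c (k - 1) - c k"
      unfolding c_def by (intro Bochner_Integration.integral_diff int_g)
    finally show ?thesis .
  qed
  \<comment> \<open>Injectivity keeps the selected frequencies orthonormal. It is applied to the two
    ends -N-1 and N of the telescoped sum.\<close>
  have c_lim: "(\<lambda>n. c (\<kappa> n)) \<longlonglongrightarrow> 0" if "inj \<kappa>" for \<kappa> :: "nat \<Rightarrow> int"
  proof -
    have "(\<lambda>n. LINT x|unit_period. g x * cnj (fourier_basis (\<kappa> n) x)) \<longlonglongrightarrow> 0"
    proof (rule bessel_tendsto_0[where B = K])
      show "finite_measure unit_period" by (rule finite_measure_unit_period)
      show "(LINT x|unit_period. fourier_basis (\<kappa> j) x * cnj (fourier_basis (\<kappa> k) x)) = (if j = k then 1 else 0)" for j k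
        unfolding cnj_fourier_basis fourier_basis_mult int_basis using that by (auto dest: injD)
    qed (auto simp: g_le[folded space_unit_period])
    thus ?thesis unfolding c_def cnj_fourier_basis .
  qed
  have lim0: "(\<lambda>N. c (- int N - 1) - c (int N)) \<longlonglongrightarrow> 0 - 0"
    by (intro tendsto_diff c_lim) (auto simp: inj_def)
  have partial: "c (- int N - 1) - c (int N) = of_real (1 / sqrt t) * (1 + (\<Sum>n<N. 2 * exp (- of_real pi * (of_nat (Suc n))\<^sup>2 * of_real (1 / t)))) - theta (of_real t)" for N
  proof -
    have "c (- int N - 1) - c (int N) = (c (0 - 1) - c 0) +
       (\<Sum>n<N. (c (int (Suc n) - 1) - c (int (Suc n))) + (c (- int (Suc n) - 1) - c (- int (Suc n))))"
      using telescoping_symmetric_sum[of c N] by simp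
    also have "\<dots> = (of_real (1 / sqrt t) - theta (of_real t)) +
       (\<Sum>n<N. 2 * of_real (exp (- pi * (real (Suc n))\<^sup>2 / t) / sqrt t))"
      unfolding coeff_g[symmetric] f0 by (simp del: of_nat_Suc)
    also have "(\<Sum>n<N. 2 * complex_of_real (exp (- pi * (real (Suc n))\<^sup>2 / t) / sqrt t)) =
        of_real (1 / sqrt t) * (\<Sum>n<N. 2 * exp (- of_real pi * (of_nat (Suc n))\<^sup>2 * of_real (1 / t)))"
      unfolding sum_distrib_left
    proof (rule sum.cong)
      fix n
      have "exp (- of_real pi * (of_nat (Suc n))\<^sup>2 * of_real (1 / t)) = complex_of_real (exp (- pi * (real (Suc n))\<^sup>2 / t))"
        unfolding exp_of_real[symmetric] by simp
      thus "2 * complex_of_real (exp (- pi * (real (Suc n))\<^sup>2 / t) / sqrt t) =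
         of_real (1 / sqrt t) * (2 * exp (- of_real pi * (of_nat (Suc n))\<^sup>2 * of_real (1 / t)))"
        by (simp only: of_real_divide of_real_1) simp
    qed simp
    finally show ?thesis by (simp add: algebra_simps)
  qed
  have lim1: "(\<lambda>N. of_real (1 / sqrt t) * (1 + (\<Sum>n<N. 2 * exp (- of_real pi * (of_nat (Suc n))\<^sup>2 * of_real (1 / t)))) - theta (of_real t))
      \<longlonglongrightarrow> of_real (1 / sqrt t) * (1 + (theta (of_real (1 / t)) - 1)) - theta (of_real t)"
    using theta_sums[of "of_real (1 / t)"] assms unfolding sums_def by (intro tendsto_intros) auto
  show ?thesis using LIMSEQ_unique[OF lim1 lim0[unfolded partial]] by simp
qed

text \<open>Both sides are holomorphic on the half-plane and agree on the positive axis, which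
  accumulates at 1; \<open>exp (Ln z / 2)\<close> is the holomorphic square root that extends sqrt
  t.\<close>

lemma theta_inversion:
  assumes "Re \<tau> > 0"
  shows "theta (1 / \<tau>) = exp (Ln \<tau> / 2) * theta \<tau>"
proof -
  let ?S = "{\<tau>. Re \<tau> > 0}"
  have inv: "Re (1 / z) > 0" if "Re z > 0" for z
    using that by (auto simp: Re_divide power2_eq_square intro!: divide_pos_pos add_pos_nonneg)
  have ne: "z \<notin> \<real>\<^sub>\<le>\<^sub>0" "z \<noteq> 0" if "Re z > 0" for z
    using that by (auto simp: complex_nonpos_Reals_iff)
  have "theta (1 / \<tau>) - exp (Ln \<tau> / 2) * theta \<tau> = 0"
  proof (rule analytic_continuation[where f = "\<lambda>z. theta (1 / z) - exp (Ln z / 2) * theta z" and S = ?S and U = "of_real ` {0<..}" and \<xi> = 1])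
    have "(\<lambda>z. theta (1 / z)) holomorphic_on ?S"
      using ne inv by (intro holomorphic_on_compose_gen[OF _ theta_holomorphic, unfolded o_def])
        (auto intro!: holomorphic_intros)
    thus "(\<lambda>z. theta (1 / z) - exp (Ln z / 2) * theta z) holomorphic_on ?S"
      using ne theta_holomorphic by (intro holomorphic_intros) auto
    show "open ?S" by (rule open_halfspace_Re_gt)
    show "connected ?S" by (intro convex_connected convex_halfspace_Re_gt)
    show "(1 :: complex) islimpt of_real ` {0<..}"
    proof -
      have "(\<lambda>n. of_real (1 + 1 / real (Suc n)) :: complex) \<longlonglongrightarrow> of_real (1 + 0)"
        by (intro tendsto_of_real tendsto_intros LIMSEQ_Suc lim_1_over_n)
      thus ?thesis unfolding islimpt_sequential
        by (intro exI[of _ "\<lambda>n. of_real (1 + 1 / real (Suc n))"]) (auto simp: add_pos_nonneg complex_eq_iff)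
    qed
    fix z :: complex assume "z \<in> of_real ` {0<..}"
    then obtain t where t: "t > 0" "z = of_real t" by auto
    have "exp (Ln z / 2) = of_real (sqrt t)"
    proof -
      have "exp (ln t / 2) = exp (ln (sqrt t))" using t by (simp only: ln_sqrt)
      hence "exp (ln t / 2) = sqrt t" using t by simp
      hence "of_real (sqrt t) = exp (complex_of_real (ln t / 2))" by (simp only: exp_of_real)
      thus ?thesis using t by (simp add: Ln_of_real)
    qed
    thus "theta (1 / z) - exp (Ln z / 2) * theta z = 0"
      using theta_inversion_real[OF t(1)] t by simp
  qed (use assms in auto)
  thus ?thesis by simp
qed

section \<open>The logarithm of theta and the decay of gamma\<close>

text \<open>The difference of two logarithms takes values in 2 pi i Z. These are 2 pi apart, so on a
  connected set a continuous difference is constant.\<close>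

lemma continuous_log_unique:
  fixes f g :: "complex \<Rightarrow> complex"
  assumes S: "connected S" and cont: "continuous_on S f" "continuous_on S g"
    and exp: "\<And>x. x \<in> S \<Longrightarrow> exp (f x) = exp (g x)"
    and a: "a \<in> S" "f a = g a" and x: "x \<in> S"
  shows "f x = g x"
proof -
  have "(\<lambda>x. f x - g x) constant_on S"
  proof (rule continuous_discrete_range_constant[OF S])
    show "continuous_on S (\<lambda>x. f x - g x)" using cont by (intro continuous_intros)
    fix x assume x: "x \<in> S"
    have "2 * pi \<le> norm (f y - g y - (f x - g x))" if y: "y \<in> S" "f y - g y \<noteq> f x - g x" for y
    proof -
      have "exp (f y - g y - (f x - g x)) = 1"
        using exp[OF y(1)] exp[OF x] by (simp add: exp_diff)
      then obtain n :: int where n: "Re (f y - g y - (f x - g x)) = 0"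
          "Im (f y - g y - (f x - g x)) = of_int (2 * n) * pi"
        unfolding exp_eq_1 by blast
      have "n \<noteq> 0" using n y(2) by (auto simp: complex_eq_iff)
      hence "2 * pi \<le> \<bar>of_int (2 * n) * pi\<bar>" by (simp add: abs_mult)
      also have "\<dots> \<le> norm (f y - g y - (f x - g x))"
        unfolding n(2)[symmetric] by (rule abs_Im_le_cmod)
      finally show ?thesis .
    qed
    thus "\<exists>e>0. \<forall>y. y \<in> S \<and> f y - g y \<noteq> f x - g x \<longrightarrow> e \<le> norm (f y - g y - (f x - g x))"
      by (intro exI[of _ "2 * pi"]) auto
  qed
  then obtain c where "\<And>x. x \<in> S \<Longrightarrow> f x - g x = c" unfolding constant_on_def by blast
  from this[OF a(1)] this[OF x] a(2) show ?thesis by simp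
qed

text \<open>A zero-free function on a convex domain has some holomorphic logarithm. Shifting it by a
  constant makes its value at 1 equal to the real number \<open>Ln (theta 1)\<close>; then it must
  coincide with the real logarithm of theta along the whole positive axis.\<close>

lemma log_theta_exists:
  "\<exists>L. L holomorphic_on {\<tau>. Re \<tau> > 0} \<and>
       (\<forall>\<tau>. Re \<tau> > 0 \<longrightarrow> exp (L \<tau>) = theta \<tau>) \<and> (\<forall>t::real. t > 0 \<longrightarrow> L (of_real t) \<in> \<real>)"
proof -
  let ?S = "{\<tau>. Re \<tau> > 0}"
  obtain g where g: "g holomorphic_on ?S" "\<And>x. x \<in> ?S \<Longrightarrow> exp (g x) = theta x"
    by (rule holomorphic_logarithm_exists[OF convex_halfspace_Re_gt[of 0] open_halfspace_Re_gt theta_holomorphic, of 1])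
       (auto simp: theta_nonzero)
  define L where "L = (\<lambda>x. g x - g 1 + Ln (theta 1))"
  have L: "L holomorphic_on ?S" unfolding L_def by (intro holomorphic_intros g)
  have eL: "exp (L x) = theta x" if "x \<in> ?S" for x
    unfolding L_def using g(2)[OF that] g(2)[of 1] theta_nonzero[of 1] by (simp add: exp_add exp_diff)
  have pos: "theta (of_real t) = of_real (Re (theta (of_real t)))" "Re (theta (of_real t)) > 0" if "t > 0" for t
    using theta_of_real[OF that] by (auto simp: complex_eq_iff)
  have re: "L z = of_real (ln (Re (theta z)))" if "z \<in> of_real ` {0<..}" for z
  proof (rule continuous_log_unique[where f = L and g = "\<lambda>z. of_real (ln (Re (theta z)))" and S = "of_real ` {0<..}" and a = 1])
    have sub: "of_real ` {0<..} \<subseteq> ?S" by auto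
    show "connected (complex_of_real ` {0<..})"
      by (intro connected_continuous_image continuous_intros) auto
    show "continuous_on (of_real ` {0<..}) L"
      using L sub holomorphic_on_imp_continuous_on continuous_on_subset by blast
    have nz: "Re (theta x) \<noteq> 0" if "x \<in> of_real ` {0<..}" for x
    proof -
      obtain t where "t > 0" "x = of_real t" using \<open>x \<in> of_real ` {0<..}\<close> by auto
      thus ?thesis using pos(2)[of t] by simp
    qed
    have "continuous_on (of_real ` {0<..}) theta"
      using theta_holomorphic sub holomorphic_on_imp_continuous_on continuous_on_subset by blast
    thus "continuous_on (of_real ` {0<..}) (\<lambda>z. complex_of_real (ln (Re (theta z))))"
      by (intro continuous_intros) (use nz in blast)+
    show "exp (L x) = exp (of_real (ln (Re (theta x))))" if x: "x \<in> of_real ` {0<..}" for x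
    proof -
      obtain t where t: "t > 0" "x = of_real t" using x by auto
      have "exp (complex_of_real (ln (Re (theta x)))) = of_real (Re (theta x))"
        unfolding exp_of_real using pos(2)[OF t(1)] t(2) by simp
      also have "\<dots> = theta x" using pos(1)[OF t(1)] t(2) by simp
      finally show ?thesis using eL[of x] t by simp
    qed
    show "L 1 = of_real (ln (Re (theta 1)))"
      using pos[of 1] unfolding L_def by (metis Ln_of_real diff_self add_0 of_real_1 zero_less_one)
  qed (use that in \<open>auto intro: image_eqI[of _ _ 1]\<close>)
  show ?thesis using L eL re by (intro exI[of _ L]) auto
qed

lemma log_theta_holomorphic: "log_theta holomorphic_on {\<tau>. Re \<tau> > 0}"
  and exp_log_theta: "Re \<tau> > 0 \<Longrightarrow> exp (log_theta \<tau>) = theta \<tau>"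
  and log_theta_real: "t > 0 \<Longrightarrow> log_theta (of_real t) \<in> \<real>"
  using someI_ex[OF log_theta_exists] unfolding log_theta_def[symmetric] by auto

lemma Re_inverse_pos: "Re z > 0 \<Longrightarrow> Re (1 / z) > 0" for z :: complex
  by (auto simp: Re_divide power2_eq_square intro!: divide_pos_pos add_pos_nonneg)

lemma not_nonpos_Reals: "Re z > 0 \<Longrightarrow> z \<notin> \<real>\<^sub>\<le>\<^sub>0"
  by (auto simp: complex_nonpos_Reals_iff)

text \<open>Both sides are continuous logarithms of theta(1/tau), and at tau = 1 they agree because
  Ln 1 = 0.\<close>

lemma log_theta_inversion:
  assumes "Re \<tau> > 0"
  shows "log_theta (1 / \<tau>) = Ln \<tau> / 2 + log_theta \<tau>"
proof (rule continuous_log_unique[where f = "\<lambda>z. log_theta (1 / z)" and g = "\<lambda>z. Ln z / 2 + log_theta z"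
      and S = "{\<tau>. Re \<tau> > 0}" and a = 1])
  let ?S = "{\<tau>. Re \<tau> > 0}"
  have ne: "z \<noteq> 0" if "Re z > 0" for z using that by auto
  show "connected ?S" by (intro convex_connected convex_halfspace_Re_gt)
  have c: "continuous_on ?S log_theta"
    by (rule holomorphic_on_imp_continuous_on[OF log_theta_holomorphic])
  show "continuous_on ?S (\<lambda>z. log_theta (1 / z))"
    by (rule continuous_on_compose2[OF c]) (auto intro!: continuous_intros Re_inverse_pos)
  show "continuous_on ?S (\<lambda>z. Ln z / 2 + log_theta z)"
    by (intro continuous_intros c) (auto dest: not_nonpos_Reals)
  show "exp (log_theta (1 / z)) = exp (Ln z / 2 + log_theta z)" if "z \<in> ?S" for z
    using that exp_log_theta[of z] exp_log_theta[OF Re_inverse_pos[of z]] theta_inversion[of z] by (simp add: exp_add)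
qed (use assms in auto)

text \<open>For Re tau >= 1 theta stays within 1/2 of 1, so there the branch does agree with the
  principal logarithm. The constant is 2 * 4, from |Ln u| <= 2 |u - 1| and the bound for theta -
  1.\<close>

lemma log_theta_bound:
  assumes "Re \<tau> \<ge> 1"
  shows "norm (log_theta \<tau>) \<le> 8 * exp (- pi * Re \<tau>)"
proof -
  let ?S = "{\<tau>. Re \<tau> \<ge> 1}"
  have near: "norm (theta z - 1) < 1 / 2" if "Re z \<ge> 1" for z
  proof -
    \<comment> \<open>From e >= 2 and pi > 3 one gets e^{-pi Re z} < 1/8, and 4/8 is the required
      1/2.\<close>
    have "(2::real) \<le> exp 1" using exp_ge_add_one_self[of 1] by simp
    hence "2 ^ 3 \<le> (exp 1 :: real) ^ 3" by (intro power_mono) auto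
    also have "\<dots> = exp 3" by (simp add: exp_of_nat_mult[symmetric])
    also have "3 < pi * Re z" using pi_gt3 mult_left_mono[OF that, of pi, OF pi_ge_zero] by linarith
    hence "exp 3 < exp (pi * Re z)" by simp
    finally have "exp (- pi * Re z) < 1 / 8" by (simp add: exp_minus field_simps)
    thus ?thesis using theta_minus_one_bound[OF that] by linarith
  qed
  have pos: "Re (theta z) > 0" if "Re z \<ge> 1" for z
    using near[OF that] abs_Re_le_cmod[of "theta z - 1"] by simp
  have sub: "?S \<subseteq> {\<tau>. Re \<tau> > 0}" by auto
  have "log_theta \<tau> = Ln (theta \<tau>)"
  proof (rule continuous_log_unique[where f = log_theta and g = "\<lambda>z. Ln (theta z)" and S = ?S and a = 1])
    show "connected ?S" by (intro convex_connected convex_halfspace_Re_ge)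
    show "continuous_on ?S log_theta"
      using log_theta_holomorphic sub holomorphic_on_imp_continuous_on continuous_on_subset by blast
    have "continuous_on ?S theta"
      using theta_holomorphic sub holomorphic_on_imp_continuous_on continuous_on_subset by blast
    thus "continuous_on ?S (\<lambda>z. Ln (theta z))"
      by (intro continuous_intros) (auto dest: pos not_nonpos_Reals)
    show "exp (log_theta z) = exp (Ln (theta z))" if "z \<in> ?S" for z
      using that exp_log_theta[of z] theta_nonzero[of z] by auto
    obtain r where "log_theta 1 = of_real r" using log_theta_real[of 1] by (auto elim: Reals_cases)
    thus "log_theta 1 = Ln (theta 1)" using exp_log_theta[of 1] Ln_exp[of "of_real r"] pi_gt_zero by auto
  qed (use assms in auto)
  moreover have "norm (Ln (theta \<tau>)) \<le> 2 * norm (theta \<tau> - 1)"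
    using norm_Ln_le[OF near[OF assms]] by simp
  ultimately show ?thesis using theta_minus_one_bound[OF assms] by simp
qed

section \<open>The logarithm of theta in the variable z on the strip, and the symmetry of
  gamma\<close>

definition strip :: "complex set" where
  "strip = {z. \<bar>Im z\<bar> < pi / 4}"

definition ell :: "complex \<Rightarrow> complex" where
  "ell z = log_theta (exp (2 * z))"

lemma open_strip: "open strip"
proof -
  have eq: "strip = {z. Im z < pi / 4} \<inter> {z. Im z > - (pi / 4)}" by (auto simp: strip_def)
  show ?thesis unfolding eq by (intro open_Int open_halfspace_Im_lt open_halfspace_Im_gt)
qed

lemma convex_strip: "convex strip"
proof -
  have eq: "strip = {z. Im z < pi / 4} \<inter> {z. Im z > - (pi / 4)}" by (auto simp: strip_def)
  show ?thesis unfolding eq by (intro convex_Int convex_halfspace_Im_lt convex_halfspace_Im_gt)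
qed

lemma Complex_in_strip: "- pi / 4 < y \<Longrightarrow> y < pi / 4 \<Longrightarrow> Complex x y \<in> strip"
  by (simp add: strip_def)

lemma of_real_in_strip [simp]: "of_real x \<in> strip"
  by (simp add: strip_def)

lemma uminus_in_strip: "z \<in> strip \<Longrightarrow> - z \<in> strip"
  by (simp add: strip_def)

lemma Re_exp_strip_pos: "z \<in> strip \<Longrightarrow> Re (exp (2 * z)) > 0"
  using cos_gt_zero_pi[of "2 * Im z"] unfolding strip_def mem_Collect_eq Re_exp by (simp add: abs_less_iff)

lemma ell_holomorphic: "ell holomorphic_on strip"
  unfolding ell_def
  by (intro holomorphic_on_compose_gen[OF _ log_theta_holomorphic, unfolded o_def] holomorphic_intros)
     (auto intro: Re_exp_strip_pos)

text \<open>z to -z is tau to 1/tau under tau = e^{2z}. On the strip |Im (2z)| < pi/2, so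
  \<open>Ln\<close> inverts \<open>exp\<close> at 2z.\<close>

lemma ell_minus:
  assumes "z \<in> strip"
  shows "ell (- z) = ell z + z"
proof -
  have "ell (- z) = log_theta (1 / exp (2 * z))" by (simp add: ell_def exp_minus field_simps)
  also have "\<dots> = Ln (exp (2 * z)) / 2 + log_theta (exp (2 * z))"
    by (rule log_theta_inversion[OF Re_exp_strip_pos[OF assms]])
  also have "Ln (exp (2 * z)) = 2 * z"
    using assms by (intro Ln_exp) (auto simp: strip_def)
  finally show ?thesis by (simp add: ell_def)
qed

lemma ell_has_deriv: "z \<in> strip \<Longrightarrow> (ell has_field_derivative deriv ell z) (at z)"
  by (rule holomorphic_derivI[OF ell_holomorphic open_strip])

lemma deriv_ell_has_deriv: "z \<in> strip \<Longrightarrow> (deriv ell has_field_derivative deriv (deriv ell) z) (at z)"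
  by (rule holomorphic_derivI[OF holomorphic_deriv[OF ell_holomorphic open_strip] open_strip])

lemma deriv_ell_minus:
  assumes "z \<in> strip"
  shows "deriv ell (- z) = - deriv ell z - 1"
proof -
  have "((\<lambda>z. ell (- z)) has_field_derivative - deriv ell (- z)) (at z)"
    using DERIV_chain2[OF ell_has_deriv[OF uminus_in_strip[OF assms]] DERIV_minus[OF DERIV_ident]] by simp
  moreover have "((\<lambda>z. ell (- z)) has_field_derivative deriv ell z + 1) (at z)"
    by (rule has_field_derivative_transform_within_open[OF DERIV_add[OF ell_has_deriv[OF assms] DERIV_ident] open_strip assms])
       (simp add: ell_minus)
  ultimately have "- deriv ell (- z) = deriv ell z + 1" by (rule DERIV_unique)
  from arg_cong[OF this, of uminus] show ?thesis by simp
qed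

lemma deriv2_ell_minus:
  assumes "z \<in> strip"
  shows "deriv (deriv ell) (- z) = deriv (deriv ell) z"
proof -
  have "((\<lambda>z. deriv ell (- z)) has_field_derivative - deriv (deriv ell) (- z)) (at z)"
    using DERIV_chain2[OF deriv_ell_has_deriv[OF uminus_in_strip[OF assms]] DERIV_minus[OF DERIV_ident]] by simp
  moreover have "((\<lambda>z. deriv ell (- z)) has_field_derivative - deriv (deriv ell) z - 0) (at z)"
    by (rule has_field_derivative_transform_within_open[OF
          DERIV_diff[OF DERIV_minus[OF deriv_ell_has_deriv[OF assms]] DERIV_const[of 1]] open_strip assms])
       (simp add: deriv_ell_minus)
  ultimately have "- deriv (deriv ell) (- z) = - deriv (deriv ell) z - 0" by (rule DERIV_unique)
  thus ?thesis by simp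
qed

text \<open>The factor w from the chain rule cancels the denominator of \<open>h\<close>, so one
  formula covers both branches of its definition.\<close>

lemma h_has_deriv:
  assumes "z \<in> strip"
  shows "(h w has_field_derivative deriv ell z * exp (w * ell z)) (at z)"
proof (cases "w = 0")
  case True
  hence "h w = ell" by (auto simp: h_def ell_def fun_eq_iff)
  thus ?thesis using ell_has_deriv[OF assms] True by simp
next
  case False
  hence "h w = (\<lambda>z. (exp (w * ell z) - 1) / w)" by (auto simp: h_def ell_def theta_pow_def fun_eq_iff)
  thus ?thesis using False by (auto intro!: derivative_eq_intros ell_has_deriv[OF assms])
qed

text \<open>This form is visibly entire in w; the definition by iterated \<open>deriv\<close> does
  not reappear after it.\<close>

lemma gamma_eq:
  assumes "z \<in> strip"
  shows "gamma w z = (deriv (deriv ell) z + w * (deriv ell z)\<^sup>2 + w * deriv ell z) * exp (w * ell z)"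
proof -
  have d1: "deriv (h w) z = deriv ell z * exp (w * ell z)" if "z \<in> strip" for z
    using h_has_deriv[OF that] by (rule DERIV_imp_deriv)
  have "((\<lambda>z. deriv ell z * exp (w * ell z)) has_field_derivative
      (deriv (deriv ell) z + w * (deriv ell z)\<^sup>2) * exp (w * ell z)) (at z)"
    using assms by (auto intro!: derivative_eq_intros ell_has_deriv deriv_ell_has_deriv simp: power2_eq_square algebra_simps)
  hence "(deriv (h w) has_field_derivative (deriv (deriv ell) z + w * (deriv ell z)\<^sup>2) * exp (w * ell z)) (at z)"
    by (rule has_field_derivative_transform_within_open[OF _ open_strip assms]) (simp add: d1)
  hence "deriv (deriv (h w)) z = (deriv (deriv ell) z + w * (deriv ell z)\<^sup>2) * exp (w * ell z)"
    by (rule DERIV_imp_deriv)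
  thus ?thesis unfolding gamma_def by (simp add: numeral_2_eq_2 d1[OF assms] algebra_simps)
qed

text \<open>Under z to -z the second derivative of \<open>ell\<close> is invariant and u =
  \<open>deriv ell z\<close> becomes -u - 1, which preserves u^2 + u. Only the exponential factor
  changes.\<close>

lemma gamma_minus:
  assumes "z \<in> strip"
  shows "gamma w (- z) = exp (w * z) * gamma w z"
  unfolding gamma_eq[OF assms] gamma_eq[OF uminus_in_strip[OF assms]]
    deriv_ell_minus[OF assms] deriv2_ell_minus[OF assms] ell_minus[OF assms]
  by (simp add: exp_add algebra_simps power2_eq_square)

lemma gamma_holomorphic: "gamma w holomorphic_on strip"
proof -
  have "(\<lambda>z. (deriv (deriv ell) z + w * (deriv ell z)\<^sup>2 + w * deriv ell z) * exp (w * ell z)) holomorphic_on strip"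
    by (intro holomorphic_intros ell_holomorphic open_strip)
  thus ?thesis using gamma_eq by (subst holomorphic_cong[OF refl]) auto
qed

section \<open>Decay of \<open>ell\<close>, its derivatives and gamma on closed substrips\<close>

text \<open>Far to the right Re (e^{2z}) grows like e^{2x}, which beats any linear exponent; the
  remaining part of the half-strip is compact. The range starts at -1 to leave room for Cauchy discs
  around points with Re z >= 0.\<close>

lemma ell_bound:
  assumes "\<delta> > 0" "\<delta> < pi / 4" "A \<ge> 0"
  shows "\<exists>C\<ge>0. \<forall>z. Re z \<ge> -1 \<longrightarrow> \<bar>Im z\<bar> \<le> pi / 4 - \<delta> \<longrightarrow> norm (ell z) \<le> C * exp (- A * Re z)"
proof -
  \<comment> \<open>The minimum of cos (2y) over the closed substrip, hence Re (e^{2z}) >= c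
    e^{2x}.\<close>
  define c where "c = sin (2 * \<delta>)"
  have c: "c > 0" unfolding c_def using assms by (intro sin_gt_zero) auto
  have cos_ge: "cos (2 * y) \<ge> c" if "\<bar>y\<bar> \<le> pi / 4 - \<delta>" for y
  proof -
    have "cos (2 * (pi / 4 - \<delta>)) \<le> cos \<bar>2 * y\<bar>"
      using that assms by (intro cos_monotone_0_pi_le) auto
    also have "2 * (pi / 4 - \<delta>) = pi / 2 - 2 * \<delta>" by simp
    finally show ?thesis by (simp add: c_def cos_diff)
  qed
  \<comment> \<open>Beyond X one has c e^{2x} >= 1, the range in which
    \<open>log_theta_bound\<close> applies.\<close>
  define X where "X = max 0 (ln (1 / c))"
  have large: "norm (ell z) \<le> 8 * exp (A\<^sup>2 / (4 * pi * c)) * exp (- A * Re z)"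
    if z: "Re z \<ge> X" "\<bar>Im z\<bar> \<le> pi / 4 - \<delta>" for z
  proof -
    define x where "x = Re z"
    have x: "x \<ge> 0" "x \<ge> ln (1 / c)" using z by (auto simp: X_def x_def)
    have ReE: "Re (exp (2 * z)) \<ge> c * exp (2 * x)"
      using cos_ge[OF z(2)] by (simp add: Re_exp x_def mult.commute)
    have "1 / c \<le> exp x" using x(2) c by (metis divide_pos_pos exp_le_cancel_iff exp_ln zero_less_one)
    also have "\<dots> \<le> exp (2 * x)" using x by simp
    finally have ge1: "c * exp (2 * x) \<ge> 1" using c by (simp add: field_simps)
    have "x\<^sup>2 \<le> (exp x)\<^sup>2" using x exp_ge_add_one_self[of x] by (intro power_mono) linarith+
    hence x2: "x\<^sup>2 \<le> exp (2 * x)" by (simp add: exp_double)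
    \<comment> \<open>With e^{2x} weakened to x^2, completing the square bounds -pi c x^2 by A^2/(4
      pi c) - Ax.\<close>
    have "0 \<le> (2 * pi * c * x - A)\<^sup>2 / (4 * pi * c)" using c by simp
    also have "\<dots> = pi * c * x\<^sup>2 - A * x + A\<^sup>2 / (4 * pi * c)"
      using c by (simp add: field_simps power2_eq_square)
    finally have "- (pi * (c * x\<^sup>2)) \<le> A\<^sup>2 / (4 * pi * c) - A * x" by simp
    moreover have "pi * (c * x\<^sup>2) \<le> pi * Re (exp (2 * z))"
      using order_trans[OF mult_left_mono[OF x2, of c] ReE] c by (intro mult_left_mono) auto
    ultimately have "- pi * Re (exp (2 * z)) \<le> A\<^sup>2 / (4 * pi * c) + (- A * x)"
      unfolding mult_minus_left by linarith
    hence "exp (- pi * Re (exp (2 * z))) \<le> exp (A\<^sup>2 / (4 * pi * c) + (- A * x))" by simp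
    moreover have "norm (ell z) \<le> 8 * exp (- pi * Re (exp (2 * z)))"
      unfolding ell_def using ReE ge1 by (intro log_theta_bound) linarith
    ultimately show ?thesis unfolding exp_add x_def by simp
  qed
  define S where "S = cbox (Complex (-1) (-(pi / 4 - \<delta>))) (Complex X (pi / 4 - \<delta>))"
  have in_S: "z \<in> S \<longleftrightarrow> Re z \<ge> -1 \<and> Re z \<le> X \<and> \<bar>Im z\<bar> \<le> pi / 4 - \<delta>" for z
    by (auto simp: S_def in_cbox_complex_iff abs_le_iff)
  have "S \<subseteq> strip" using assms unfolding strip_def by (auto simp: in_S)
  hence "continuous_on S ell"
    using holomorphic_on_imp_continuous_on[OF ell_holomorphic] continuous_on_subset by blast
  hence "bounded (ell ` S)"
    unfolding S_def by (intro compact_imp_bounded compact_continuous_image) auto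
  then obtain B where B: "B > 0" "\<And>z. z \<in> S \<Longrightarrow> norm (ell z) \<le> B" unfolding bounded_pos by auto
  define C where "C = max (8 * exp (A\<^sup>2 / (4 * pi * c))) (B * exp (A * X))"
  show ?thesis
  proof (intro exI[of _ C] conjI allI impI)
    show "C \<ge> 0" by (simp add: C_def le_max_iff_disj)
    fix z assume z: "Re z \<ge> -1" "\<bar>Im z\<bar> \<le> pi / 4 - \<delta>"
    show "norm (ell z) \<le> C * exp (- A * Re z)"
    proof (cases "Re z \<ge> X")
      case True
      show ?thesis
        by (rule order_trans[OF large[OF True z(2)]], rule mult_right_mono) (auto simp: C_def)
    next
      case False
      have "norm (ell z) \<le> B * 1" using z False by (simp add: B(2) in_S)
      also have "\<dots> \<le> B * exp (A * X + - A * Re z)"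
        using False assms(3) B(1) by (intro mult_left_mono) (auto simp: mult_left_mono)
      also have "\<dots> = B * exp (A * X) * exp (- A * Re z)" unfolding exp_add by simp
      also have "\<dots> \<le> C * exp (- A * Re z)" by (intro mult_right_mono) (auto simp: C_def)
      finally show ?thesis .
    qed
  qed
qed

text \<open>Cauchy's inequality on discs of radius r = delta/2: they stay in the substrip of margin
  r, and since r < 1, moving from the centre to the circle costs at most a factor e^A.\<close>

lemma ell_deriv_bound:
  assumes "\<delta> > 0" "\<delta> < pi / 4" "A \<ge> 0"
  shows "\<exists>C\<ge>0. \<forall>z. Re z \<ge> 0 \<longrightarrow> \<bar>Im z\<bar> \<le> pi / 4 - \<delta> \<longrightarrow> norm ((deriv ^^ n) ell z) \<le> C * exp (- A * Re z)"
proof -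
  define r where "r = \<delta> / 2"
  have r: "r > 0" "r < 1" using assms pi_less_4 by (auto simp: r_def)
  obtain C where C: "C \<ge> 0"
      "\<And>z. Re z \<ge> -1 \<Longrightarrow> \<bar>Im z\<bar> \<le> pi / 4 - r \<Longrightarrow> norm (ell z) \<le> C * exp (- A * Re z)"
    using ell_bound[of r A] assms r unfolding r_def by auto
  show ?thesis
  proof (intro exI[of _ "fact n * (C * exp A) / r ^ n"] conjI allI impI)
    show "fact n * (C * exp A) / r ^ n \<ge> 0" using C r by simp
    fix z assume z: "Re z \<ge> 0" "\<bar>Im z\<bar> \<le> pi / 4 - \<delta>"
    have near: "Re u \<ge> Re z - r" "\<bar>Im u\<bar> \<le> pi / 4 - r" if "norm (z - u) \<le> r" for u
      using abs_Re_le_cmod[of "z - u"] abs_Im_le_cmod[of "z - u"] that z unfolding r_def by auto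
    have sub: "cball z r \<subseteq> strip"
    proof
      fix u assume "u \<in> cball z r"
      hence "\<bar>Im u\<bar> \<le> pi / 4 - r" by (intro near) (simp add: dist_norm)
      thus "u \<in> strip" using r by (simp add: strip_def)
    qed
    have "norm ((deriv ^^ n) ell z) \<le> fact n * (C * exp A * exp (- A * Re z)) / r ^ n"
    proof (rule Cauchy_inequality)
      show "ell holomorphic_on ball z r"
        using ell_holomorphic sub ball_subset_cball holomorphic_on_subset by blast
      show "continuous_on (cball z r) ell"
        using holomorphic_on_imp_continuous_on[OF ell_holomorphic] sub continuous_on_subset by blast
      fix u assume u: "norm (z - u) = r"
      have "norm (ell u) \<le> C * exp (- A * Re u)" using near[of u] u z r by (intro C) auto
      also have "\<dots> \<le> C * exp (A + - A * Re z)"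
      proof -
        have "A * (Re z - 1) \<le> A * Re u" using near(1)[of u] u r assms(3) by (intro mult_left_mono) auto
        thus ?thesis using C(1) by (intro mult_left_mono) (auto simp: algebra_simps)
      qed
      also have "\<dots> = C * exp A * exp (- A * Re z)" unfolding exp_add by simp
      finally show "norm (ell u) \<le> C * exp A * exp (- A * Re z)" .
    qed (use r in auto)
    thus "norm ((deriv ^^ n) ell z) \<le> fact n * (C * exp A) / r ^ n * exp (- A * Re z)" by simp
  qed
qed

text \<open>Each term of the bracket in \<open>gamma_eq\<close> contains a derivative of
  \<open>ell\<close>, which supplies the decay, while \<open>exp (w * ell z)\<close> stays bounded.
  As E <= 1, the squared derivative is still bounded by a multiple of E.\<close>

lemma gamma_bound_right:
  assumes "\<delta> > 0" "\<delta> < pi / 4" "A \<ge> 0" "R \<ge> 0"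
  shows "\<exists>C\<ge>0. \<forall>(w::complex) z. norm w \<le> R \<longrightarrow> Re z \<ge> 0 \<longrightarrow> \<bar>Im z\<bar> \<le> pi / 4 - \<delta> \<longrightarrow>
           norm (gamma w z) \<le> C * exp (- A * Re z)"
proof -
  obtain C0 where C0: "C0 \<ge> 0"
     "\<And>z. Re z \<ge> 0 \<Longrightarrow> \<bar>Im z\<bar> \<le> pi / 4 - \<delta> \<Longrightarrow> norm (ell z) \<le> C0 * exp (- A * Re z)"
    using ell_deriv_bound[OF assms(1-3), of 0] by auto
  obtain C1 where C1: "C1 \<ge> 0"
     "\<And>z. Re z \<ge> 0 \<Longrightarrow> \<bar>Im z\<bar> \<le> pi / 4 - \<delta> \<Longrightarrow> norm (deriv ell z) \<le> C1 * exp (- A * Re z)"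
    using ell_deriv_bound[OF assms(1-3), of 1] by auto
  obtain C2 where C2: "C2 \<ge> 0"
     "\<And>z. Re z \<ge> 0 \<Longrightarrow> \<bar>Im z\<bar> \<le> pi / 4 - \<delta> \<Longrightarrow> norm (deriv (deriv ell) z) \<le> C2 * exp (- A * Re z)"
    using ell_deriv_bound[OF assms(1-3), of 2] by (auto simp: numeral_2_eq_2)
  let ?C = "(C2 + R * C1\<^sup>2 + R * C1) * exp (R * C0)"
  show ?thesis
  proof (intro exI[of _ ?C] conjI allI impI)
    show "?C \<ge> 0" using C1 C2 assms by simp
    fix w z :: complex assume *: "norm w \<le> R" "Re z \<ge> 0" "\<bar>Im z\<bar> \<le> pi / 4 - \<delta>"
    define E where "E = exp (- A * Re z)"
    have E: "0 < E" "E \<le> 1" using * assms by (auto simp: E_def)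
    have "norm (ell z) \<le> C0 * 1"
      using C0(2)[OF *(2,3)] mult_left_mono[OF E(2) C0(1)] unfolding E_def by linarith
    hence "norm (w * ell z) \<le> R * C0" unfolding norm_mult using * C0(1) assms by (intro mult_mono) auto
    hence e: "norm (exp (w * ell z)) \<le> exp (R * C0)"
      using complex_Re_le_cmod[of "w * ell z"] by (auto intro: order_trans)
    have d1: "norm (deriv ell z) \<le> C1 * E" and d2: "norm (deriv (deriv ell) z) \<le> C2 * E"
      using C1(2)[OF *(2,3)] C2(2)[OF *(2,3)] by (auto simp: E_def)
    have "(norm (deriv ell z))\<^sup>2 \<le> (C1 * E)\<^sup>2" by (intro power_mono d1) auto
    also have "\<dots> = C1\<^sup>2 * (E * E)" by (simp add: power2_eq_square)
    also have "\<dots> \<le> C1\<^sup>2 * (E * 1)" using E by (intro mult_left_mono) auto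
    finally have d1s: "(norm (deriv ell z))\<^sup>2 \<le> C1\<^sup>2 * E" by simp
    have "norm (deriv (deriv ell) z + w * (deriv ell z)\<^sup>2 + w * deriv ell z) \<le>
        norm (deriv (deriv ell) z) + norm w * (norm (deriv ell z))\<^sup>2 + norm w * norm (deriv ell z)"
      by (intro norm_add_rule_thm) (auto simp: norm_mult norm_power)
    also have "\<dots> \<le> C2 * E + R * (C1\<^sup>2 * E) + R * (C1 * E)"
      using * d1 d2 d1s assms by (intro add_mono mult_mono) auto
    finally have "norm (deriv (deriv ell) z + w * (deriv ell z)\<^sup>2 + w * deriv ell z) \<le> (C2 + R * C1\<^sup>2 + R * C1) * E"
      by (simp add: algebra_simps)
    hence "norm (deriv (deriv ell) z + w * (deriv ell z)\<^sup>2 + w * deriv ell z) * norm (exp (w * ell z)) \<le>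
       (C2 + R * C1\<^sup>2 + R * C1) * E * exp (R * C0)"
      using e C1 C2 assms E by (intro mult_mono) auto
    moreover have "z \<in> strip" using * assms by (simp add: strip_def)
    ultimately show "norm (gamma w z) \<le> ?C * exp (- A * Re z)"
      unfolding E_def[symmetric] by (simp only: gamma_eq norm_mult mult_ac)
  qed
qed

text \<open>The symmetry carries the estimate to the left end at the cost of a factor |e^{wz}|, at
  most e^{R(|x|+1)}. Asking for the rate A + R on the right pays for it.\<close>

lemma gamma_bound:
  assumes "\<delta> > 0" "\<delta> < pi / 4" "A \<ge> 0" "R \<ge> 0"
  obtains C where "C \<ge> 0"
    "\<And>(w::complex) z. norm w \<le> R \<Longrightarrow> \<bar>Im z\<bar> \<le> pi / 4 - \<delta> \<Longrightarrow> norm (gamma w z) \<le> C * exp (- A * \<bar>Re z\<bar>)"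
proof -
  obtain C where C: "C \<ge> 0" "\<And>(w::complex) z. norm w \<le> R \<Longrightarrow> Re z \<ge> 0 \<Longrightarrow> \<bar>Im z\<bar> \<le> pi / 4 - \<delta> \<Longrightarrow>
           norm (gamma w z) \<le> C * exp (- (A + R) * Re z)"
    using gamma_bound_right[OF assms(1,2) _ assms(4), of "A + R"] assms by auto
  show ?thesis
  proof (rule that[of "C * exp R"])
    show "C * exp R \<ge> 0" using C by simp
    fix w z :: complex assume *: "norm w \<le> R" "\<bar>Im z\<bar> \<le> pi / 4 - \<delta>"
    show "norm (gamma w z) \<le> C * exp R * exp (- A * \<bar>Re z\<bar>)"
    proof (cases "Re z \<ge> 0")
      case True
      have "norm (gamma w z) \<le> C * exp (- (A + R) * Re z)" using C(2) * True by blast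
      also have "\<dots> \<le> C * exp (R + - A * \<bar>Re z\<bar>)"
      proof -
        have "- (A + R) * Re z = - A * \<bar>Re z\<bar> - R * Re z" using True by (simp add: algebra_simps)
        hence "- (A + R) * Re z \<le> R + - A * \<bar>Re z\<bar>"
          using mult_nonneg_nonneg[OF assms(4) True] assms(4) by linarith
        thus ?thesis using C(1) by (intro mult_left_mono) simp_all
      qed
      finally show ?thesis unfolding exp_add by simp
    next
      case False
      have z: "- z \<in> strip" using * assms by (simp add: strip_def)
      have 1: "norm (exp (w * (- z))) \<le> exp (R * (\<bar>Re z\<bar> + 1))"
      proof -
        have "norm z \<le> \<bar>Re z\<bar> + \<bar>Im z\<bar>" by (rule cmod_le)
        also have "\<bar>Im z\<bar> \<le> 1" using * assms pi_less_4 by linarith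
        finally have "norm (w * (- z)) \<le> R * (\<bar>Re z\<bar> + 1)"
          unfolding norm_mult using * assms by (intro mult_mono) auto
        thus ?thesis using complex_Re_le_cmod[of "w * (- z)"] by (auto intro: order_trans)
      qed
      have 2: "norm (gamma w (- z)) \<le> C * exp (- (A + R) * \<bar>Re z\<bar>)"
        using C(2)[of w "- z"] * False by simp
      have "norm (gamma w z) = norm (exp (w * (- z))) * norm (gamma w (- z))"
        using gamma_minus[OF z, of w] by (simp add: norm_mult)
      also have "\<dots> \<le> exp (R * (\<bar>Re z\<bar> + 1)) * (C * exp (- (A + R) * \<bar>Re z\<bar>))"
        by (intro mult_mono 1 2) auto
      also have "\<dots> = C * exp (R * (\<bar>Re z\<bar> + 1) + (- (A + R) * \<bar>Re z\<bar>))"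
        unfolding exp_add by simp
      also have "R * (\<bar>Re z\<bar> + 1) + (- (A + R) * \<bar>Re z\<bar>) = R + - A * \<bar>Re z\<bar>"
        by (simp add: algebra_simps)
      finally show ?thesis unfolding exp_add by simp
    qed
  qed
qed

section \<open>Parameter integrals and the entire function\<close>

lemma integrable_exp_abs:
  assumes "a > 0"
  shows "integrable lborel (\<lambda>x::real. exp (- a * \<bar>x\<bar>))"
proof -
  let ?f = "\<lambda>x::real. indicator {0..} x *\<^sub>R exp (- a * x)"
  have "set_integrable lebesgue {0..} (\<lambda>x. exp (- a * x))"
    using assms by (intro nonnegative_absolutely_integrable_1 integrable_on_exp_minus_to_infinity) auto
  hence "integrable lebesgue ?f" by (simp add: set_integrable_def)
  moreover have "?f \<in> borel_measurable lborel" by measurable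
  ultimately have f: "integrable lborel ?f" using integrable_completion by blast
  hence "integrable lborel (\<lambda>x. ?f (0 + (- 1) * x))" by (intro lborel_integrable_real_affine) auto
  hence "integrable lborel (\<lambda>x. ?f x + ?f (0 + (- 1) * x))" using f by (intro Bochner_Integration.integrable_add)
  thus ?thesis
    by (rule Bochner_Integration.integrable_bound) (auto simp: indicator_def abs_if split: if_splits)
qed

lemma integrable_exp_bound:
  fixes f :: "real \<Rightarrow> complex"
  assumes "continuous_on UNIV f" "a > 0" "\<And>x. norm (f x) \<le> C * exp (- a * \<bar>x\<bar>)"
  shows "integrable lborel f"
proof (rule Bochner_Integration.integrable_bound)
  show "integrable lborel (\<lambda>x. C * exp (- a * \<bar>x\<bar>))"
    using integrable_exp_abs[OF assms(2)] by (rule integrable_mult_right)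
  show "f \<in> borel_measurable lborel" using assms(1) borel_measurable_continuous_onI by simp
  show "AE x in lborel. norm (f x) \<le> norm (C * exp (- a * \<bar>x\<bar>))"
    using assms(3) by (intro AE_I2) (metis abs_ge_self order_trans real_norm_def)
qed

lemma exp_abs_tendsto_0:
  assumes "a > 0"
  shows "(\<lambda>N. C * exp (- a * (real N + 1/2))) \<longlonglongrightarrow> 0"
  using assms by real_asymp

text \<open>The fundamental theorem on growing intervals, with boundary terms that tend to 0. It
  serves both the shift of the contour and the integration by parts.\<close>

lemma integral_derivative_eq_0:
  fixes K k :: "real \<Rightarrow> complex"
  assumes deriv: "\<And>x. (K has_vector_derivative k x) (at x)" and int: "integrable lborel k"
    and "a > 0" and le: "\<And>x. norm (K x) \<le> C * exp (- a * \<bar>x\<bar>)"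
  shows "(LINT x|lborel. k x) = 0"
proof -
  have "integral {-(real N + 1/2)..real N + 1/2} k = K (real N + 1/2) - K (-(real N + 1/2))" for N
    by (intro integral_unique fundamental_theorem_of_calculus) (auto intro: has_vector_derivative_at_within deriv)
  hence lim: "(\<lambda>N. K (real N + 1/2) - K (-(real N + 1/2))) \<longlonglongrightarrow> (LINT x|lborel. k x)"
    using integral_Icc_tendsto_lborel[OF int] by simp
  have abs: "\<bar>real N + 1/2\<bar> = real N + 1/2" "\<bar>-(real N + 1/2)\<bar> = real N + 1/2" for N by auto
  have "(\<lambda>N. K (real N + 1/2) - K (-(real N + 1/2))) \<longlonglongrightarrow> 0 - 0"
    by (intro tendsto_diff Lim_null_comparison[OF _ exp_abs_tendsto_0[OF assms(3), of C]] always_eventually allI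
          le[of "real _ + 1/2", unfolded abs] le[of "-(real _ + 1/2)", unfolded abs])
  thus ?thesis using LIMSEQ_unique[OF lim] by simp
qed

text \<open>A convergent sequence of parameters is bounded, so one dominating function per ball
  suffices.\<close>

lemma continuous_integral_param:
  fixes G :: "'a :: real_normed_vector \<Rightarrow> real \<Rightarrow> complex"
  assumes cont: "\<And>x. continuous_on UNIV (\<lambda>p. G p x)"
    and meas: "\<And>p. G p \<in> borel_measurable lborel"
    and dom: "\<And>R. \<exists>g. integrable lborel g \<and> (\<forall>p x. norm p \<le> R \<longrightarrow> norm (G p x) \<le> g x)"
  shows "continuous (at p) (\<lambda>p. LINT x|lborel. G p x)"
proof (rule continuous_at_sequentiallyI)
  fix u assume u: "u \<longlonglongrightarrow> p"
  hence "Bseq u" by (intro convergent_imp_Bseq convergentI)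
  then obtain R where R: "\<And>n. norm (u n) \<le> R" by (auto simp: Bseq_def)
  obtain g where g: "integrable lborel g" "\<And>p x. norm p \<le> R \<Longrightarrow> norm (G p x) \<le> g x" using dom by blast
  show "(\<lambda>n. LINT x|lborel. G (u n) x) \<longlonglongrightarrow> (LINT x|lborel. G p x)"
  proof (rule integral_dominated_convergence[where w = g])
    show "AE x in lborel. (\<lambda>n. G (u n) x) \<longlonglongrightarrow> G p x"
      by (intro AE_I2 continuous_on_tendsto_compose[OF cont u]) auto
  qed (use meas g R in auto)
qed

text \<open>Cauchy's inequality on unit discs turns the bound for G on the ball of radius R + 1 into
  the same bound for G' on the ball of radius R. By the mean value inequality it then dominates the
  difference quotients.\<close>

lemma has_field_derivative_integral_param:
  fixes G G' :: "complex \<Rightarrow> real \<Rightarrow> complex"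
  assumes deriv: "\<And>p x. ((\<lambda>p. G p x) has_field_derivative G' p x) (at p)"
    and meas: "\<And>p. G p \<in> borel_measurable lborel" "\<And>p. G' p \<in> borel_measurable lborel"
    and dom: "\<And>R. \<exists>g. integrable lborel g \<and> (\<forall>p x. norm p \<le> R \<longrightarrow> norm (G p x) \<le> g x)"
  shows "((\<lambda>p. LINT x|lborel. G p x) has_field_derivative (LINT x|lborel. G' p x)) (at p)"
  unfolding has_field_derivative_iff tendsto_at_iff_sequentially
proof (intro allI impI)
  fix u assume u: "\<forall>n. u n \<in> UNIV - {p}" "u \<longlonglongrightarrow> p"
  hence "Bseq u" by (intro convergent_imp_Bseq convergentI)
  then obtain K where K: "K > 0" "\<And>n. norm (u n) \<le> K" by (auto simp: Bseq_def)
  define R where "R = max K (norm p)"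
  obtain g where g: "integrable lborel g" "\<And>p x. norm p \<le> R + 1 \<Longrightarrow> norm (G p x) \<le> g x" using dom by blast
  have int: "integrable lborel (G q)" if "norm q \<le> R" for q
    by (rule Bochner_Integration.integrable_bound[OF g(1) meas(1)])
       (use g(2)[of q] that in \<open>auto intro!: AE_I2 intro: order_trans[OF _ abs_ge_self]\<close>)
  have hol: "(\<lambda>p. G p x) holomorphic_on S" for S x
    unfolding holomorphic_on_def field_differentiable_def using deriv has_field_derivative_at_within by blast
  have G'_le: "norm (G' q x) \<le> g x" if q: "norm q \<le> R" for q x
  proof -
    have "norm ((deriv ^^ 1) (\<lambda>p. G p x) q) \<le> fact 1 * g x / 1 ^ 1"
    proof (rule Cauchy_inequality)
      show "continuous_on (cball q 1) (\<lambda>p. G p x)" by (rule holomorphic_on_imp_continuous_on[OF hol])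
      fix v assume "norm (q - v) = 1"
      hence "norm v \<le> R + 1" using q norm_triangle_ineq4[of q "q - v"] by simp
      thus "norm (G v x) \<le> g x" by (rule g(2))
    qed (auto intro: hol)
    thus ?thesis using DERIV_imp_deriv[OF deriv] by simp
  qed
  let ?Q = "\<lambda>n x. (G (u n) x - G p x) / (u n - p)"
  have lim: "(\<lambda>n. LINT x|lborel. ?Q n x) \<longlonglongrightarrow> (LINT x|lborel. G' p x)"
  proof (rule integral_dominated_convergence[where w = g])
    show "AE x in lborel. (\<lambda>n. ?Q n x) \<longlonglongrightarrow> G' p x"
      using deriv u unfolding has_field_derivative_iff tendsto_at_iff_sequentially o_def by (intro AE_I2) blast
    show "AE x in lborel. norm (?Q n x) \<le> g x" for n
    proof (intro AE_I2)
      fix x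
      have "norm (G (u n) x - G p x) \<le> g x * norm (u n - p)"
      proof (rule field_differentiable_bound[where S = "cball 0 R"])
        show "((\<lambda>p. G p x) has_field_derivative G' z x) (at z within cball 0 R)" for z
          by (rule has_field_derivative_at_within[OF deriv])
        show "norm (G' z x) \<le> g x" if "z \<in> cball 0 R" for z using that by (intro G'_le) simp
      qed (use K in \<open>auto simp: R_def le_max_iff_disj\<close>)
      thus "norm (?Q n x) \<le> g x" using u(1) by (simp add: norm_divide divide_le_eq)
    qed
  qed (use meas g in auto)
  have eq: "(LINT x|lborel. ?Q n x) = ((LINT x|lborel. G (u n) x) - (LINT x|lborel. G p x)) / (u n - p)" for n
    using int[of "u n"] int[of p] K by (simp add: R_def le_max_iff_disj)
  show "((\<lambda>y. ((LINT x|lborel. G y x) - (LINT x|lborel. G p x)) / (y - p)) \<circ> u) \<longlonglongrightarrow> (LINT x|lborel. G' p x)"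
    using lim unfolding o_def eq .
qed

text \<open>On the strip |Im z| <= 1, so |e^{zs}| <= e^{R(|x|+1)}; the rate A + R for gamma absorbs
  this growth.\<close>

lemma gamma_exp_bound:
  assumes "\<delta> > 0" "\<delta> < pi / 4" "A \<ge> 0" "R \<ge> 0"
  obtains C where "C \<ge> 0"
    "\<And>(w::complex) s z. norm w \<le> R \<Longrightarrow> norm s \<le> R \<Longrightarrow> \<bar>Im z\<bar> \<le> pi / 4 - \<delta> \<Longrightarrow>
        norm (gamma w z * exp (z * s)) \<le> C * exp (- A * \<bar>Re z\<bar>)"
proof -
  obtain C where C: "C \<ge> 0" "\<And>w z. norm w \<le> R \<Longrightarrow> \<bar>Im z\<bar> \<le> pi / 4 - \<delta> \<Longrightarrow>
           norm (gamma w z) \<le> C * exp (- (A + R) * \<bar>Re z\<bar>)"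
    using gamma_bound[OF assms(1,2) _ assms(4), of "A + R"] assms by auto
  show ?thesis
  proof (rule that[of "C * exp R"])
    show "C * exp R \<ge> 0" using C by simp
    fix w s z :: complex assume *: "norm w \<le> R" "norm s \<le> R" "\<bar>Im z\<bar> \<le> pi / 4 - \<delta>"
    have "norm z \<le> \<bar>Re z\<bar> + \<bar>Im z\<bar>" by (rule cmod_le)
    also have "\<bar>Im z\<bar> \<le> 1" using * assms pi_less_4 by linarith
    finally have "norm (z * s) \<le> (\<bar>Re z\<bar> + 1) * R"
      unfolding norm_mult using * assms by (intro mult_mono) auto
    hence 1: "norm (exp (z * s)) \<le> exp ((\<bar>Re z\<bar> + 1) * R)"
      using complex_Re_le_cmod[of "z * s"] by (auto intro: order_trans)
    have "norm (gamma w z * exp (z * s)) \<le> (C * exp (- (A + R) * \<bar>Re z\<bar>)) * exp ((\<bar>Re z\<bar> + 1) * R)"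
      unfolding norm_mult using C by (intro mult_mono 1 C(2) *) auto
    also have "\<dots> = C * exp (- (A + R) * \<bar>Re z\<bar> + (\<bar>Re z\<bar> + 1) * R)"
      unfolding exp_add by simp
    also have "- (A + R) * \<bar>Re z\<bar> + (\<bar>Re z\<bar> + 1) * R = R + - A * \<bar>Re z\<bar>"
      by (simp add: algebra_simps)
    finally show "norm (gamma w z * exp (z * s)) \<le> C * exp R * exp (- A * \<bar>Re z\<bar>)"
      unfolding exp_add by simp
  qed
qed

lemma Complex_holomorphic_continuous:
  assumes "f holomorphic_on strip" "- pi / 4 < y" "y < pi / 4"
  shows "continuous_on UNIV (\<lambda>x. f (Complex x y))"
proof (rule continuous_on_compose2[OF holomorphic_on_imp_continuous_on[OF assms(1)]])
  show "continuous_on UNIV (\<lambda>x. Complex x y)"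
    unfolding Complex_eq by (intro continuous_intros)
qed (use assms Complex_in_strip in auto)

lemma gamma_exp_holomorphic: "(\<lambda>z. gamma w z * exp (z * s)) holomorphic_on strip"
  by (intro holomorphic_intros gamma_holomorphic)

lemma strip_margin:
  assumes "- pi / 4 < y" "y < pi / 4"
  obtains \<delta> where "\<delta> > 0" "\<delta> < pi / 4" "\<bar>y\<bar> \<le> pi / 4 - \<delta>"
proof -
  define m where "m = \<bar>y\<bar>"
  have m: "m < pi / 4" "0 \<le> m" using assms unfolding m_def by linarith+
  have "0 < (pi / 4 - m) / 2" "(pi / 4 - m) / 2 < pi / 4" "m \<le> pi / 4 - (pi / 4 - m) / 2"
    using m pi_gt_zero by (simp_all add: field_simps)
  thus ?thesis using that unfolding m_def by blast
qed

lemma gamma_exp_integrable: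
  assumes "- pi / 4 < y" "y < pi / 4"
  shows "integrable lborel (\<lambda>x. gamma w (Complex x y) * exp (Complex x y * s))"
proof -
  obtain \<delta> where d: "\<delta> > 0" "\<delta> < pi / 4" "\<bar>y\<bar> \<le> pi / 4 - \<delta>"
    using strip_margin[OF assms] by blast
  obtain C where C: "C \<ge> 0" "\<And>v u z. norm v \<le> max (norm w) (norm s) \<Longrightarrow> norm u \<le> max (norm w) (norm s) \<Longrightarrow>
      \<bar>Im z\<bar> \<le> pi / 4 - \<delta> \<Longrightarrow> norm (gamma v z * exp (z * u)) \<le> C * exp (- 1 * \<bar>Re z\<bar>)"
    using gamma_exp_bound[OF d(1,2), of 1 "max (norm w) (norm s)"] by (auto simp: le_max_iff_disj)
  show ?thesis
  proof (rule integrable_exp_bound)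
    show "continuous_on UNIV (\<lambda>x. gamma w (Complex x y) * exp (Complex x y * s))"
      by (rule Complex_holomorphic_continuous[OF gamma_exp_holomorphic assms])
    show "norm (gamma w (Complex x y) * exp (Complex x y * s)) \<le> C * exp (- 1 * \<bar>x\<bar>)" for x
      using C(2)[of w s "Complex x y"] d by simp
  qed simp
qed

lemma Complex_has_vector_derivative: "((\<lambda>x. Complex x y) has_vector_derivative 1) (at x)"
  unfolding Complex_eq by (auto intro!: derivative_eq_intros)

lemma holomorphic_has_vector_derivative:
  assumes "(f has_field_derivative f') (at (Complex x y))"
  shows "((\<lambda>x. f (Complex x y)) has_vector_derivative f') (at x)"
  using field_vector_diff_chain_at[OF Complex_has_vector_derivative assms] by (simp add: o_def)

text \<open>Cauchy's theorem by way of a primitive P on the convex strip: P(x+iy) - P(x) has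
  derivative f(x+iy) - f(x), and it decays because it is at most |y| times the maximum of |f| on the
  vertical segment.\<close>

lemma gamma_integral_shift:
  assumes "- pi / 4 < y" "y < pi / 4"
  shows "(LINT x|lborel. gamma w (Complex x y) * exp (Complex x y * s)) =
         (LINT x|lborel. gamma w (of_real x) * exp (of_real x * s))"
proof -
  define f where "f = (\<lambda>z. gamma w z * exp (z * s))"
  obtain \<delta> where d: "\<delta> > 0" "\<delta> < pi / 4" "\<bar>y\<bar> \<le> pi / 4 - \<delta>"
    using strip_margin[OF assms] by blast
  obtain C where C: "C \<ge> 0" "\<And>v u z. norm v \<le> max (norm w) (norm s) \<Longrightarrow> norm u \<le> max (norm w) (norm s) \<Longrightarrow>
      \<bar>Im z\<bar> \<le> pi / 4 - \<delta> \<Longrightarrow> norm (gamma v z * exp (z * u)) \<le> C * exp (- 1 * \<bar>Re z\<bar>)"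
    using gamma_exp_bound[OF d(1,2), of 1 "max (norm w) (norm s)"] by (auto simp: le_max_iff_disj)
  have f_le: "norm (f z) \<le> C * exp (- 1 * \<bar>Re z\<bar>)" if "\<bar>Im z\<bar> \<le> \<bar>y\<bar>" for z
    unfolding f_def using C(2)[of w s z] d that by simp
  obtain P where P: "\<And>z. z \<in> strip \<Longrightarrow> (P has_field_derivative f z) (at z)"
    using holomorphic_convex_primitive'[OF convex_strip open_strip, of f] gamma_exp_holomorphic
      at_within_open[OF _ open_strip] unfolding f_def by metis
  have in_strip: "Complex x y \<in> strip" "Complex x 0 \<in> strip" for x using assms by (auto simp: strip_def)
  have z0: "- pi / 4 < 0" "0 < pi / 4" by auto
  have int: "integrable lborel (\<lambda>x. f (Complex x y))" "integrable lborel (\<lambda>x. f (Complex x 0))"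
    unfolding f_def by (intro gamma_exp_integrable assms z0)+
  have "(LINT x|lborel. f (Complex x y) - f (Complex x 0)) = 0"
  proof (rule integral_derivative_eq_0)
    show "((\<lambda>x. P (Complex x y) - P (Complex x 0)) has_vector_derivative f (Complex x y) - f (Complex x 0)) (at x)" for x
      by (intro has_vector_derivative_diff holomorphic_has_vector_derivative P in_strip)
    show "integrable lborel (\<lambda>x. f (Complex x y) - f (Complex x 0))"
      by (intro Bochner_Integration.integrable_diff int)
    show "norm (P (Complex x y) - P (Complex x 0)) \<le> (C * \<bar>y\<bar>) * exp (- 1 * \<bar>x\<bar>)" for x
    proof -
      let ?S = "closed_segment (Complex x 0) (Complex x y)"
      have S: "Re z = x" "\<bar>Im z\<bar> \<le> \<bar>y\<bar>" if "z \<in> ?S" for z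
      proof -
        obtain u where u: "0 \<le> u" "u \<le> 1" "z = (1 - u) *\<^sub>R Complex x 0 + u *\<^sub>R Complex x y"
          using \<open>z \<in> ?S\<close> unfolding in_segment by blast
        have "Re z = x" "Im z = u * y" unfolding u(3) by (simp_all add: left_diff_distrib)
        thus "Re z = x" "\<bar>Im z\<bar> \<le> \<bar>y\<bar>" using u by (auto simp: abs_mult intro: mult_left_le_one_le)
      qed
      have "norm (P (Complex x y) - P (Complex x 0)) \<le> (C * exp (- 1 * \<bar>x\<bar>)) * norm (Complex x y - Complex x 0)"
      proof (rule field_differentiable_bound[where S = ?S])
        show "(P has_field_derivative f z) (at z within ?S)" if "z \<in> ?S" for z
          using S[OF that] assms by (intro has_field_derivative_at_within[OF P]) (auto simp: strip_def)
        show "norm (f z) \<le> C * exp (- 1 * \<bar>x\<bar>)" if "z \<in> ?S" for z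
          using f_le[of z] S[OF that] by simp
      qed auto
      also have "norm (Complex x y - Complex x 0) = \<bar>y\<bar>" by (simp add: cmod_def)
      finally show ?thesis by (simp add: mult_ac)
    qed
  qed simp
  hence "(LINT x|lborel. f (Complex x y)) = (LINT x|lborel. f (Complex x 0))"
    by (simp add: Bochner_Integration.integral_diff[OF int])
  thus ?thesis unfolding f_def by (simp add: complex_of_real_def)
qed

section \<open>The integral as an entire function of (w, s)\<close>

definition xi_integral :: "complex \<Rightarrow> complex \<Rightarrow> complex" where
  "xi_integral w s = 1 / 2 * (LINT x|lborel. gamma w (of_real x) * exp (of_real x * s))"

lemma gamma_real_continuous: "continuous_on UNIV (\<lambda>x. gamma w (of_real x))"
  by (rule continuous_on_compose2[OF holomorphic_on_imp_continuous_on[OF gamma_holomorphic]])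
     (auto intro: continuous_intros)

text \<open>One function dominates the integrand and its s-derivative on bounded parameter sets:
  starting from rate 2, the factor |x| <= e^{|x|} uses up 1, and rate 1 is left for
  integrability.\<close>

lemma gamma_exp_dominated:
  "\<exists>g. integrable lborel g \<and> (\<forall>w s x. norm w \<le> R \<longrightarrow> norm s \<le> R \<longrightarrow>
      norm (gamma w (of_real x) * exp (of_real x * s)) \<le> g x \<and>
      norm (of_real x * (gamma w (of_real x) * exp (of_real x * s))) \<le> g x)"
proof -
  obtain C where C: "C \<ge> 0" "\<And>v u z. norm v \<le> max R 0 \<Longrightarrow> norm u \<le> max R 0 \<Longrightarrow>
      \<bar>Im z\<bar> \<le> pi / 4 - pi / 8 \<Longrightarrow> norm (gamma v z * exp (z * u)) \<le> C * exp (- 2 * \<bar>Re z\<bar>)"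
    using gamma_exp_bound[of "pi / 8" 2 "max R 0"] by auto
  show ?thesis
  proof (intro exI[of _ "\<lambda>x. C * exp (- 1 * \<bar>x\<bar>)"] conjI allI impI)
    show "integrable lborel (\<lambda>x. C * exp (- 1 * \<bar>x\<bar>))"
      using integrable_exp_abs[of 1] by (intro integrable_mult_right) simp
    fix w s :: complex and x :: real assume *: "norm w \<le> R" "norm s \<le> R"
    have 1: "norm (gamma w (of_real x) * exp (of_real x * s)) \<le> C * exp (- 2 * \<bar>x\<bar>)"
      using C(2)[of w s "of_real x"] * by (simp add: le_max_iff_disj)
    have "C * exp (- 2 * \<bar>x\<bar>) \<le> C * exp (- 1 * \<bar>x\<bar>)" using C(1) by (intro mult_left_mono) auto
    thus "norm (gamma w (of_real x) * exp (of_real x * s)) \<le> C * exp (- 1 * \<bar>x\<bar>)" using 1 by linarith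
    have "\<bar>x\<bar> \<le> exp \<bar>x\<bar>" using exp_ge_add_one_self[of "\<bar>x\<bar>"] by linarith
    hence "\<bar>x\<bar> * norm (gamma w (of_real x) * exp (of_real x * s)) \<le> exp \<bar>x\<bar> * (C * exp (- 2 * \<bar>x\<bar>))"
      by (intro mult_mono 1) auto
    also have "\<dots> = C * exp (\<bar>x\<bar> + - 2 * \<bar>x\<bar>)" unfolding exp_add by simp
    finally show "norm (of_real x * (gamma w (of_real x) * exp (of_real x * s))) \<le> C * exp (- 1 * \<bar>x\<bar>)"
      unfolding norm_mult[of "of_real x"] by simp
  qed
qed

lemma gamma_exp_measurable:
  "(\<lambda>x. gamma w (of_real x) * exp (of_real x * s)) \<in> borel_measurable lborel"
  "(\<lambda>x. of_real x * (gamma w (of_real x) * exp (of_real x * s))) \<in> borel_measurable lborel"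
  by (simp_all, (intro borel_measurable_continuous_onI continuous_intros gamma_real_continuous)+)

text \<open>The partial derivative in s gets a name because its joint continuity in (w, s) is what
  upgrades partial to total differentiability.\<close>

definition xi_integral_ds :: "complex \<Rightarrow> complex \<Rightarrow> complex" where
  "xi_integral_ds w s = 1 / 2 * (LINT x|lborel. of_real x * (gamma w (of_real x) * exp (of_real x * s)))"

lemma xi_integral_has_deriv_s: "(xi_integral w has_field_derivative xi_integral_ds w s) (at s)"
  unfolding xi_integral_def xi_integral_ds_def
proof (rule DERIV_cmult, rule has_field_derivative_integral_param)
  show "((\<lambda>s. gamma w (of_real x) * exp (of_real x * s)) has_field_derivative
     of_real x * (gamma w (of_real x) * exp (of_real x * s))) (at s)" for x s
    by (auto intro!: derivative_eq_intros)
  show "\<exists>g. integrable lborel g \<and> (\<forall>s x. norm s \<le> R \<longrightarrow> norm (gamma w (of_real x) * exp (of_real x * s)) \<le> g x)" for R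
    using gamma_exp_dominated[of "max R (norm w)"] by (auto simp: le_max_iff_disj)
qed (rule gamma_exp_measurable)+

lemma xi_integral_has_deriv_w: "\<exists>a. ((\<lambda>w. xi_integral w s) has_field_derivative a) (at w)"
proof -
  \<comment> \<open>The w-derivative of the closed form of gamma. It is written out so that its
    measurability in x can be read off; no estimate of it is made.\<close>
  define G' where "G' = (\<lambda>w x. (let z = of_real x in
     ((deriv ell z)\<^sup>2 + deriv ell z + (deriv (deriv ell) z + w * (deriv ell z)\<^sup>2 + w * deriv ell z) * ell z) *
       exp (w * ell z) * exp (z * s)))"
  have "((\<lambda>w. 1 / 2 * (LINT x|lborel. gamma w (of_real x) * exp (of_real x * s))) has_field_derivative
      1 / 2 * (LINT x|lborel. G' w x)) (at w)"
  proof (rule DERIV_cmult, rule has_field_derivative_integral_param)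
    show "((\<lambda>w. gamma w (of_real x) * exp (of_real x * s)) has_field_derivative G' w x) (at w)" for w x
      unfolding G'_def Let_def gamma_eq[OF of_real_in_strip]
      by (auto intro!: derivative_eq_intros simp: algebra_simps)
    show "\<exists>g. integrable lborel g \<and> (\<forall>w x. norm w \<le> R \<longrightarrow> norm (gamma w (of_real x) * exp (of_real x * s)) \<le> g x)" for R
      using gamma_exp_dominated[of "max R (norm s)"] by (auto simp: le_max_iff_disj)
    have c: "continuous_on UNIV (\<lambda>x. f (complex_of_real x))" if "f holomorphic_on strip" for f
      by (rule continuous_on_compose2[OF holomorphic_on_imp_continuous_on[OF that]]) (auto intro: continuous_intros)
    have "continuous_on UNIV (G' w)" for w
      unfolding G'_def Let_def
      by (intro continuous_intros c ell_holomorphic holomorphic_deriv open_strip)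
    thus "G' w \<in> borel_measurable lborel" for w by (simp add: borel_measurable_continuous_onI)
  qed (rule gamma_exp_measurable)
  thus ?thesis unfolding xi_integral_def by blast
qed

lemma xi_integral_ds_continuous: "continuous (at p) (\<lambda>(w, s). xi_integral_ds w s)"
proof -
  have "continuous (at p) (\<lambda>p. LINT x|lborel. (case p of (w, s) \<Rightarrow> of_real x * (gamma w (of_real x) * exp (of_real x * s))))"
  proof (rule continuous_integral_param)
    show "continuous_on UNIV (\<lambda>p. case p of (w, s) \<Rightarrow> of_real x * (gamma w (of_real x) * exp (of_real x * s)))" for x
      unfolding case_prod_unfold gamma_eq[OF of_real_in_strip] by (intro continuous_intros)
    show "(\<lambda>x. case p of (w, s) \<Rightarrow> of_real x * (gamma w (of_real x) * exp (of_real x * s))) \<in> borel_measurable lborel" for p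
      by (cases p) (simp only: prod.case gamma_exp_measurable)
    show "\<exists>g. integrable lborel g \<and> (\<forall>p x. norm p \<le> R \<longrightarrow>
        norm (case p of (w, s) \<Rightarrow> of_real x * (gamma w (of_real x) * exp (of_real x * s))) \<le> g x)" for R
    proof -
      obtain g where g: "integrable lborel g" "\<And>w s x. norm w \<le> R \<Longrightarrow> norm s \<le> R \<Longrightarrow>
         norm (of_real x * (gamma w (of_real x) * exp (of_real x * s))) \<le> g x"
        using gamma_exp_dominated[of R] by blast
      have "norm (case p of (w, s) \<Rightarrow> of_real x * (gamma w (of_real x) * exp (of_real x * s))) \<le> g x"
        if "norm p \<le> R" for p x
      proof -
        have "norm (fst p) \<le> R" "norm (snd p) \<le> R"
          using that norm_fst_le[of "fst p" "snd p"] norm_snd_le[of "snd p" "fst p"] by auto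
        thus ?thesis unfolding case_prod_unfold by (rule g(2))
      qed
      thus ?thesis using g(1) by blast
    qed
  qed
  hence "continuous (at p) (\<lambda>p. 1 / 2 * (LINT x|lborel. (case p of (w, s) \<Rightarrow> of_real x * (gamma w (of_real x) * exp (of_real x * s)))))"
    by (intro continuous_intros)
  thus ?thesis unfolding xi_integral_ds_def by (simp add: case_prod_unfold)
qed

text \<open>A function is differentiable at a point if one partial derivative exists there and the
  other exists nearby and is continuous. The second role is played by the s-derivative.\<close>

lemma entire2_xi_integral: "entire2 xi_integral"
  unfolding entire2_def
proof (intro allI)
  fix w s
  obtain a where a: "((\<lambda>w. xi_integral w s) has_field_derivative a) (at w)" using xi_integral_has_deriv_w by blast
  have "((\<lambda>(w, s). xi_integral w s) has_derivative (\<lambda>(p, q). a * p + blinfun_apply (blinfun_mult_right (xi_integral_ds w s)) q))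
     (at (w, s) within UNIV \<times> UNIV)"
  proof (rule has_derivative_partialsI)
    show "((\<lambda>w. xi_integral w s) has_derivative (*) a) (at w within UNIV)"
      using a by (simp add: has_field_derivative_def)
    show "((\<lambda>s. xi_integral w s) has_derivative blinfun_apply (blinfun_mult_right (xi_integral_ds w s))) (at s within UNIV)" for w s
      using xi_integral_has_deriv_s[of w s] by (simp add: has_field_derivative_def)
    have "continuous (at (w, s)) (\<lambda>p. blinfun_mult_right ((\<lambda>(w, s). xi_integral_ds w s) p))"
      by (intro bounded_linear.continuous[OF bounded_linear_blinfun_mult_right] xi_integral_ds_continuous)
    thus "continuous (at (w, s) within UNIV \<times> UNIV) (\<lambda>(w, s). blinfun_mult_right (xi_integral_ds w s))"
      by (simp add: case_prod_unfold)
  qed auto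
  thus "\<exists>a b. ((\<lambda>(u, v). xi_integral u v) has_derivative (\<lambda>(p, q). a * p + b * q)) (at (w, s))"
    by auto
qed

section \<open>Identity theorem on C^2\<close>

lemma entire2_line_holomorphic:
  assumes "entire2 F"
  shows "(\<lambda>\<zeta>. F (a + \<zeta> * b) (c + \<zeta> * d)) holomorphic_on UNIV"
  unfolding holomorphic_on_def field_differentiable_def
proof
  fix \<zeta> :: complex
  obtain u v where uv: "((\<lambda>(w, s). F w s) has_derivative (\<lambda>(p, q). u * p + v * q)) (at (a + \<zeta> * b, c + \<zeta> * d))"
    using assms unfolding entire2_def by blast
  have "((\<lambda>\<zeta>. (a + \<zeta> * b, c + \<zeta> * d)) has_derivative (\<lambda>h. (h * b, h * d))) (at \<zeta>)"
    by (auto intro!: derivative_eq_intros)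
  from diff_chain_at[OF this uv] have "((\<lambda>\<zeta>. F (a + \<zeta> * b) (c + \<zeta> * d)) has_derivative (\<lambda>h. (u * b + v * d) * h)) (at \<zeta>)"
    by (simp add: o_def algebra_simps)
  thus "\<exists>f'. ((\<lambda>\<zeta>. F (a + \<zeta> * b) (c + \<zeta> * d)) has_field_derivative f') (at \<zeta> within UNIV)"
    unfolding has_field_derivative_def by auto
qed

text \<open>Join (w, s) by a complex line to (-2, -1), a point of the region of agreement.
  Parameters near 0 stay in that open region, so the one-variable identity theorem carries equality
  to the parameter 1, which is (w, s).\<close>

lemma entire2_unique:
  assumes "entire2 F" "entire2 G"
    and eq: "\<And>w s. Re w < Re s \<Longrightarrow> Re s < 0 \<Longrightarrow> F w s = G w s"
  shows "F = G"
proof (intro ext)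
  fix w s :: complex
  define D where "D = (\<lambda>\<zeta>. F (-2 + \<zeta> * (w + 2)) (-1 + \<zeta> * (s + 1)) - G (-2 + \<zeta> * (w + 2)) (-1 + \<zeta> * (s + 1)))"
  define U where "U = {\<zeta>. Re (-2 + \<zeta> * (w + 2)) < Re (-1 + \<zeta> * (s + 1)) \<and> Re (-1 + \<zeta> * (s + 1)) < 0}"
  have "open U" unfolding U_def by (intro open_Collect_conj open_Collect_less continuous_intros)
  moreover have "0 \<in> U" by (simp add: U_def)
  ultimately have "0 islimpt U" using interior_limit_point[of 0 U] by (simp add: interior_open)
  have "D 1 = 0"
  proof (rule analytic_continuation[where f = D and S = UNIV and U = U and \<xi> = 0])
    show "D holomorphic_on UNIV" unfolding D_def by (intro holomorphic_intros entire2_line_holomorphic assms)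
    show "\<And>z. z \<in> U \<Longrightarrow> D z = 0" unfolding D_def U_def by (simp add: eq)
  qed (use \<open>0 islimpt U\<close> in auto)
  thus "F w s = G w s" by (simp add: D_def)
qed

section \<open>The Mellin integral and the Schwartz bounds\<close>

text \<open>\<open>ell\<close> itself is bounded only to the right, since it behaves like -x on the
  left. Its derivative is bounded everywhere: reflection adds at most 1 in norm.\<close>

lemma ell_real_bound:
  obtains C where "C \<ge> 0" "\<And>x::real. x \<ge> 0 \<Longrightarrow> norm (ell (of_real x)) \<le> C"
    "\<And>x::real. norm (deriv ell (of_real x)) \<le> C"
proof -
  have d: "pi / 8 > (0::real)" "pi / 8 < pi / 4" by auto
  obtain C0 where C0: "C0 \<ge> 0"
     "\<And>z. Re z \<ge> 0 \<Longrightarrow> \<bar>Im z\<bar> \<le> pi / 4 - pi / 8 \<Longrightarrow> norm (ell z) \<le> C0 * exp (- 0 * Re z)"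
    using ell_deriv_bound[OF d, of 0 0] by auto
  obtain C1 where C1: "C1 \<ge> 0"
     "\<And>z. Re z \<ge> 0 \<Longrightarrow> \<bar>Im z\<bar> \<le> pi / 4 - pi / 8 \<Longrightarrow> norm (deriv ell z) \<le> C1 * exp (- 0 * Re z)"
    using ell_deriv_bound[OF d, of 0 1] by auto
  show ?thesis
  proof (rule that[of "max C0 (C1 + 1)"])
    show "norm (ell (of_real x)) \<le> max C0 (C1 + 1)" if "x \<ge> 0" for x :: real
      using C0(2)[of "of_real x"] that by (simp add: le_max_iff_disj)
    have right: "norm (deriv ell (of_real x)) \<le> C1" if "x \<ge> 0" for x :: real
      using C1(2)[of "of_real x"] that by simp
    show "norm (deriv ell (of_real x)) \<le> max C0 (C1 + 1)" for x :: real
    proof (cases "x \<ge> 0")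
      case True
      thus ?thesis using right[OF True] by (simp add: le_max_iff_disj)
    next
      case False
      have "deriv ell (of_real x) = - deriv ell (of_real (- x)) - 1"
        using deriv_ell_minus[OF of_real_in_strip, of "- x"] by simp
      also have "norm \<dots> \<le> norm (- deriv ell (of_real (- x))) + norm (1::complex)" by (rule norm_triangle_ineq4)
      also have "\<dots> \<le> C1 + 1" using right[of "- x"] False by simp
      finally show ?thesis by (simp add: le_max_iff_disj)
    qed
  qed (use C0 in \<open>simp add: le_max_iff_disj\<close>)
qed

text \<open>The two inequalities serve the two ends: Re s < 0 gives decay to the right, and
  reflection replaces s by w - s, whose real part is negative as well.\<close>

lemma theta_pow_exp_bound:
  assumes "Re w < Re s" "Re s < 0"
  obtains C a where "C \<ge> 0" "a > 0"
    "\<And>x::real. norm (exp (w * ell (of_real x) + of_real x * s)) \<le> C * exp (- a * \<bar>x\<bar>)"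
proof -
  obtain C where C: "C \<ge> 0" "\<And>x::real. x \<ge> 0 \<Longrightarrow> norm (ell (of_real x)) \<le> C"
    using ell_real_bound by metis
  define a where "a = min (- Re s) (Re s - Re w)"
  have a: "a > 0" "a \<le> - Re s" "a \<le> Re s - Re w" using assms by (auto simp: a_def)
  have main: "norm (exp (w * ell (of_real x) + of_real x * u)) \<le> exp (norm w * C) * exp (- a * x)"
    if "x \<ge> 0" "a \<le> - Re u" for x :: real and u
  proof -
    have "Re (w * ell (of_real x)) \<le> norm w * C"
      using complex_Re_le_cmod[of "w * ell (of_real x)"] mult_left_mono[OF C(2)[OF that(1)], of "norm w"]
      unfolding norm_mult by simp
    moreover have "Re (of_real x * u) \<le> - a * x"
      using mult_left_mono[OF that(2) that(1)] by (simp add: algebra_simps)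
    ultimately have "Re (w * ell (of_real x) + of_real x * u) \<le> norm w * C + - a * x"
      unfolding plus_complex.sel by linarith
    thus ?thesis unfolding norm_exp_eq_Re exp_add[symmetric] by simp
  qed
  have "norm (exp (w * ell (of_real x) + of_real x * s)) \<le> exp (norm w * C) * exp (- a * \<bar>x\<bar>)" for x :: real
  proof (cases "x \<ge> 0")
    case True
    thus ?thesis using main[OF True a(2)] by simp
  next
    case False
    have e: "ell (of_real x) = ell (of_real (- x)) + of_real (- x)"
      using ell_minus[OF of_real_in_strip, of "- x"] by simp
    have "w * ell (of_real x) + of_real x * s = w * ell (of_real (- x)) + of_real (- x) * (w - s)"
      unfolding e by (simp add: algebra_simps)
    thus ?thesis using main[of "- x" "w - s"] a(3) False by simp
  qed
  thus ?thesis using that[of "exp (norm w * C)" a] a(1) by simp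
qed

lemma ell_real_continuous:
  "continuous_on UNIV (\<lambda>x. ell (complex_of_real x))" "continuous_on UNIV (\<lambda>x. deriv ell (complex_of_real x))"
  by (rule continuous_on_compose2[OF holomorphic_on_imp_continuous_on[OF ell_holomorphic]]
           continuous_on_compose2[OF holomorphic_on_imp_continuous_on[OF holomorphic_deriv[OF ell_holomorphic open_strip]]];
      auto intro: continuous_intros)+

text \<open>Substitute t = e^{-x}. Then dt/t is dx up to orientation, and the exponents combine
  because s ell(-x) + (w - s) ell(x) = w ell(x) + sx.\<close>

lemma Z_Q_eq:
  assumes "Re w < Re s" "Re s < 0"
  shows "integrable lborel (\<lambda>x::real. exp (w * ell (of_real x) + of_real x * s))"
    and "Z_Q w s = (LINT x|lborel. exp (w * ell (of_real x) + of_real x * s))"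
proof -
  define H where "H = (\<lambda>x::real. exp (w * ell (of_real x) + of_real x * s))"
  have H_cont: "continuous_on UNIV H" unfolding H_def by (intro continuous_intros ell_real_continuous)
  obtain C a where Ca: "C \<ge> 0" "a > 0" "\<And>x. norm (H x) \<le> C * exp (- a * \<bar>x\<bar>)"
    using theta_pow_exp_bound[OF assms] unfolding H_def by metis
  have intH: "integrable lborel H" by (rule integrable_exp_bound[OF H_cont Ca(2,3)])
  thus "integrable lborel (\<lambda>x::real. exp (w * ell (of_real x) + of_real x * s))" unfolding H_def .
  define \<phi> where "\<phi> = (\<lambda>t::real. theta_pow (of_real (t\<^sup>2)) s * theta_pow (of_real (1 / t\<^sup>2)) (w - s) / of_real t)"
  have sub: "\<bar>- exp (- x)\<bar> *\<^sub>R \<phi> (exp (- x)) = H x" for x :: real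
  proof -
    have sq: "(exp (- x))\<^sup>2 = exp (2 * (- x))" by (rule exp_double[symmetric])
    have sq': "1 / (exp (- x))\<^sup>2 = exp (2 * x)" unfolding sq by (simp add: exp_minus field_simps)
    have e: "log_theta (of_real ((exp (- x))\<^sup>2)) = ell (of_real (- x))"
        "log_theta (of_real (1 / (exp (- x))\<^sup>2)) = ell (of_real x)"
      unfolding sq' unfolding sq ell_def by (simp_all flip: exp_of_real)
    have "\<bar>- exp (- x)\<bar> *\<^sub>R \<phi> (exp (- x)) =
        exp (s * ell (of_real (- x))) * exp ((w - s) * ell (of_real x))"
      unfolding \<phi>_def theta_pow_def e by (simp add: scaleR_conv_of_real)
    also have "\<dots> = exp (s * ell (of_real (- x)) + (w - s) * ell (of_real x))" by (simp add: exp_add)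
    also have "s * ell (of_real (- x)) + (w - s) * ell (of_real x) = w * ell (of_real x) + of_real x * s"
      using ell_minus[OF of_real_in_strip, of x] by (simp add: algebra_simps)
    finally show ?thesis by (simp add: H_def)
  qed
  have img: "(\<lambda>x::real. exp (- x)) ` UNIV = {0<..}"
  proof -
    have "t \<in> range (\<lambda>x::real. exp (- x))" if "t > 0" for t
      using that by (intro image_eqI[of _ _ "- ln t"]) auto
    thus ?thesis by auto
  qed
  have der: "((\<lambda>x::real. exp (- x)) has_field_derivative - exp (- x)) (at x within UNIV)" for x
    by (auto intro!: derivative_eq_intros)
  have "H absolutely_integrable_on UNIV"
    unfolding set_integrable_def using intH integrable_completion[of H lborel] by simp
  moreover have "integral UNIV H = (LINT x|lborel. H x)"
    using has_integral_integral_lborel[OF intH] by (rule integral_unique)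
  ultimately have "\<phi> absolutely_integrable_on (\<lambda>x::real. exp (- x)) ` UNIV \<and>
      integral ((\<lambda>x::real. exp (- x)) ` UNIV) \<phi> = (LINT x|lborel. H x)"
    using has_absolute_integral_change_of_variables_real[of UNIV "\<lambda>x::real. exp (- x)" "\<lambda>x. - exp (- x)"
        \<phi> "LINT x|lborel. H x", OF _ der] unfolding sub
    by (simp add: inj_def)
  hence \<phi>: "\<phi> absolutely_integrable_on {0<..}" "integral {0<..} \<phi> = (LINT x|lborel. H x)"
    unfolding img by auto
  \<comment> \<open>The change of variables yields integrability for the completed measure only;
    continuity supplies the Borel measurability needed to return to \<open>lborel\<close>.\<close>
  have "continuous_on {0<..} \<phi>"
  proof -
    have lc: "continuous_on {0<..} (\<lambda>t. log_theta (complex_of_real (f t)))"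
      if "continuous_on {0<..} f" "\<And>t. t > 0 \<Longrightarrow> f t > 0" for f :: "real \<Rightarrow> real"
      by (rule continuous_on_compose2[OF holomorphic_on_imp_continuous_on[OF log_theta_holomorphic]])
         (use that in \<open>auto intro: continuous_intros\<close>)
    have "continuous_on {0<..} (\<lambda>t::real. log_theta (of_real (t\<^sup>2)))"
         "continuous_on {0<..} (\<lambda>t::real. log_theta (of_real (1 / t\<^sup>2)))"
      by (rule lc; auto intro!: continuous_intros)+
    thus ?thesis unfolding \<phi>_def theta_pow_def by (intro continuous_intros) auto
  qed
  hence "(\<lambda>t. indicator {0<..} t *\<^sub>R \<phi> t) \<in> borel_measurable lborel"
    using borel_measurable_continuous_on_indicator[of "{0<..}" \<phi>] by simp
  hence "set_integrable lborel {0<..} \<phi>"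
    using \<phi>(1) integrable_completion unfolding set_integrable_def by blast
  hence "(LINT t:{0<..}|lborel. \<phi> t) = integral {0<..} \<phi>" by (rule set_borel_integral_eq_integral)
  thus "Z_Q w s = (LINT x|lborel. exp (w * ell (of_real x) + of_real x * s))"
    unfolding Z_Q_def \<phi>_def[symmetric] using \<phi>(2) unfolding H_def by simp
qed

text \<open>Integration by parts twice, in the form of a single total derivative: with \<open>H = exp (w \<ell> + x s)\<close>
  and \<open>k = w \<ell>' + w - s\<close> one has \<open>(k H)' = w \<gamma> exp (x s) - s (s - w) H\<close>.\<close>

lemma xi_integral_eq_Z_Q:
  assumes "Re w < Re s" "Re s < 0"
  shows "xi_integral w s = s * (s - w) / (2 * w) * Z_Q w s"
proof -
  define H where "H = (\<lambda>z. exp (w * ell z + z * s))"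
  define K where "K = (\<lambda>z. (w * deriv ell z + w - s) * H z)"
  obtain C a where Ca: "C \<ge> 0" "a > 0" "\<And>x::real. norm (H (of_real x)) \<le> C * exp (- a * \<bar>x\<bar>)"
    using theta_pow_exp_bound[OF assms] unfolding H_def by metis
  obtain B where B: "B \<ge> 0" "\<And>x::real. norm (deriv ell (of_real x)) \<le> B"
    using ell_real_bound by metis
  have H_int: "integrable lborel (\<lambda>x::real. H (of_real x))"
    and Z: "Z_Q w s = (LINT x|lborel. H (of_real x))"
    using Z_Q_eq[OF assms] unfolding H_def by auto
  have g_int: "integrable lborel (\<lambda>x::real. gamma w (of_real x) * exp (of_real x * s))"
    using gamma_exp_integrable[of 0 w s] by (simp add: complex_of_real_def)
  have "(LINT x|lborel. w * (gamma w (of_real x) * exp (of_real x * s)) - s * (s - w) * H (of_real x)) = 0"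
  proof (rule integral_derivative_eq_0)
    show "((\<lambda>x. K (of_real x)) has_vector_derivative
        (w * (gamma w (of_real x) * exp (of_real x * s)) - s * (s - w) * H (of_real x))) (at x)" for x :: real
    proof (rule has_vector_derivative_real_field)
      let ?z = "complex_of_real x"
      have "(K has_field_derivative (w * deriv (deriv ell) ?z) * H ?z + (w * deriv ell ?z + w - s) * ((w * deriv ell ?z + s) * H ?z)) (at ?z)"
        unfolding K_def H_def
        by (auto intro!: derivative_eq_intros ell_has_deriv deriv_ell_has_deriv simp: algebra_simps)
      also have "(w * deriv (deriv ell) ?z) * H ?z + (w * deriv ell ?z + w - s) * ((w * deriv ell ?z + s) * H ?z) =
          w * (gamma w ?z * exp (?z * s)) - s * (s - w) * H ?z"
        unfolding gamma_eq[OF of_real_in_strip] H_def exp_add by (simp add: algebra_simps power2_eq_square)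
      finally show "(K has_field_derivative w * (gamma w ?z * exp (?z * s)) - s * (s - w) * H ?z) (at ?z)" .
    qed
    show "integrable lborel (\<lambda>x. w * (gamma w (of_real x) * exp (of_real x * s)) - s * (s - w) * H (of_real x))"
      by (intro Bochner_Integration.integrable_diff integrable_mult_right g_int H_int)
    show "norm (K (of_real x)) \<le> ((norm w * B + norm (w - s)) * C) * exp (- a * \<bar>x\<bar>)" for x :: real
    proof -
      have "norm (w * deriv ell (of_real x) + (w - s)) \<le> norm w * norm (deriv ell (of_real x)) + norm (w - s)"
        by (metis norm_mult norm_triangle_ineq)
      also have "\<dots> \<le> norm w * B + norm (w - s)" by (intro add_mono mult_left_mono B) auto
      finally have "norm (K (of_real x)) \<le> (norm w * B + norm (w - s)) * (C * exp (- a * \<bar>x\<bar>))"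
        unfolding K_def norm_mult using B Ca by (intro mult_mono) (auto simp: add_diff_eq)
      thus ?thesis by (simp add: mult_ac)
    qed
  qed (rule Ca)
  hence "w * (LINT x|lborel. gamma w (of_real x) * exp (of_real x * s)) = s * (s - w) * (LINT x|lborel. H (of_real x))"
    using g_int H_int by (simp add: Bochner_Integration.integral_diff)
  moreover have w: "w \<noteq> 0" using assms by auto
  ultimately have "(LINT x|lborel. gamma w (of_real x) * exp (of_real x * s)) = s * (s - w) * (LINT x|lborel. H (of_real x)) / w"
    by (metis nonzero_mult_div_cancel_left)
  thus ?thesis unfolding xi_integral_def Z by simp
qed

text \<open>This discharges the definite description: existence of the entire extension is obtained
  from the integral itself.\<close>

lemma xi_Q_eq: "xi_Q = xi_integral"
  unfolding xi_Q_def
proof (rule the_equality)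
  show "entire2 xi_integral \<and> (\<forall>w s. Re w < Re s \<and> Re s < 0 \<longrightarrow> xi_integral w s = s * (s - w) / (2 * w) * Z_Q w s)"
    using entire2_xi_integral xi_integral_eq_Z_Q by blast
  show "F = xi_integral"
    if "entire2 F \<and> (\<forall>w s. Re w < Re s \<and> Re s < 0 \<longrightarrow> F w s = s * (s - w) / (2 * w) * Z_Q w s)" for F
    by (rule entire2_unique) (use that entire2_xi_integral xi_integral_eq_Z_Q in auto)
qed

section \<open>Schwartz seminorms by Cauchy's inequality\<close>

text \<open>Along a horizontal line the real derivatives are the complex ones, which opens them to
  Cauchy's inequality.\<close>

lemma nth_vderiv_holomorphic:
  assumes "f holomorphic_on S" "open S" "\<And>x. Complex x y \<in> S"
  shows "nth_vderiv m (\<lambda>x. f (Complex x y)) = (\<lambda>x. (deriv ^^ m) f (Complex x y))"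
    and "nth_vderiv m (\<lambda>x. f (Complex x y)) differentiable (at x)"
proof -
  have d: "((\<lambda>x. (deriv ^^ m) f (Complex x y)) has_vector_derivative deriv ((deriv ^^ m) f) (Complex x y)) (at x)" for x m
    by (intro holomorphic_has_vector_derivative holomorphic_derivI[OF _ assms(2)] holomorphic_higher_deriv assms)
  show eq: "nth_vderiv m (\<lambda>x. f (Complex x y)) = (\<lambda>x. (deriv ^^ m) f (Complex x y))"
  proof (induction m)
    case (Suc m)
    have "nth_vderiv (Suc m) (\<lambda>x. f (Complex x y)) = (\<lambda>x. vector_derivative (nth_vderiv m (\<lambda>x. f (Complex x y))) (at x))"
      by (simp add: nth_vderiv_def)
    also have "\<dots> = (\<lambda>x. (deriv ^^ Suc m) f (Complex x y))"
      unfolding Suc.IH using vector_derivative_at[OF d] by simp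
    finally show ?case .
  qed (simp add: nth_vderiv_def)
  show "nth_vderiv m (\<lambda>x. f (Complex x y)) differentiable (at x)"
    unfolding eq using d by (rule differentiableI_vector)
qed

lemma power_abs_le_exp: "\<bar>x::real\<bar> ^ k \<le> fact k * exp \<bar>x\<bar>"
proof -
  have "(\<Sum>n\<in>{k}. inverse (fact n) * \<bar>x\<bar> ^ n) \<le> (\<Sum>n. inverse (fact n) * \<bar>x\<bar> ^ n)"
    by (rule sum_le_suminf[OF summable_exp]) auto
  also have "\<dots> = exp \<bar>x\<bar>" by (simp add: exp_def)
  finally show ?thesis by (simp add: field_simps)
qed

text \<open>The weight e^{sigma x} is not holomorphic in x + iy. On the line Im z = y it equals
  e^{sigma z} times a constant phase of modulus 1, which is holomorphic; hence y is a parameter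
  separate from z.\<close>

definition weighted_gamma :: "complex \<Rightarrow> real \<Rightarrow> real \<Rightarrow> complex \<Rightarrow> complex" where
  "weighted_gamma w \<sigma> y z = exp (- \<i> * of_real (y * \<sigma>)) * (gamma w z * exp (z * of_real \<sigma>))"

lemma weighted_gamma_eq: "of_real (exp (\<sigma> * x)) * gamma w (Complex x y) = weighted_gamma w \<sigma> y (Complex x y)"
proof -
  have "complex_of_real (exp (\<sigma> * x)) = exp (- \<i> * of_real (y * \<sigma>)) * exp (Complex x y * of_real \<sigma>)"
    unfolding Complex_eq exp_add[symmetric] exp_of_real[symmetric] by (simp add: algebra_simps)
  thus ?thesis by (simp add: weighted_gamma_def)
qed

lemma weighted_gamma_holomorphic: "weighted_gamma w \<sigma> y holomorphic_on strip"
  unfolding weighted_gamma_def by (intro holomorphic_intros gamma_holomorphic)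

text \<open>Cauchy's inequality on discs of radius delta/2 gives decay e^{-|x|} for every
  derivative, and |x|^k <= k! e^{|x|} consumes exactly that. The constant depends on the parameters
  only through R and delta, which is the uniformity.\<close>

lemma weighted_gamma_schwartz_bound:
  assumes "\<delta> > 0" "\<delta> < pi / 4" "R \<ge> 0"
  shows "\<exists>C. \<forall>w \<sigma> y x. norm w \<le> R \<longrightarrow> \<bar>\<sigma>\<bar> \<le> R \<longrightarrow> \<bar>y\<bar> \<le> pi / 4 - \<delta> \<longrightarrow>
     \<bar>x\<bar> ^ k * norm (nth_vderiv m (\<lambda>u. of_real (exp (\<sigma> * u)) * gamma w (Complex u y)) x) \<le> C"
proof -
  define r where "r = \<delta> / 2"
  have r: "r > 0" "r < pi / 4" using assms by (auto simp: r_def)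
  obtain C where C: "C \<ge> 0" "\<And>w s z. norm w \<le> R \<Longrightarrow> norm s \<le> R \<Longrightarrow> \<bar>Im z\<bar> \<le> pi / 4 - r \<Longrightarrow>
        norm (gamma w z * exp (z * s)) \<le> C * exp (- 1 * \<bar>Re z\<bar>)"
    using gamma_exp_bound[OF r _ assms(3), of 1] by auto
  show ?thesis
  proof (intro exI[of _ "fact k * (fact m * (C * exp r) / r ^ m)"] allI impI)
    fix w :: complex and \<sigma> y x :: real
    assume *: "norm w \<le> R" "\<bar>\<sigma>\<bar> \<le> R" "\<bar>y\<bar> \<le> pi / 4 - \<delta>"
    define G where "G = weighted_gamma w \<sigma> y"
    have in_strip: "Complex x y \<in> strip" for x using * assms by (simp add: strip_def)
    have near: "\<bar>x\<bar> - r \<le> \<bar>Re u\<bar>" "\<bar>Im u\<bar> \<le> pi / 4 - r" if "norm (Complex x y - u) \<le> r" for u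
      using abs_Re_le_cmod[of "Complex x y - u"] abs_Im_le_cmod[of "Complex x y - u"] that *(3)
      unfolding r_def by auto
    have sub: "cball (Complex x y) r \<subseteq> strip"
    proof
      fix u assume "u \<in> cball (Complex x y) r"
      hence "\<bar>Im u\<bar> \<le> pi / 4 - r" by (intro near) (simp add: dist_norm)
      thus "u \<in> strip" using r by (simp add: strip_def)
    qed
    have "norm ((deriv ^^ m) G (Complex x y)) \<le> fact m * (C * exp r * exp (- \<bar>x\<bar>)) / r ^ m"
    proof (rule Cauchy_inequality)
      show "G holomorphic_on ball (Complex x y) r"
        unfolding G_def by (rule holomorphic_on_subset[OF weighted_gamma_holomorphic]) (use sub in auto)
      show "continuous_on (cball (Complex x y) r) G"
        unfolding G_def
        by (rule continuous_on_subset[OF holomorphic_on_imp_continuous_on[OF weighted_gamma_holomorphic] sub])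
      fix u assume u: "norm (Complex x y - u) = r"
      have "norm (G u) = norm (gamma w u * exp (u * of_real \<sigma>))"
        unfolding G_def weighted_gamma_def norm_mult by simp
      also have "\<dots> \<le> C * exp (- 1 * \<bar>Re u\<bar>)"
        using * near(2)[of u] u by (intro C(2)) auto
      also have "\<dots> \<le> C * exp (r + - \<bar>x\<bar>)"
        using near(1)[of u] u C(1) by (intro mult_left_mono) auto
      also have "\<dots> = C * exp r * exp (- \<bar>x\<bar>)" unfolding exp_add by simp
      finally show "norm (G u) \<le> C * exp r * exp (- \<bar>x\<bar>)" .
    qed (rule r)
    moreover have "nth_vderiv m (\<lambda>u. of_real (exp (\<sigma> * u)) * gamma w (Complex u y)) x = (deriv ^^ m) G (Complex x y)"
      unfolding weighted_gamma_eq G_def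
      using nth_vderiv_holomorphic(1)[OF weighted_gamma_holomorphic open_strip in_strip] by metis
    ultimately have "\<bar>x\<bar> ^ k * norm (nth_vderiv m (\<lambda>u. of_real (exp (\<sigma> * u)) * gamma w (Complex u y)) x) \<le>
       (fact k * exp \<bar>x\<bar>) * (fact m * (C * exp r * exp (- \<bar>x\<bar>)) / r ^ m)"
      by (intro mult_mono power_abs_le_exp) auto
    also have "\<dots> = fact k * (fact m * (C * exp r) / r ^ m) * (exp \<bar>x\<bar> * exp (- \<bar>x\<bar>))"
      by simp
    also have "exp \<bar>x\<bar> * exp (- \<bar>x\<bar>) = 1" by (simp add: exp_minus)
    finally show "\<bar>x\<bar> ^ k * norm (nth_vderiv m (\<lambda>u. of_real (exp (\<sigma> * u)) * gamma w (Complex u y)) x) \<le>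
       fact k * (fact m * (C * exp r) / r ^ m)" by simp
  qed
qed

lemma weighted_gamma_schwartz:
  assumes "- pi / 4 < y" "y < pi / 4"
  shows "(\<lambda>x. of_real (exp (\<sigma> * x)) * gamma w (Complex x y)) \<in> schwartz"
proof -
  obtain \<delta> where d: "\<delta> > 0" "\<delta> < pi / 4" "\<bar>y\<bar> \<le> pi / 4 - \<delta>"
    using strip_margin[OF assms] by blast
  have "nth_vderiv m (\<lambda>x. of_real (exp (\<sigma> * x)) * gamma w (Complex x y)) differentiable (at x)" for m x
    unfolding weighted_gamma_eq
    by (rule nth_vderiv_holomorphic(2)[OF weighted_gamma_holomorphic open_strip Complex_in_strip[OF assms]])
  moreover have "\<exists>C. \<forall>x. \<bar>x\<bar> ^ k * norm (nth_vderiv m (\<lambda>x. of_real (exp (\<sigma> * x)) * gamma w (Complex x y)) x) \<le> C" for k m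
  proof -
    have "0 \<le> max (norm w) \<bar>\<sigma>\<bar>" "norm w \<le> max (norm w) \<bar>\<sigma>\<bar>" "\<bar>\<sigma>\<bar> \<le> max (norm w) \<bar>\<sigma>\<bar>" by auto
    thus ?thesis using weighted_gamma_schwartz_bound[OF d(1,2), of "max (norm w) \<bar>\<sigma>\<bar>" k m] d(3) by meson
  qed
  ultimately show ?thesis unfolding schwartz_def by blast
qed

text \<open>On a compact set |y| attains a maximum below pi/4, which gives a common margin, and the
  norm bound R covers w and sigma at once.\<close>

lemma weighted_gamma_schwartz_uniform:
  fixes K :: "(complex \<times> real \<times> real) set"
  assumes "compact K" "K \<subseteq> {(w, \<sigma>, y). - pi / 4 < y \<and> y < pi / 4}"
  shows "\<exists>C. \<forall>(w, \<sigma>, y) \<in> K. \<forall>x.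
         \<bar>x\<bar> ^ k * norm (nth_vderiv m (\<lambda>u. of_real (exp (\<sigma> * u)) * gamma w (Complex u y)) x) \<le> C"
proof (cases "K = {}")
  case False
  have "continuous_on K (\<lambda>p. \<bar>snd (snd p)\<bar>)" by (intro continuous_intros)
  from continuous_attains_sup[OF assms(1) False this]
  obtain p where p: "p \<in> K" "\<And>q. q \<in> K \<Longrightarrow> \<bar>snd (snd q)\<bar> \<le> \<bar>snd (snd p)\<bar>" by blast
  have "- pi / 4 < snd (snd p)" "snd (snd p) < pi / 4" using assms(2) p(1) by (auto simp: case_prod_unfold)
  from strip_margin[OF this]
  obtain \<delta> where d: "\<delta> > 0" "\<delta> < pi / 4" "\<bar>snd (snd p)\<bar> \<le> pi / 4 - \<delta>" by blast
  obtain R where R: "R > 0" "\<And>q. q \<in> K \<Longrightarrow> norm q \<le> R"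
    using compact_imp_bounded[OF assms(1)] unfolding bounded_pos by blast
  have "norm w \<le> R" "\<bar>\<sigma>\<bar> \<le> R" "\<bar>y\<bar> \<le> pi / 4 - \<delta>" if "(w, \<sigma>, y) \<in> K" for w \<sigma> y
    using R(2)[OF that] p(2)[OF that] d(3) norm_fst_le[of w "(\<sigma>, y)"] norm_snd_le[of "(\<sigma>, y)" w] norm_fst_le[of \<sigma> y]
    by auto
  moreover obtain C where "\<forall>w \<sigma> y x. norm w \<le> R \<longrightarrow> \<bar>\<sigma>\<bar> \<le> R \<longrightarrow> \<bar>y\<bar> \<le> pi / 4 - \<delta> \<longrightarrow>
     \<bar>x\<bar> ^ k * norm (nth_vderiv m (\<lambda>u. of_real (exp (\<sigma> * u)) * gamma w (Complex u y)) x) \<le> C"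
    using weighted_gamma_schwartz_bound[OF d(1,2) less_imp_le[OF R(1)], of k m] by blast
  ultimately show ?thesis by (intro exI[of _ C]) blast
qed auto

text \<open>Integrability is asserted next to the formula because the integral of a non-integrable
  function would silently be 0.\<close>

theorem theorem4p4:
  "(\<forall>(w::complex) (y::real) (s::complex). - pi / 4 < y \<and> y < pi / 4 \<longrightarrow>
      integrable lborel (\<lambda>x::real. gamma w (Complex x y) * exp (Complex x y * s)) \<and>
      xi_Q w s = 1 / 2 * (LINT x|lborel. gamma w (Complex x y) * exp (Complex x y * s))) \<and>
   (\<forall>(w::complex) (\<sigma>::real) (y::real). - pi / 4 < y \<and> y < pi / 4 \<longrightarrow>
      (\<lambda>x. of_real (exp (\<sigma> * x)) * gamma w (Complex x y)) \<in> schwartz) \<and>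
   (\<forall>K :: (complex \<times> real \<times> real) set.
      compact K \<and> K \<subseteq> {(w, \<sigma>, y). - pi / 4 < y \<and> y < pi / 4} \<longrightarrow>
      (\<forall>k m. \<exists>C. \<forall>(w, \<sigma>, y) \<in> K. \<forall>x.
         \<bar>x\<bar> ^ k * norm (nth_vderiv m (\<lambda>u. of_real (exp (\<sigma> * u)) * gamma w (Complex u y)) x) \<le> C))"
proof (intro conjI allI impI)
  fix w s :: complex and y :: real assume y: "- pi / 4 < y \<and> y < pi / 4"
  thus "integrable lborel (\<lambda>x::real. gamma w (Complex x y) * exp (Complex x y * s))"
    by (intro gamma_exp_integrable) auto
  show "xi_Q w s = 1 / 2 * (LINT x|lborel. gamma w (Complex x y) * exp (Complex x y * s))"
    unfolding xi_Q_eq xi_integral_def using gamma_integral_shift[of y w s] y by simp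
next
  fix w :: complex and \<sigma> y :: real assume "- pi / 4 < y \<and> y < pi / 4"
  thus "(\<lambda>x. of_real (exp (\<sigma> * x)) * gamma w (Complex x y)) \<in> schwartz"
    by (intro weighted_gamma_schwartz) auto
next
  fix K :: "(complex \<times> real \<times> real) set" and k m
  assume "compact K \<and> K \<subseteq> {(w, \<sigma>, y). - pi / 4 < y \<and> y < pi / 4}"
  thus "\<exists>C. \<forall>(w, \<sigma>, y) \<in> K. \<forall>x.
         \<bar>x\<bar> ^ k * norm (nth_vderiv m (\<lambda>u. of_real (exp (\<sigma> * u)) * gamma w (Complex u y)) x) \<le> C"
    by (intro weighted_gamma_schwartz_uniform) auto
qed

end
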